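(* For any $S_0\in\mathcal{D}$, the following hold for the continuous-time exclusion-voter process $\eta$ with parameters $(\beta,p)$: (i) if $p\in[0,1/2)$ and $\beta\in[4/7,1]$, then $\eta$ is recurrent, that is, $\mathbb{P}_{\beta,p}(\tau_{\mathrm{c}}<\infty\mid\eta_0=S_0)=1$; (ii) if $\beta=0$ and $p\in(1/2,1]$, then for any $s\in[0,\infty)$, $\mathbb{E}_{0,p}[\tau_{\mathrm{c}}^{s}\mid\eta_0=S_0]<\infty$; (iii) if $\beta\in[0,1]$ and $p\in(1/2,1]$, then $\mathbb{E}_{\beta,p}[\tau_{\mathrm{c}}^{6/5}\mid\eta_0=S_0]<\infty$.
   Context: Configurations: let $\mathcal{D}'\subset\{0,1\}^{\mathbb{Z}}$ be the set of configurations with finitely many $0$'s to the left of the origin and finitely many $1$'s to the right. Call $S,S'\in\mathcal{D}'$ equivalent if they are translates of each other, and let $\mathcal{D}$ be the (countable) set of equivalence classes. The ground state is $\mathcal{D}_0=\ldots 111000\ldots$ (up to translation). Continuous-time process: for $\nu=(\nu(x))_{x\in\mathbb{Z}}\in\{0,1\}^{\mathbb{Z}}$ let $\nu_{x,y}$ be $\nu$ with the labels at $x$ and $y$ interchanged, and $\nu_x$ be $\nu$ with the label at $x$ replaced by its opposite. For functions $f$ on $\{0,1\}^{\mathbb{Z}}$ define $$\Omega^{\mathrm e}_pf(\nu)=\sum_{x,y}p(x,y)\,\nu(x)(1-\nu(y))[f(\nu_{x,y})-f(\nu)],\qquad \Omega^{\mathrm v}f(\nu)=\sum_x c(x,\nu)[f(\nu_x)-f(\nu)],$$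 where $p(x,x-1)=p$, $p(x,x+1)=1-p$, $p(x,y)=0$ if $|x-y|\ne1$, and $$c(x,\nu)=\begin{cases}\frac12(\nu(x-1)+\nu(x+1)), & \nu(x)=0,\\ \frac12(2-\nu(x-1)-\nu(x+1)), & \nu(x)=1.\end{cases}$$ For $\beta,p\in[0,1]$, let $(\eta'_t)_{t\ge0}$ be the Markov process on $\mathcal{D}'$ with generator $(1-\beta)\Omega^{\mathrm e}_p+\beta\Omega^{\mathrm v}$, and let $\eta=(\eta_t)_{t\ge0}$ be the induced Markov process on $\mathcal{D}$, where $\eta_t$ is the equivalence class of $\eta'_t$. Law and expectation are denoted $\mathbb{P}_{\beta,p}$, $\mathbb{E}_{\beta,p}$. Relaxation time: $\tau_{\mathrm{c}}=\inf\{t\ge0:\eta_t=\mathcal{D}_0\}$ (with $\inf\varnothing=+\infty$). *)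

theory Defs
  imports "HOL-Probability.Probability"
begin

section \<open>Markov processes on a countable state space\<close>

definition transition_function :: "'s set \<Rightarrow> (real \<Rightarrow> 's \<Rightarrow> 's pmf) \<Rightarrow> bool" where
  "transition_function S K \<longleftrightarrow>
     (\<forall>t\<ge>0. \<forall>i\<in>S. set_pmf (K t i) \<subseteq> S) \<and>
     (\<forall>i\<in>S. K 0 i = return_pmf i) \<and>
     (\<forall>s\<ge>0. \<forall>t\<ge>0. \<forall>i\<in>S. K (s + t) i = bind_pmf (K s i) (K t))"

text \<open>The jump rates of the exclusion-voter process are finite at every configuration but not
  bounded, so the difference quotient of the semigroup is required to converge pointwise,
  for every bounded function.\<close>

definition has_generator ::
  "'s set \<Rightarrow> (real \<Rightarrow> 's \<Rightarrow> 's pmf) \<Rightarrow> (('s \<Rightarrow> real) \<Rightarrow> 's \<Rightarrow> real) \<Rightarrow> bool" where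
  "has_generator S K G \<longleftrightarrow>
     (\<forall>f. bounded (range f) \<longrightarrow>
        (\<forall>i\<in>S. ((\<lambda>t. (measure_pmf.expectation (K t i) f - f i) / t) \<longlongrightarrow> G f i) (at_right 0)))"

definition natural_filtration ::
  "'a measure \<Rightarrow> (real \<Rightarrow> 'a \<Rightarrow> 's) \<Rightarrow> real \<Rightarrow> 'a measure" where
  "natural_filtration M X s =
     sigma (space M) {X r -` B \<inter> space M | r B. 0 \<le> r \<and> r \<le> s}"

text \<open>The state space \<open>S\<close> carries the discrete topology: right-continuity of a path means that
  it stays constant for a positive time after every time.  No initial law is prescribed.\<close>

definition markov_process ::
  "'a measure \<Rightarrow> 's set \<Rightarrow> (('s \<Rightarrow> real) \<Rightarrow> 's \<Rightarrow> real) \<Rightarrow> (real \<Rightarrow> 'a \<Rightarrow> 's) \<Rightarrow> bool" where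
  "markov_process M S G X \<longleftrightarrow>
     prob_space M \<and>
     (\<forall>t\<ge>0. X t \<in> measurable M (count_space S)) \<and>
     (\<forall>\<omega>\<in>space M. \<forall>t\<ge>0. \<forall>\<^sub>F s in at_right t. X s \<omega> = X t \<omega>) \<and>
     (\<exists>K. transition_function S K \<and> has_generator S K G \<and>
        (\<forall>s\<ge>0. \<forall>t\<ge>0. \<forall>j\<in>S. AE \<omega> in M.
           real_cond_exp M (natural_filtration M X s) (indicator {\<omega>'. X (s + t) \<omega>' = j}) \<omega>
             = pmf (K t (X s \<omega>)) j))"

section \<open>Configurations\<close>

type_synonym config = "int \<Rightarrow> bool"

definition configs :: "config set" where
  "configs = {\<nu>. finite {x. x < 0 \<and> \<not> \<nu> x} \<and> finite {x. x > 0 \<and> \<nu> x}}"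

definition translate_rel :: "(config \<times> config) set" where
  "translate_rel = {(\<nu>, \<nu>'). \<nu> \<in> configs \<and> \<nu>' \<in> configs \<and> (\<exists>k. \<forall>x. \<nu>' x = \<nu> (x + k))}"

definition config_classes :: "config set set" where
  "config_classes = configs // translate_rel"

definition config_class :: "config \<Rightarrow> config set" where
  "config_class \<nu> = translate_rel `` {\<nu>}"

definition ground_state :: "config set" where
  "ground_state = config_class (\<lambda>x. x \<le> 0)"

section \<open>The exclusion-voter process\<close>

definition jump_prob :: "real \<Rightarrow> int \<Rightarrow> int \<Rightarrow> real" where
  "jump_prob p x y = (if y = x - 1 then p else if y = x + 1 then 1 - p else 0)"

definition flip_rate :: "int \<Rightarrow> config \<Rightarrow> real" where
  "flip_rate x \<nu> =
     (if \<nu> x then (2 - of_bool (\<nu> (x - 1)) - of_bool (\<nu> (x + 1))) / 2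
      else (of_bool (\<nu> (x - 1)) + of_bool (\<nu> (x + 1))) / 2)"

text \<open>For configurations in \<^const>\<open>configs\<close> both infinite sums below have only finitely many
  nonzero terms, see \<open>finite_exclusion_terms\<close> and \<open>finite_voter_terms\<close>.\<close>

definition exclusion_generator :: "real \<Rightarrow> (config \<Rightarrow> real) \<Rightarrow> config \<Rightarrow> real" where
  "exclusion_generator p f \<nu> =
     (\<Sum>\<^sub>\<infinity>(x, y)\<in>UNIV. jump_prob p x y * of_bool (\<nu> x) * (1 - of_bool (\<nu> y)) *
        (f (\<nu>(x := \<nu> y, y := \<nu> x)) - f \<nu>))"

definition voter_generator :: "(config \<Rightarrow> real) \<Rightarrow> config \<Rightarrow> real" where
  "voter_generator f \<nu> = (\<Sum>\<^sub>\<infinity>x\<in>UNIV. flip_rate x \<nu> * (f (\<nu>(x := \<not> \<nu> x)) - f \<nu>))"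

definition exclusion_voter_generator ::
  "real \<Rightarrow> real \<Rightarrow> (config \<Rightarrow> real) \<Rightarrow> config \<Rightarrow> real" where
  "exclusion_voter_generator \<beta> p f \<nu> =
     (1 - \<beta>) * exclusion_generator p f \<nu> + \<beta> * voter_generator f \<nu>"

definition exclusion_voter_process ::
  "'a measure \<Rightarrow> real \<Rightarrow> real \<Rightarrow> (real \<Rightarrow> 'a \<Rightarrow> config set) \<Rightarrow> bool" where
  "exclusion_voter_process M \<beta> p \<eta> \<longleftrightarrow>
     (\<exists>\<eta>'. markov_process M configs (exclusion_voter_generator \<beta> p) \<eta>' \<and>
        (\<forall>t\<ge>0. \<forall>\<omega>\<in>space M. \<eta> t \<omega> = config_class (\<eta>' t \<omega>)))"

definition relaxation_time :: "(real \<Rightarrow> 'a \<Rightarrow> config set) \<Rightarrow> 'a \<Rightarrow> ennreal" where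
  "relaxation_time \<eta> \<omega> = Inf {ennreal t | t. 0 \<le> t \<and> \<eta> t \<omega> = ground_state}"

text \<open>Powers with exponent \<open>s \<ge> 0\<close>, with \<open>x\<^sup>0 = 1\<close> for all \<open>x\<close> and \<open>\<infinity>\<^sup>s = \<infinity>\<close> for \<open>s > 0\<close>;
  note that \<open>0 powr 0 = 0\<close> for the real power.\<close>

definition ennreal_powr :: "ennreal \<Rightarrow> real \<Rightarrow> ennreal" where
  "ennreal_powr x s =
     (if s = 0 then 1 else if x = \<infinity> then \<infinity> else ennreal (enn2real x powr s))"

definition cond_nn_expectation :: "'a measure \<Rightarrow> ('a \<Rightarrow> ennreal) \<Rightarrow> ('a \<Rightarrow> bool) \<Rightarrow> ennreal" where
  "cond_nn_expectation M f Q = (\<integral>\<^sup>+\<omega>. f \<omega> \<partial>uniform_measure M {\<omega>\<in>space M. Q \<omega>})"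

section \<open>Well-definedness\<close>

lemma equiv_translate_rel: "equiv configs translate_rel"
proof (rule equivI)
  show "refl_on configs translate_rel"
    by (auto simp: refl_on_def translate_rel_def intro: exI[of _ 0])
  show "translate_rel \<subseteq> configs \<times> configs"
    by (auto simp: translate_rel_def)
  show "sym translate_rel"
  proof (rule symI)
    fix \<nu> \<nu>' assume "(\<nu>, \<nu>') \<in> translate_rel"
    then obtain k where k: "\<nu> \<in> configs" "\<nu>' \<in> configs" "\<forall>x. \<nu>' x = \<nu> (x + k)"
      by (auto simp: translate_rel_def)
    then have "\<forall>x. \<nu> x = \<nu>' (x + (- k))" by simp
    with k show "(\<nu>', \<nu>) \<in> translate_rel" unfolding translate_rel_def by blast
  qed
  show "trans translate_rel"
  proof (rule transI)
    fix \<nu> \<nu>' \<nu>'' assume "(\<nu>, \<nu>') \<in> translate_rel" "(\<nu>', \<nu>'') \<in> translate_rel"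
    then obtain k l where k: "\<nu> \<in> configs" "\<nu>'' \<in> configs"
        "\<forall>x. \<nu>' x = \<nu> (x + k)" "\<forall>x. \<nu>'' x = \<nu>' (x + l)"
      by (auto simp: translate_rel_def)
    then have "\<forall>x. \<nu>'' x = \<nu> (x + (l + k))" by (simp add: add.assoc)
    with k show "(\<nu>, \<nu>'') \<in> translate_rel" unfolding translate_rel_def by blast
  qed
qed

lemma ground_state_in_config_classes: "ground_state \<in> config_classes"
proof -
  have empty: "{x::int. x < 0 \<and> \<not> x \<le> 0} = {}" "{x::int. x > 0 \<and> x \<le> 0} = {}"
    by auto
  have "(\<lambda>x. x \<le> 0) \<in> configs"
    by (simp only: configs_def mem_Collect_eq empty finite.emptyI simp_thms)
  then show ?thesis
    unfolding ground_state_def config_classes_def config_class_def by (rule quotientI)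
qed

lemma finite_boundary:
  assumes "\<nu> \<in> configs"
  shows "finite {x. \<nu> x \<noteq> \<nu> (x + 1)}"
proof -
  let ?A = "{x. x < 0 \<and> \<not> \<nu> x} \<union> {x. x > 0 \<and> \<nu> x}"
  have "{x. \<nu> x \<noteq> \<nu> (x + 1)} \<subseteq> {-1, 0} \<union> ?A \<union> (\<lambda>x. x - 1) ` ?A"
  proof
    fix x assume "x \<in> {x. \<nu> x \<noteq> \<nu> (x + 1)}"
    then have "x = -1 \<or> x = 0 \<or> x \<in> ?A \<or> x + 1 \<in> ?A" by auto
    moreover have "x = (x + 1) - 1" by simp
    ultimately show "x \<in> {-1, 0} \<union> ?A \<union> (\<lambda>x. x - 1) ` ?A" by blast
  qed
  moreover have "finite ({-1, 0} \<union> ?A \<union> (\<lambda>x. x - 1) ` ?A)"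
    using assms unfolding configs_def by auto
  ultimately show ?thesis by (rule finite_subset)
qed

lemma finite_exclusion_terms:
  assumes "\<nu> \<in> configs"
  shows "finite {(x, y). jump_prob p x y * of_bool (\<nu> x) * (1 - of_bool (\<nu> y)) \<noteq> (0::real)}"
proof -
  let ?B = "{x. \<nu> x \<noteq> \<nu> (x + 1)}"
  have "{(x, y). jump_prob p x y * of_bool (\<nu> x) * (1 - of_bool (\<nu> y)) \<noteq> (0::real)}
          \<subseteq> (\<lambda>x. (x, x + 1)) ` ?B \<union> (\<lambda>x. (x + 1, x)) ` ?B"
  proof clarify
    fix x y
    assume nz: "jump_prob p x y * of_bool (\<nu> x) * (1 - of_bool (\<nu> y)) \<noteq> (0::real)"
      and "(x, y) \<notin> (\<lambda>x. (x + 1, x)) ` ?B"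
    then have "y = x + 1 \<or> y = x - 1" and "\<nu> x" "\<not> \<nu> y"
      by (auto simp: jump_prob_def split: if_splits)
    then show "(x, y) \<in> (\<lambda>x. (x, x + 1)) ` ?B"
      using \<open>(x, y) \<notin> _\<close> by (auto simp: image_iff)
  qed
  with finite_boundary[OF assms] show ?thesis by (auto intro: finite_subset)
qed

lemma finite_voter_terms:
  assumes "\<nu> \<in> configs"
  shows "finite {x. flip_rate x \<nu> \<noteq> 0}"
proof -
  let ?B = "{x. \<nu> x \<noteq> \<nu> (x + 1)}"
  have "{x. flip_rate x \<nu> \<noteq> 0} \<subseteq> ?B \<union> (\<lambda>x. x + 1) ` ?B"
  proof
    fix x assume "x \<in> {x. flip_rate x \<nu> \<noteq> 0}"
    then have "x \<in> ?B \<or> x - 1 \<in> ?B"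
      by (auto simp: flip_rate_def split: if_splits)
    moreover have "x = (x - 1) + 1" by simp
    ultimately show "x \<in> ?B \<union> (\<lambda>x. x + 1) ` ?B" by blast
  qed
  with finite_boundary[OF assms] show ?thesis by (auto intro: finite_subset)
qed

end

theory Submission
  imports Defs
begin

text \<open>
  The survival probability \<open>P\<^sub>i(\<tau> > t)\<close> of the ground state is bounded from above by the limit
  of the probabilities of avoiding it along dyadic time grids. This limit satisfies
  \<open>survival (t + h) \<le> K h (survival t)\<close>, so its Laplace-type transforms
  \<open>R i = \<integral> e\<^sup>-\<^sup>\<lambda>\<^sup>t (1 + t)\<^sup>r P\<^sub>i(\<tau> > t) dt\<close> are bounded functions, to which the generator may be
  applied, with \<open>L R \<ge> \<lambda> R - D\<close> off the ground state, where
  \<open>D i = c + 2 r \<integral> (1 + t)\<^sup>r\<^sup>-\<^sup>1 P\<^sub>i(\<tau> > t) dt\<close>.  A maximum principle then gives \<open>R \<le> V\<close> for every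
  \<open>V \<ge> 0\<close> with \<open>L V \<le> - D\<close> and bounded jump rates on its level sets; the bound is uniform in \<open>\<lambda>\<close>,
  and moments of \<open>\<tau>\<close> are bounded one power of \<open>t\<close> after the other.

  Let \<open>f\<close> be the number of inversions, \<open>I\<close> the sum of the lengths of the inversions, and \<open>N\<close> the
  number of \<open>01\<close> boundaries. The voter dynamics maps \<open>f\<close> to \<open>- N\<close> and \<open>I\<close> to \<open>0\<close>; for \<open>p > 1/2\<close> the
  exclusion dynamics has a drift of \<open>I\<close> which is negative and at least of the order of the length
  of the hybrid zone, up to a term \<open>N + 1 - p\<close> that a multiple of \<open>f\<close> compensates.  The Lyapunov
  functions are \<open>ln (1 + f)\<close> for (i), powers of \<open>I + \<alpha> f\<close> for (ii) and for (iii) with \<open>\<beta> < 1\<close>,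
  and \<open>f\<close> together with \<open>I\<^sup>4\<^sup>/\<^sup>5\<close> for (iii) with \<open>\<beta> = 1\<close>. Where they have the wrong drift,
  which happens only when \<open>f\<close> is bounded, a multiple of the bounded function \<open>1 - \<epsilon>\<^sup>f\<close> corrects it.
\<close>

section \<open>Survival probabilities of a transition function\<close>

text \<open>Hence the roles are exchanged: the semigroup acts only on bounded functionals of the
  survival probability, and \<open>L V\<close> is a finite algebraic sum. Hitting is expressed by
  finite time grids because these involve the kernels \<open>K\<close> alone, neither stopping times
  nor a strong Markov property; only upper bounds on survival are wanted, so one-sided inequalities
  suffice. The exponent 6/5 is r + 1 for r = 1/5. At \<beta> = 1 the generator annihilates the
  spread, so decay can only come from the concavity of a power of it, and the power 4/5 yields a
  drift of order f^(1/5). As f itself bounds the expected hitting time, the term D for r = 1/5 is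
  also of order f^(1/5), and the two match.\<close>

locale taboo_semigroup =
  fixes S :: "'s set" and K :: "real \<Rightarrow> 's \<Rightarrow> 's pmf" and T :: "'s set"
  assumes transition_function: "transition_function S K"
begin

lemma set_pmf_K: "0 \<le> t \<Longrightarrow> i \<in> S \<Longrightarrow> set_pmf (K t i) \<subseteq> S"
  and K_0: "i \<in> S \<Longrightarrow> K 0 i = return_pmf i"
  and K_add: "0 \<le> s \<Longrightarrow> 0 \<le> t \<Longrightarrow> i \<in> S \<Longrightarrow> K (s + t) i = bind_pmf (K s i) (K t)"
  using transition_function unfolding transition_function_def by auto

lemma nn_integral_K_mono:
  assumes "0 \<le> t" "i \<in> S" "\<And>j. j \<in> S \<Longrightarrow> f j \<le> g j"
  shows "(\<integral>\<^sup>+j. f j \<partial>K t i) \<le> (\<integral>\<^sup>+j. g j \<partial>K t i)"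
  using set_pmf_K[OF assms(1,2)] assms(3) by (intro nn_integral_mono_AE) (auto simp: AE_measure_pmf_iff)

lemma nn_integral_K_add:
  assumes "0 \<le> s" "0 \<le> t" "i \<in> S"
  shows "(\<integral>\<^sup>+j. f j \<partial>K (s + t) i) = (\<integral>\<^sup>+j. \<integral>\<^sup>+k. f k \<partial>K t j \<partial>K s i)"
  using K_add[OF assms] by simp

text \<open>This is the taboo probability of being outside \<open>T\<close> at all of the k + 1
  times 0, h, ..., kh when starting at \<open>i\<close>; time 0 is included, so it vanishes on
  \<open>T\<close>.\<close>

primrec avoid :: "real \<Rightarrow> nat \<Rightarrow> 's \<Rightarrow> ennreal" where
  "avoid h 0 i = indicator (- T) i"
| "avoid h (Suc k) i = indicator (- T) i * (\<integral>\<^sup>+j. avoid h k j \<partial>K h i)"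

lemma avoid_le_1: "avoid h k i \<le> 1"
proof (induction k arbitrary: i)
  case (Suc k)
  have "(\<integral>\<^sup>+j. avoid h k j \<partial>K h i) \<le> (\<integral>\<^sup>+j. 1 \<partial>K h i)"
    by (intro nn_integral_mono Suc)
  then have "(\<integral>\<^sup>+j. avoid h k j \<partial>K h i) \<le> 1"
    by simp
  then show ?case
    by (auto simp: indicator_def)
qed (auto simp: indicator_def)

lemma avoid_target: "i \<in> T \<Longrightarrow> avoid h k i = 0"
  by (cases k) auto

lemma avoid_Suc_le: "avoid h (Suc k) i \<le> avoid h k i"
proof (induction k arbitrary: i)
  case 0
  then show ?case
    using avoid_le_1[of h "Suc 0" i] by (auto simp: indicator_def)
next
  case (Suc k)
  show ?case
    unfolding avoid.simps(2)[of h "Suc k"] avoid.simps(2)[of h k i]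
    by (intro mult_left_mono nn_integral_mono Suc) auto
qed

lemma avoid_antimono: "k \<le> l \<Longrightarrow> avoid h l i \<le> avoid h k i"
  by (rule lift_Suc_antimono_le[of "\<lambda>k. avoid h k i"]) (rule avoid_Suc_le)

text \<open>The finer grid adds conditions at the midpoints. Dropping the indicator at a midpoint
  and merging the two half steps by Chapman-Kolmogorov gives one coarse step.\<close>

lemma avoid_refine:
  assumes "0 \<le> h" "i \<in> S"
  shows "avoid (h / 2) (2 * k) i \<le> avoid h k i"
  using assms(2)
proof (induction k arbitrary: i)
  case (Suc k)
  have "(\<integral>\<^sup>+j. avoid (h / 2) (Suc (2 * k)) j \<partial>K (h / 2) i)
      \<le> (\<integral>\<^sup>+j. \<integral>\<^sup>+l. avoid (h / 2) (2 * k) l \<partial>K (h / 2) j \<partial>K (h / 2) i)"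
    by (intro nn_integral_mono) (auto simp: indicator_def)
  also have "\<dots> = (\<integral>\<^sup>+l. avoid (h / 2) (2 * k) l \<partial>K (h / 2 + h / 2) i)"
    using assms(1) Suc.prems by (intro nn_integral_K_add[symmetric]) auto
  also have "\<dots> \<le> (\<integral>\<^sup>+l. avoid h k l \<partial>K (h / 2 + h / 2) i)"
    using assms(1) Suc by (intro nn_integral_K_mono) auto
  finally have "(\<integral>\<^sup>+j. avoid (h / 2) (Suc (2 * k)) j \<partial>K (h / 2) i) \<le> (\<integral>\<^sup>+l. avoid h k l \<partial>K h i)"
    by simp
  then show ?case
    by (auto simp: indicator_def)
qed auto

text \<open>The conditions at the first l times are forgotten, which can only increase the
  probability.\<close>

lemma avoid_add:
  assumes "0 \<le> h" "i \<in> S"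
  shows "avoid h (l + k) i \<le> (\<integral>\<^sup>+j. avoid h k j \<partial>K (real l * h) i)"
  using assms(2)
proof (induction l arbitrary: i)
  case 0
  then show ?case by (simp add: K_0)
next
  case (Suc l)
  have "avoid h (Suc l + k) i \<le> (\<integral>\<^sup>+j. avoid h (l + k) j \<partial>K h i)"
    by (auto simp: indicator_def)
  also have "\<dots> \<le> (\<integral>\<^sup>+j. \<integral>\<^sup>+m. avoid h k m \<partial>K (real l * h) j \<partial>K h i)"
    using assms(1) Suc by (intro nn_integral_K_mono) auto
  also have "\<dots> = (\<integral>\<^sup>+m. avoid h k m \<partial>K (h + real l * h) i)"
    using assms(1) Suc.prems by (intro nn_integral_K_add[symmetric]) auto
  finally show ?case
    by (simp add: algebra_simps)
qed

text \<open>Along dyadic grids the avoidance probabilities decrease on \<open>S\<close>, so there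
  the infimum is the limit; as an infimum of step functions of t it is bounded, monotone and
  measurable at once. The floor is the number of grid steps that fit into the interval from 0 to
  t.\<close>

definition survival :: "real \<Rightarrow> 's \<Rightarrow> ennreal" where
  "survival t i = (INF n. avoid (1 / 2 ^ n) (nat \<lfloor>2 ^ n * t\<rfloor>) i)"

lemma survival_le: "survival t i \<le> avoid (1 / 2 ^ n) (nat \<lfloor>2 ^ n * t\<rfloor>) i"
  unfolding survival_def by (rule INF_lower) auto

lemma survival_le_1: "survival t i \<le> 1"
  using survival_le avoid_le_1 by (rule order_trans)

lemma survival_target: "i \<in> T \<Longrightarrow> survival t i = 0"
  using survival_le[of t i 0] by (simp add: avoid_target)

lemma survival_antimono: "s \<le> t \<Longrightarrow> survival t i \<le> survival s i"
  unfolding survival_def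
proof (rule INF_superset_mono)
  fix n :: nat assume "s \<le> t"
  then have "nat \<lfloor>2 ^ n * s\<rfloor> \<le> nat \<lfloor>2 ^ n * t\<rfloor>"
    by (simp add: floor_mono nat_mono)
  then show "avoid (1 / 2 ^ n) (nat \<lfloor>2 ^ n * t\<rfloor>) i \<le> avoid (1 / 2 ^ n) (nat \<lfloor>2 ^ n * s\<rfloor>) i"
    by (rule avoid_antimono)
qed auto

lemma survival_measurable[measurable]: "(\<lambda>t. survival t i) \<in> borel_measurable borel"
  unfolding survival_def
proof (intro borel_measurable_INF)
  fix n :: nat
  have [measurable]: "(\<lambda>t::real. nat \<lfloor>2 ^ n * t\<rfloor>) \<in> borel \<rightarrow>\<^sub>M count_space UNIV"
    by measurable
  show "(\<lambda>t::real. avoid (1 / 2 ^ n) (nat \<lfloor>2 ^ n * t\<rfloor>) i) \<in> borel_measurable borel"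
    by (rule measurable_compose_countable[where f = "\<lambda>k _. avoid (1 / 2 ^ n) k i" and
          g = "\<lambda>t::real. nat \<lfloor>2 ^ n * t\<rfloor>"]) auto
qed auto

lemma avoid_dyadic_decseq:
  assumes "i \<in> S" "0 \<le> t"
  shows "decseq (\<lambda>n. avoid (1 / 2 ^ n) (nat \<lfloor>2 ^ n * t\<rfloor>) i)"
proof (rule decseq_SucI)
  fix n :: nat
  have "2 * nat \<lfloor>2 ^ n * t\<rfloor> \<le> nat \<lfloor>2 ^ Suc n * t\<rfloor>"
    using assms(2) by (auto simp: le_nat_iff le_floor_iff)
  then have "avoid (1 / 2 ^ n / 2) (nat \<lfloor>2 ^ Suc n * t\<rfloor>) i
      \<le> avoid (1 / 2 ^ n / 2) (2 * nat \<lfloor>2 ^ n * t\<rfloor>) i"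
    by (rule avoid_antimono)
  also have "\<dots> \<le> avoid (1 / 2 ^ n) (nat \<lfloor>2 ^ n * t\<rfloor>) i"
    using assms(1) by (intro avoid_refine) auto
  finally show "avoid (1 / 2 ^ Suc n) (nat \<lfloor>2 ^ Suc n * t\<rfloor>) i
      \<le> avoid (1 / 2 ^ n) (nat \<lfloor>2 ^ n * t\<rfloor>) i"
    by (simp add: mult.commute)
qed

text \<open>The time step is dyadic so that, on every sufficiently fine grid, advancing by it means
  advancing by a whole number of grid steps. Infimum and integral are exchanged by monotone
  convergence.\<close>

lemma survival_add:
  assumes "i \<in> S" "0 \<le> t"
  shows "survival (t + 1 / 2 ^ m) i \<le> (\<integral>\<^sup>+j. survival t j \<partial>K (1 / 2 ^ m) i)"
proof -
  let ?h = "1 / 2 ^ m :: real"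
  let ?a = "\<lambda>n. avoid (1 / 2 ^ n) (nat \<lfloor>2 ^ n * t\<rfloor>)"
  have mono: "?a n' j \<le> ?a n j" if "j \<in> S" "n \<le> n'" for j n n'
    using avoid_dyadic_decseq[OF that(1) assms(2)] that(2) by (auto simp: decseq_def)
  have bound: "survival (t + ?h) i \<le> (\<integral>\<^sup>+j. ?a n j \<partial>K ?h i)" for n
  proof -
    \<comment> \<open>A common refinement of the two grids: the step 1 / 2 ^ m becomes 2 ^ (n' - m)
      of its steps, and the bound for \<open>n\<close> follows from monotonicity in the
      grid.\<close>
    define n' where "n' = max n m"
    have h: "2 ^ n' * ?h = real (2 ^ (n' - m))"
      using power_add[of "2 :: real" "n' - m" m] by (simp add: n'_def)
    then have "2 ^ n' * (t + ?h) = 2 ^ n' * t + real_of_int (2 ^ (n' - m))"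
      by (simp add: distrib_left)
    then have "\<lfloor>2 ^ n' * (t + ?h)\<rfloor> = \<lfloor>2 ^ n' * t\<rfloor> + 2 ^ (n' - m)"
      by (simp only: floor_add_int[symmetric])
    then have eq: "nat \<lfloor>2 ^ n' * (t + ?h)\<rfloor> = 2 ^ (n' - m) + nat \<lfloor>2 ^ n' * t\<rfloor>"
      using assms(2) by (simp add: nat_add_distrib nat_power_eq)
    have "survival (t + ?h) i \<le> avoid (1 / 2 ^ n') (2 ^ (n' - m) + nat \<lfloor>2 ^ n' * t\<rfloor>) i"
      using survival_le[of "t + ?h" i n'] unfolding eq .
    also have "\<dots> \<le> (\<integral>\<^sup>+j. ?a n' j \<partial>K (real (2 ^ (n' - m)) * (1 / 2 ^ n')) i)"
      using assms by (intro avoid_add) auto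
    also have "real (2 ^ (n' - m)) * (1 / 2 ^ n') = ?h"
      unfolding h[symmetric] by simp
    also have "(\<integral>\<^sup>+j. ?a n' j \<partial>K ?h i) \<le> (\<integral>\<^sup>+j. ?a n j \<partial>K ?h i)"
      using assms by (intro nn_integral_K_mono mono) (auto simp: n'_def)
    finally show ?thesis .
  qed
  have "(\<integral>\<^sup>+j. survival t j \<partial>K ?h i) = (INF n. \<integral>\<^sup>+j. ?a n j \<partial>K ?h i)"
    unfolding survival_def
  proof (rule nn_integral_monotone_convergence_INF_AE')
    show "AE j in K ?h i. ?a (Suc n) j \<le> ?a n j" for n
      using set_pmf_K[of ?h i] assms(1) by (auto simp: AE_measure_pmf_iff intro!: mono simp del: power_Suc)
    have "(\<integral>\<^sup>+j. ?a 0 j \<partial>K ?h i) \<le> (\<integral>\<^sup>+j. 1 \<partial>K ?h i)"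
      by (intro nn_integral_mono avoid_le_1)
    then show "(\<integral>\<^sup>+j. ?a 0 j \<partial>K ?h i) < \<infinity>"
      by (auto simp: order_le_less_trans)
  qed auto
  then show ?thesis
    using bound by (simp add: le_INF_iff)
qed

end

section \<open>Integration against laws with countable support\<close>

text \<open>The support is countable, so its counting measure is sigma-finite and joint
  measurability may be checked point by point. This gives the two following facts even when the type
  \<open>'a\<close> is uncountable, as it is for configurations.\<close>

lemma nn_integral_pmf_eq_count_space:
  fixes f :: "'a \<Rightarrow> ennreal"
  shows "(\<integral>\<^sup>+j. f j \<partial>measure_pmf p) = (\<integral>\<^sup>+j. ennreal (pmf p j) * f j \<partial>count_space (set_pmf p))"
  unfolding nn_integral_measure_pmf by (rule nn_integral_count_space_eq) (auto simp: set_pmf_iff)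

lemma borel_measurable_nn_integral_pmf:
  fixes f :: "'a \<Rightarrow> 'b \<Rightarrow> ennreal"
  assumes [measurable]: "\<And>j. f j \<in> borel_measurable M"
  shows "(\<lambda>t. \<integral>\<^sup>+j. f j t \<partial>measure_pmf p) \<in> borel_measurable M"
proof -
  interpret sigma_finite_measure "count_space (set_pmf p)"
    by (rule sigma_finite_measure_count_space_countable) simp
  have "(\<lambda>x. ennreal (pmf p (snd x))
      * f (snd x) (fst x)) \<in> borel_measurable (M \<Otimes>\<^sub>M count_space (set_pmf p))"
    by (rule measurable_compose_countable'[where f = "\<lambda>j x. ennreal (pmf p j)
        * f j (fst x)" and g = snd])
      auto
  then have "(\<lambda>(t, j). ennreal (pmf p j) * f j t) \<in> borel_measurable (M \<Otimes>\<^sub>M count_space (set_pmf p))"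
    by (simp add: case_prod_beta')
  then show ?thesis
    unfolding nn_integral_pmf_eq_count_space by (rule borel_measurable_nn_integral)
qed

lemma nn_integral_pmf_swap:
  fixes f :: "'a \<Rightarrow> 'b \<Rightarrow> ennreal"
  assumes [measurable]: "\<And>j. f j \<in> borel_measurable M"
  shows "(\<integral>\<^sup>+j. \<integral>\<^sup>+t. f j t \<partial>M \<partial>measure_pmf p) = (\<integral>\<^sup>+t. \<integral>\<^sup>+j. f j t \<partial>measure_pmf p \<partial>M)"
proof -
  have "(\<integral>\<^sup>+j. \<integral>\<^sup>+t. f j t \<partial>M \<partial>measure_pmf p)
      = (\<integral>\<^sup>+j. \<integral>\<^sup>+t. ennreal (pmf p j) * f j t \<partial>M \<partial>count_space (set_pmf p))"
    unfolding nn_integral_pmf_eq_count_space by (simp add: nn_integral_cmult)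
  also have "\<dots> = (\<integral>\<^sup>+t. \<integral>\<^sup>+j. ennreal (pmf p j) * f j t \<partial>count_space (set_pmf p) \<partial>M)"
    by (rule nn_integral_count_space_nn_integral[symmetric]) auto
  finally show ?thesis
    unfolding nn_integral_pmf_eq_count_space .
qed

text \<open>Mean value theorem. The derivative is taken at the right end point, so that after the
  shift by h it integrates to a moment of order r - 1. The factor 2 serves the case r < 1, where the
  derivative decreases: since h \<le> 1 \<le> 1 + t, the intermediate point is at least half the end
  point, which costs at most 2 powr (1 - r).\<close>

lemma powr_add_le:
  fixes r t h :: real
  assumes "0 \<le> r" "0 \<le> t" "0 < h" "h \<le> 1"
  shows "(1 + t + h) powr r \<le> (1 + t) powr r + h * (2 * r * (1 + t + h) powr (r - 1))"
proof -
  have "\<exists>z. 1 + t < z \<and> z < 1 + t + h \<and>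
      (1 + t + h) powr r - (1 + t) powr r = ((1 + t + h) - (1 + t)) * (r * z powr (r - 1))"
    using assms by (intro MVT2) (auto intro!: derivative_eq_intros)
  then obtain z where z: "1 + t < z" "z < 1 + t + h"
    "(1 + t + h) powr r - (1 + t) powr r = h * (r * z powr (r - 1))"
    by auto
  have "z powr (r - 1) \<le> 2 * (1 + t + h) powr (r - 1)"
  proof (cases "1 \<le> r")
    case True
    then have "z powr (r - 1) \<le> (1 + t + h) powr (r - 1)"
      using z assms by (intro powr_mono2) auto
    then show ?thesis
      using powr_ge_zero[of "1 + t + h" "r - 1"] by linarith
  next
    case False
    have "z powr (r - 1) \<le> ((1 + t + h) / 2) powr (r - 1)"
      using False z assms by (intro powr_mono2') auto
    also have "\<dots> = (1 + t + h) powr (r - 1) * 2 powr (1 - r)"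
      using assms by (simp add: powr_divide powr_diff field_simps)
    also have "\<dots> \<le> (1 + t + h) powr (r - 1) * 2 powr 1"
      using assms by (intro mult_left_mono powr_mono) auto
    finally show ?thesis by simp
  qed
  then have "h * (r * z powr (r - 1)) \<le> h * (r * (2 * (1 + t + h) powr (r - 1)))"
    using assms by (intro mult_left_mono) auto
  then show ?thesis
    using z(3) by (simp add: algebra_simps)
qed

section \<open>Time-weighted integrals of the survival probability\<close>

context taboo_semigroup
begin

text \<open>Formally this is the expectation of ((1 + \<tau>)^(r+1) - 1) / (r + 1), so index r
  stands for a moment of order r + 1. The weight 1 + t instead of t avoids a singularity at 0 for
  negative r; the value r = -4/5 occurs.\<close>

definition moment :: "real \<Rightarrow> 's \<Rightarrow> ennreal" where
  "moment r i = (\<integral>\<^sup>+t\<in>{0..}. ennreal ((1 + t) powr r) * survival t i \<partial>lborel)"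

abbreviation discount :: "real \<Rightarrow> real \<Rightarrow> real \<Rightarrow> ennreal" where
  "discount l r t \<equiv> ennreal (exp (- l * t) * (1 + t) powr r)"

definition discounted_moment :: "real \<Rightarrow> real \<Rightarrow> 's \<Rightarrow> ennreal" where
  "discounted_moment l r i =
     (\<integral>\<^sup>+t\<in>{0..}. discount l r t * survival t i \<partial>lborel)"

lemma discounted_moment_bounded:
  assumes "0 < l" "0 \<le> r"
  obtains C where "\<And>i. discounted_moment l r i \<le> ennreal C"
proof
  \<comment> \<open>From ln (a (1 + t)) \<le> a (1 + t) - 1 the power is at most a constant times
    exp (r a t); this choice gives r a \<le> l / 2, so half of the discount absorbs it.\<close>
  define a where "a = l / (2 * (r + 1))"
  have a: "0 < a" "r * a \<le> l / 2"
    using assms by (auto simp: a_def field_simps)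
  define D where "D = exp (r * (a - ln a))"
  have bound: "exp (- l * t) * (1 + t) powr r \<le> D * exp (- (l / 2) * t)" if "0 \<le> t" for t
  proof -
    have "ln (1 + t) = ln (a * (1 + t)) - ln a"
      using a that by (simp add: ln_mult)
    also have "\<dots> \<le> a * (1 + t) - ln a"
      using ln_le_minus_one[of "a * (1 + t)"] a that by auto
    finally have "r * ln (1 + t) \<le> r * (a * (1 + t) - ln a)"
      using assms by (intro mult_left_mono) auto
    also have "\<dots> = r * (a - ln a) + (r * a) * t"
      by (simp add: algebra_simps)
    also have "\<dots> \<le> r * (a - ln a) + l / 2 * t"
      using a that by (intro add_left_mono mult_right_mono) auto
    finally have "- l * t + r * ln (1 + t) \<le> r * (a - ln a) + - (l / 2) * t"
      by simp
    then have "exp (- l * t + r * ln (1 + t)) \<le> exp (r * (a - ln a) + - (l / 2) * t)"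
      by simp
    then show ?thesis
      using that unfolding D_def powr_def exp_add by (simp add: mult.commute)
  qed
  fix i
  have "discounted_moment l r i \<le> (\<integral>\<^sup>+t. ennreal (D * exp (- (l / 2) * t)) * indicator {0..} t \<partial>lborel)"
    unfolding discounted_moment_def
  proof (rule nn_integral_mono)
    fix t :: real
    have "discount l r t * survival t i \<le> ennreal (D * exp (- (l / 2) * t)) * 1"
      if "0 \<le> t" by (intro mult_mono ennreal_leI bound that survival_le_1) auto
    then show "discount l r t * survival t i * indicator {0..} t
        \<le> ennreal (D * exp (- (l / 2) * t)) * indicator {0..} t"
      by (auto simp: indicator_def)
  qed
  also have "\<dots> = ennreal (0 - (- (2 * D / l) * exp (- (l / 2) * 0)))"
  proof (rule nn_integral_FTC_atLeast)
    have "((\<lambda>t. - (2 * D / l) * exp (- (l / 2) * t)) \<longlongrightarrow> - (2 * D / l) * 0) at_top"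
      using assms
      by (intro tendsto_mult tendsto_const filterlim_compose[OF exp_at_bot] filterlim_tendsto_neg_mult_at_bot[OF tendsto_const _ filterlim_ident])
        auto
    then show "((\<lambda>t. - (2 * D / l) * exp (- (l / 2) * t)) \<longlongrightarrow> 0) at_top"
      by simp
    show "((\<lambda>t. - (2 * D / l) * exp (- (l / 2) * t)) has_real_derivative D
        * exp (- (l / 2) * x)) (at x)" for x
      using assms by (auto intro!: derivative_eq_intros simp: field_simps)
  qed (auto simp: D_def)
  finally show "discounted_moment l r i \<le> ennreal (2 * D / l)"
    by simp
qed

text \<open>A discrete form of the generator inequality with step h = 1 / 2 ^ m. The part of the
  integral up to h costs at most h times 2 powr r. After h, \<open>survival_add\<close> moves the
  functional under \<open>K h\<close>, the discount gives exp (- l h), and the increment of the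
  weight is estimated by \<open>powr_add_le\<close>, which produces the moment of order r -
  1.\<close>

lemma discounted_moment_step:
  assumes i: "i \<in> S" and "0 < l" "0 \<le> r"
  shows "discounted_moment l r i
      \<le> ennreal (1 / 2 ^ m) * (ennreal (2 powr r) + ennreal (2 * r) * moment (r - 1) i)
     + ennreal (exp (- l * (1 / 2 ^ m))) * (\<integral>\<^sup>+j. discounted_moment l r j \<partial>K (1 / 2 ^ m) i)"
proof -
  define h :: real where "h = 1 / 2 ^ m"
  have h: "0 < h" "h \<le> 1"
    by (auto simp: h_def)
  let ?F = "\<lambda>t. discount l r t * survival t i"
  let ?G = "\<lambda>t. ennreal ((1 + t) powr (r - 1)) * survival t i"
  have shift: "(\<integral>\<^sup>+t. f t * indicator {h..} t \<partial>lborel) = (\<integral>\<^sup>+t. f (h + t) * indicator {0..} t \<partial>lborel)"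
    if [measurable]: "f \<in> borel_measurable borel" for f :: "real \<Rightarrow> ennreal"
    by (subst nn_integral_real_affine[where c = 1 and t = h])
      (auto simp: indicator_def intro!: nn_integral_cong)
  have split: "discounted_moment l r i
      = (\<integral>\<^sup>+t. ?F t * indicator {0..<h} t \<partial>lborel) + (\<integral>\<^sup>+t. ?F t * indicator {h..} t \<partial>lborel)"
  proof -
    have "discounted_moment l r i
      = (\<integral>\<^sup>+t. ?F t * indicator {0..<h} t + ?F t * indicator {h..} t \<partial>lborel)"
      unfolding discounted_moment_def using h by (intro nn_integral_cong) (auto simp: indicator_def)
    also have "\<dots> = (\<integral>\<^sup>+t. ?F t * indicator {0..<h} t \<partial>lborel)
        + (\<integral>\<^sup>+t. ?F t * indicator {h..} t \<partial>lborel)"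
      by (intro nn_integral_add) measurable
    finally show ?thesis .
  qed
  have "(\<integral>\<^sup>+t. ?F t * indicator {0..<h} t \<partial>lborel)
      \<le> (\<integral>\<^sup>+t. ennreal (2 powr r) * indicator {0..<h} t \<partial>lborel)"
  proof (rule nn_integral_mono)
    fix t
    have "?F t \<le> ennreal (2 powr r) * 1" if "0 \<le> t" "t < h"
    proof (intro mult_mono ennreal_leI survival_le_1)
      have "exp (- l * t) * (1 + t) powr r \<le> 1 * 2 powr r"
        using that assms h by (intro mult_mono powr_mono2) auto
      then show "exp (- l * t) * (1 + t) powr r \<le> 2 powr r" by simp
    qed auto
    then show "?F t * indicator {0..<h} t \<le> ennreal (2 powr r) * indicator {0..<h} t"
      by (auto simp: indicator_def)
  qed
  also have "(\<integral>\<^sup>+t. ennreal (2 powr r) * indicator {0..<h} t \<partial>lborel) = ennreal h * ennreal (2 powr r)"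
    using h by (subst nn_integral_cmult) (auto simp: mult.commute)
  finally have initial: "(\<integral>\<^sup>+t. ?F t * indicator {0..<h} t \<partial>lborel) \<le> ennreal h * ennreal (2 powr r)" .
  have "(\<integral>\<^sup>+t. ?F t * indicator {h..} t \<partial>lborel) = (\<integral>\<^sup>+t. ?F (h + t) * indicator {0..} t \<partial>lborel)"
    by (rule shift) measurable
  also have "\<dots> \<le> (\<integral>\<^sup>+t. ennreal (exp (- l * h))
      * (\<integral>\<^sup>+j. discount l r t * survival t j * indicator {0..} t \<partial>K h i)
      + ennreal (h * (2 * r)) * (?G (h + t) * indicator {0..} t) \<partial>lborel)"
  proof (rule nn_integral_mono)
    fix t :: real
    show "?F (h + t) * indicator {0..} t
        \<le> ennreal (exp (- l * h)) * (\<integral>\<^sup>+j. discount l r t * survival t j * indicator {0..} t \<partial>K h i)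
      + ennreal (h * (2 * r)) * (?G (h + t) * indicator {0..} t)"
    proof (cases "0 \<le> t")
      case True
      have "exp (- l * (h + t)) * (1 + t + h) powr r
          \<le> exp (- l * (h + t)) * ((1 + t) powr r + h * (2 * r * (1 + t + h) powr (r - 1)))"
        using powr_add_le[of r t h] assms h True by (intro mult_left_mono) auto
      also have "\<dots> = exp (- l * h) * (exp (- l * t) * (1 + t) powr r)
          + exp (- l * (h + t)) * (h * (2 * r) * (1 + t + h) powr (r - 1))"
        by (simp add: algebra_simps exp_add[symmetric])
      also have "\<dots> \<le> exp (- l * h) * (exp (- l * t) * (1 + t) powr r)
          + 1 * (h * (2 * r) * (1 + t + h) powr (r - 1))"
        using assms h True by (intro add_left_mono mult_right_mono) (auto simp: mult_nonneg_nonpos)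
      finally have "?F (h + t) \<le> ennreal (exp (- l * h) * (exp (- l * t) * (1 + t) powr r)
          + h * (2 * r) * (1 + t + h) powr (r - 1)) * survival (h + t) i"
        by (intro mult_right_mono ennreal_leI) (auto simp: add_ac)
      also have "\<dots> = ennreal (exp (- l * h)) * (discount l r t * survival (t + h) i)
          + ennreal (h * (2 * r)) * ?G (h + t)"
        using assms h by (simp add: ennreal_plus ennreal_mult distrib_right distrib_left add_ac mult_ac)
      also have "\<dots> \<le> ennreal (exp (- l * h)) * (discount l r t * (\<integral>\<^sup>+j. survival t j \<partial>K h i))
          + ennreal (h * (2 * r)) * ?G (h + t)"
        using survival_add[OF i True, of m] unfolding h_def[symmetric]
        by (intro add_right_mono mult_left_mono) auto
      finally show ?thesis
        using True by (simp add: nn_integral_cmult)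
    qed simp
  qed
  also have "\<dots> = ennreal (exp (- l * h))
      * (\<integral>\<^sup>+t. \<integral>\<^sup>+j. discount l r t * survival t j * indicator {0..} t \<partial>K h i \<partial>lborel)
      + ennreal (h * (2 * r)) * (\<integral>\<^sup>+t. ?G (h + t) * indicator {0..} t \<partial>lborel)"
  proof -
    have *: "(\<lambda>t. (\<integral>\<^sup>+j. discount l r t * survival t j
        * indicator {0..} t \<partial>K h i)) \<in> borel_measurable lborel"
      by (intro borel_measurable_nn_integral_pmf) measurable
    show ?thesis
      by (subst nn_integral_add)
        (use * in \<open>auto simp: nn_integral_cmult simp del: mult_minus_left intro!: borel_measurable_times_ennreal\<close>)
  qed
  also have "(\<integral>\<^sup>+t. \<integral>\<^sup>+j. discount l r t * survival t j * indicator {0..} t \<partial>K h i \<partial>lborel)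
      = (\<integral>\<^sup>+j. discounted_moment l r j \<partial>K h i)"
    unfolding discounted_moment_def by (rule nn_integral_pmf_swap[symmetric]) measurable
  also have "(\<integral>\<^sup>+t. ?G (h + t) * indicator {0..} t \<partial>lborel) = (\<integral>\<^sup>+t. ?G t * indicator {h..} t \<partial>lborel)"
    by (rule shift[symmetric]) measurable
  also have "ennreal (h * (2 * r)) * (\<integral>\<^sup>+t. ?G t * indicator {h..} t \<partial>lborel)
      \<le> ennreal (h * (2 * r)) * moment (r - 1) i"
    unfolding moment_def using h by (intro mult_left_mono nn_integral_mono) (auto simp: indicator_def)
  finally have "(\<integral>\<^sup>+t. ?F t * indicator {h..} t \<partial>lborel)
      \<le> ennreal (exp (- l * h)) * (\<integral>\<^sup>+j. discounted_moment l r j \<partial>K h i)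
      + ennreal (h * (2 * r)) * moment (r - 1) i"
    by (simp add: add_left_mono)
  with initial have "discounted_moment l r i \<le> ennreal h * ennreal (2 powr r)
      + (ennreal (exp (- l * h)) * (\<integral>\<^sup>+j. discounted_moment l r j \<partial>K h i) + ennreal (h * (2 * r)) * moment (r - 1) i)"
    unfolding split by (rule add_mono)
  also have "\<dots> = ennreal h * (ennreal (2 powr r) + ennreal (2 * r) * moment (r - 1) i)
     + ennreal (exp (- l * h)) * (\<integral>\<^sup>+j. discounted_moment l r j \<partial>K h i)"
    using assms h by (simp add: ennreal_mult distrib_left add_ac mult_ac)
  finally show ?thesis
    unfolding h_def .
qed

lemma moment_eq_SUP: "moment r i = (SUP n. discounted_moment (1 / Suc n) r i)"
proof -
  have lim: "(SUP n. discount (1 / Suc n) r t * survival t i * indicator {0..} t)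
      = ennreal ((1 + t) powr r) * survival t i * indicator {0..} t" for t :: real
  proof (cases "0 \<le> t")
    case True
    have "incseq (\<lambda>n. discount (1 / Suc n) r t)"
      using True by (intro incseq_SucI ennreal_leI mult_right_mono) (auto simp: field_simps)
    moreover have "(\<lambda>n. exp (- (1 / Suc n) * t) * (1 + t) powr r) \<longlonglongrightarrow> exp (- 0 * t) * (1 + t) powr r"
      by (intro tendsto_intros LIMSEQ_Suc[OF lim_1_over_n])
    then have "(\<lambda>n. discount (1 / Suc n) r t) \<longlonglongrightarrow> ennreal ((1 + t) powr r)"
      by (intro tendsto_ennrealI) simp
    ultimately have "(SUP n. discount (1 / Suc n) r t) = ennreal ((1 + t) powr r)"
      using LIMSEQ_SUP LIMSEQ_unique by blast
    then show ?thesis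
      using True by (simp add: SUP_mult_right_ennreal[symmetric] del: mult_minus_left)
  qed simp
  have "(\<integral>\<^sup>+t. (SUP n. discount (1 / Suc n) r t * survival t i * indicator {0..} t) \<partial>lborel)
      = (SUP n. \<integral>\<^sup>+t. discount (1 / Suc n) r t * survival t i * indicator {0..} t \<partial>lborel)"
  proof (rule nn_integral_monotone_convergence_SUP)
    show "incseq (\<lambda>n t. discount (1 / Suc n) r t * survival t i * indicator {0..} t)"
    proof (intro incseq_SucI le_funI)
      fix n :: nat and t :: real
      show "discount (1 / Suc n) r t * survival t i * indicator {0..} t
          \<le> discount (1 / Suc (Suc n)) r t * survival t i * indicator {0..} t"
      proof (cases "0 \<le> t")
        case True
        then have "- (1 / Suc n) * t \<le> - (1 / Suc (Suc n)) * t"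
          by (simp add: field_simps)
        then have "exp (- (1 / Suc n) * t) * (1 + t) powr r
            \<le> exp (- (1 / Suc (Suc n)) * t) * (1 + t) powr r"
          by (intro mult_right_mono) auto
        then show ?thesis
          by (rule mult_right_mono[OF mult_right_mono[OF ennreal_leI]]) simp_all
      qed simp
    qed
  qed measurable
  then show ?thesis
    unfolding moment_def discounted_moment_def lim .
qed

text \<open>A substitute for Jensen's inequality. Up to time x survival is bounded by 1, and the
  weight integrates to at most (1 + x) powr r / r. Beyond x the weight is at most (1 + x) powr (r -
  1), and the remaining integral is at most \<open>moment 0 i\<close>, hence at most x.\<close>

lemma moment_interpolate:
  assumes r: "0 < r" "r < 1" and x: "0 \<le> x" and "moment 0 i \<le> ennreal x"
  shows "moment (r - 1) i \<le> ennreal ((1 / r + 1) * (1 + x) powr r)"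
proof -
  have "moment (r - 1) i \<le> (\<integral>\<^sup>+t. ennreal ((1 + t) powr (r - 1)) * indicator {0..x} t
      + ennreal ((1 + x) powr (r - 1)) * (ennreal ((1 + t) powr 0) * survival t i * indicator {0..} t) \<partial>lborel)"
    unfolding moment_def
  proof (rule nn_integral_mono)
    fix t :: real
    consider "t < 0" | "0 \<le> t" "t \<le> x" | "x < t" by linarith
    then show "ennreal ((1 + t) powr (r - 1)) * survival t i * indicator {0..} t
      \<le> ennreal ((1 + t) powr (r - 1)) * indicator {0..x} t
        + ennreal ((1 + x) powr (r - 1)) * (ennreal ((1 + t) powr 0) * survival t i * indicator {0..} t)"
    proof cases
      case 2
      have "ennreal ((1 + t) powr (r - 1)) * survival t i \<le> ennreal ((1 + t) powr (r - 1)) * 1"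
        by (intro mult_left_mono survival_le_1) auto
      then show ?thesis
        using 2 by (simp add: add_increasing2)
    next
      case 3
      then have "(1 + t) powr (r - 1) \<le> (1 + x) powr (r - 1)"
        using r x by (intro powr_mono2') auto
      then show ?thesis
        using 3 x by (auto intro!: mult_right_mono ennreal_leI)
    qed simp
  qed
  also have "\<dots> = (\<integral>\<^sup>+t. ennreal ((1 + t) powr (r - 1)) * indicator {0..x} t \<partial>lborel)
      + ennreal ((1 + x) powr (r - 1)) * moment 0 i"
    unfolding moment_def by (subst nn_integral_add) (measurable, simp add: nn_integral_cmult)
  also have "\<dots> \<le> ennreal ((1 / r) * (1 + x) powr r) + ennreal ((1 + x) powr r)"
  proof (rule add_mono)
    have "(\<integral>\<^sup>+t. ennreal ((1 + t) powr (r - 1)) * indicator {0..x} t \<partial>lborel)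
        = ennreal ((1 + x) powr r / r - (1 + 0) powr r / r)"
    proof (rule nn_integral_FTC_Icc)
      fix t :: real assume "t \<in> {0..x}"
      then show "((\<lambda>t. (1 + t) powr r / r) has_real_derivative (1 + t) powr (r - 1)) (at t)"
        using r
        by (auto intro!: derivative_eq_intros)
    qed (use x in auto)
    also have "\<dots> \<le> ennreal ((1 / r) * (1 + x) powr r)"
      using r by (intro ennreal_leI) (simp add: field_simps)
    finally show "(\<integral>\<^sup>+t. ennreal ((1 + t) powr (r - 1)) * indicator {0..x} t \<partial>lborel)
        \<le> ennreal ((1 / r) * (1 + x) powr r)" .
    have "ennreal ((1 + x) powr (r - 1)) * moment 0 i \<le> ennreal ((1 + x) powr (r - 1)) * ennreal x"
      by (intro mult_left_mono assms) auto
    also have "\<dots> = ennreal ((1 + x) powr (r - 1) * x)"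
      using x by (simp add: ennreal_mult)
    also have "\<dots> \<le> ennreal ((1 + x) powr (r - 1) * (1 + x))"
      using x by (intro ennreal_leI mult_left_mono) auto
    also have "(1 + x) powr (r - 1) * (1 + x) = (1 + x) powr r"
      using x by (simp add: powr_diff)
    finally show "ennreal ((1 + x) powr (r - 1)) * moment 0 i \<le> ennreal ((1 + x) powr r)" .
  qed
  also have "\<dots> = ennreal ((1 / r + 1) * (1 + x) powr r)"
    using r by (simp add: ennreal_plus[symmetric] distrib_right del: ennreal_plus)
  finally show ?thesis .
qed

end

section \<open>Comparison with Lyapunov functions\<close>

text \<open>\<open>linear\<close> and \<open>rate_bound\<close> concern all functions because
  \<open>L\<close> is applied to unbounded Lyapunov functions too, about which
  \<open>has_generator\<close> says nothing. \<open>rate i\<close> plays the role of a bound on the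
  total jump rate at \<open>i\<close>.\<close>

locale taboo_generator = taboo_semigroup S K T
  for S :: "'s set" and K and T +
  fixes L :: "('s \<Rightarrow> real) \<Rightarrow> 's \<Rightarrow> real" and rate :: "'s \<Rightarrow> real"
  assumes has_generator: "has_generator S K L"
    and linear: "i \<in> S \<Longrightarrow> L (\<lambda>x. f x - c * g x) i = L f i - c * L g i"
    and rate_bound: "i \<in> S \<Longrightarrow> (\<And>j. j \<in> S \<Longrightarrow> f j \<le> m) \<Longrightarrow> L f i \<le> rate i * (m - f i)"
begin

text \<open>The supremum m need not be attained. At a point within \<delta> of it the rate bound
  gives L w \<le> Q \<delta>, which contradicts a uniformly positive \<open>L w\<close> there. Only
  the set where \<open>w\<close> exceeds m / 2 matters, so the rates have to be bounded only on such
  sets.\<close>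

lemma maximum_principle:
  assumes bdd: "\<And>i. i \<in> S \<Longrightarrow> w i \<le> C"
    and sub: "\<And>c. 0 < c \<Longrightarrow> \<exists>\<eta>>0. \<exists>Q. \<forall>i\<in>S. c \<le> w i \<longrightarrow> rate i \<le> Q \<and> \<eta> \<le> L w i"
    and i: "i \<in> S"
  shows "w i \<le> 0"
proof (rule ccontr)
  assume "\<not> w i \<le> 0"
  define m where "m = (SUP j\<in>S. w j)"
  have le_m: "w j \<le> m" if "j \<in> S" for j
    unfolding m_def using bdd that by (intro cSUP_upper bdd_aboveI2) auto
  then have m: "0 < m"
    using i \<open>\<not> w i \<le> 0\<close> by (meson less_le_trans not_le)
  then obtain \<eta> Q where \<eta>: "0 < \<eta>" and Q: "\<And>j. j \<in> S \<Longrightarrow> m / 2 \<le> w j \<Longrightarrow> rate j \<le> Q \<and> \<eta> \<le> L w j"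
    using sub[of "m / 2"] by auto
  \<comment> \<open>The first entry keeps the near-maximiser in the set where \<open>Q\<close> and
    \<eta> apply; the second makes Q \<delta> smaller than \<eta>.\<close>
  define \<delta> where "\<delta> = min (m / 2) (\<eta> / (2 * (\<bar>Q\<bar> + 1)))"
  have \<delta>: "0 < \<delta>"
    using m \<eta> by (auto simp: \<delta>_def)
  then have "\<exists>j\<in>S. m - \<delta> < w j"
    using less_cSUP_iff[of S w "m - \<delta>"] i bdd_aboveI2[of S w C] bdd unfolding m_def[symmetric] by auto
  then obtain j where j: "j \<in> S" "m - \<delta> < w j"
    by auto
  then have "rate j \<le> Q" "\<eta> \<le> L w j"
    using Q[of j] by (auto simp: \<delta>_def)
  moreover have "L w j \<le> rate j * (m - w j)"
    using j by (intro rate_bound le_m)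
  moreover have "rate j * (m - w j) \<le> \<bar>Q\<bar> * \<delta>"
    using le_m[OF j(1)] j(2) \<open>rate j \<le> Q\<close> \<delta> by (intro order_trans[OF mult_right_mono[of _ "\<bar>Q\<bar>"] mult_left_mono]) auto
  moreover have "\<bar>Q\<bar> * \<delta> \<le> \<bar>Q\<bar> * (\<eta> / (2 * (\<bar>Q\<bar> + 1)))"
    by (intro mult_left_mono) (auto simp: \<delta>_def)
  moreover have "\<bar>Q\<bar> * (\<eta> / (2 * (\<bar>Q\<bar> + 1))) < \<eta>"
    using \<eta> by (simp add: field_simps add_nonneg_pos)
  ultimately show False
    by linarith
qed

text \<open>Since the difference quotient converges as t decreases to 0, its limit may be computed
  along the dyadic times, the only ones for which the step inequality is available.\<close>

lemma generator_lower_bound: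
  assumes f: "\<And>j. 0 \<le> f j" "\<And>j. f j \<le> C" and "0 \<le> l" and i: "i \<in> S"
    and step: "\<And>m. f i \<le> 1 / 2 ^ m * c
        + exp (- l * (1 / 2 ^ m)) * measure_pmf.expectation (K (1 / 2 ^ m) i) f"
  shows "l * f i - c \<le> L f i"
proof -
  define h :: "nat \<Rightarrow> real" where "h = (\<lambda>m. 1 / 2 ^ m)"
  have h: "0 < h m" for m
    by (simp add: h_def)
  have h_lim: "h \<longlonglongrightarrow> 0"
    unfolding h_def using LIMSEQ_inverse_realpow_zero[of 2] by (simp add: divide_inverse)
  have "\<forall>\<^sub>F m in sequentially. h m \<in> {0<..} \<and> h m \<noteq> 0"
    using h by (intro always_eventually) (auto simp: less_imp_neq[THEN not_sym])
  with h_lim have h_filter: "filterlim h (at_right 0) sequentially"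
    by (auto simp: filterlim_at)
  have "bounded (range f)"
    using f by (intro boundedI[of _ C]) auto
  with has_generator i have "((\<lambda>t. (measure_pmf.expectation (K t i) f - f i) / t) \<longlongrightarrow> L f i) (at_right 0)"
    unfolding has_generator_def by blast
  then have quotient: "(\<lambda>m. (measure_pmf.expectation (K (h m) i) f - f i) / h m) \<longlonglongrightarrow> L f i"
    using h_filter by (rule filterlim_compose)
  have "(\<lambda>m. l * f i - exp (l * h m) * c) \<longlonglongrightarrow> l * f i - exp (l * 0) * c"
    by (intro tendsto_intros h_lim)
  then have "l * f i - exp (l * 0) * c \<le> L f i"
  proof (rule LIMSEQ_le[OF _ quotient])
    have "l * f i - exp (l * h m) * c \<le> (measure_pmf.expectation (K (h m) i) f - f i) / h m" for m
    proof -
      let ?E = "measure_pmf.expectation (K (h m) i) f"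
      \<comment> \<open>Removing the discount from the expectation and using 1 + l h \<le> exp (l h)
        leaves l f - exp (l h) c as a lower bound of the quotient, which tends to l f - c.\<close>
      have "exp (l * h m) * f i \<le> exp (l * h m) * (h m * c + exp (- l * h m) * ?E)"
        using step[of m] unfolding h_def by (intro mult_left_mono) auto
      also have "\<dots> = exp (l * h m) * (h m * c) + ?E"
        by (simp add: distrib_left exp_minus field_simps)
      finally have "exp (l * h m) * f i \<le> exp (l * h m) * (h m * c) + ?E" .
      moreover have "(1 + l * h m) * f i \<le> exp (l * h m) * f i"
        using f by (intro mult_right_mono exp_ge_add_one_self) auto
      ultimately have "(l * f i - exp (l * h m) * c) * h m \<le> ?E - f i"
        by (simp add: algebra_simps)
      then show ?thesis
        using h[of m] by (simp add: pos_le_divide_eq)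
    qed
    then show "\<exists>N. \<forall>n\<ge>N. l * f i - exp (l * h n) * c
        \<le> (measure_pmf.expectation (K (h n) i) f - f i) / h n"
      by blast
  qed
  then show ?thesis by simp
qed

text \<open>The comparison is between the bounded discounted functional \<open>R\<close> and
  \<open>V\<close>. Where R - V \<ge> c > 0, the bound on \<open>R\<close> confines \<open>V\<close>
  to a level set, so the rates are bounded, and the point lies off \<open>T\<close>, where
  \<open>R\<close> vanishes; there the terms \<open>g\<close> cancel and L (R - V) \<ge> l R \<ge> l
  c. The resulting bound does not involve l, so the discount can be removed. \<open>g\<close>
  dominates the source term and thereby certifies that the moment of lower order is finite off
  \<open>T\<close>.\<close>

theorem moment_le:
  assumes r: "0 \<le> r"
    and V: "\<And>i. i \<in> S \<Longrightarrow> 0 \<le> V i"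
    and proper: "\<And>c. \<exists>Q. \<forall>i\<in>S. V i \<le> c \<longrightarrow> rate i \<le> Q"
    and drift: "\<And>i. i \<in> S \<Longrightarrow> i \<notin> T \<Longrightarrow> L V i \<le> - g i"
    and g: "\<And>i. i \<in> S \<Longrightarrow> i \<notin> T \<Longrightarrow> ennreal (2 powr r) + ennreal (2 * r) * moment (r - 1) i \<le> ennreal (g i)"
    and i: "i \<in> S"
  shows "moment r i \<le> ennreal (V i)"
proof -
  have "discounted_moment l r i \<le> ennreal (V i)" if l: "0 < l" for l
  proof -
    obtain C where C: "\<And>i. discounted_moment l r i \<le> ennreal C"
      using discounted_moment_bounded[OF l r] by blast
    define R where "R = (\<lambda>i. enn2real (discounted_moment l r i))"
    have R: "discounted_moment l r i = ennreal (R i)" for i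
      using order_le_less_trans[OF C[of i] ennreal_less_top] unfolding R_def by simp
    have R_le: "R i \<le> max 0 C" for i
    proof -
      have "ennreal (R i) \<le> ennreal (max 0 C)"
        unfolding R[symmetric] using C[of i] by (simp add: ennreal_max_0)
      then show ?thesis
        by (subst (asm) ennreal_le_iff) auto
    qed
    have R_nonneg: "0 \<le> R i" for i
      by (simp add: R_def)
    have R_target: "R i = 0" if "i \<in> T" for i
      using that unfolding R_def discounted_moment_def by (simp add: survival_target)
    have LR: "l * R i - g i \<le> L R i" if i: "i \<in> S" "i \<notin> T" for i
    proof (rule generator_lower_bound[OF R_nonneg R_le _ i(1)])
      fix m :: nat
      let ?h = "1 / 2 ^ m :: real"
      have "integrable (K ?h i) R"
        using R_nonneg R_le by (intro measure_pmf.integrable_const_bound[of _ "max 0 C"]) auto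
      then have E: "(\<integral>\<^sup>+j. discounted_moment l r j \<partial>K ?h i)
          = ennreal (measure_pmf.expectation (K ?h i) R)"
        unfolding R using R_nonneg by (intro nn_integral_eq_integral) auto
      have E_nonneg: "0 \<le> measure_pmf.expectation (K ?h i) R"
        using R_nonneg by simp
      have "ennreal (2 powr r) \<le> ennreal (g i)"
        using g[OF i] by (rule order_trans[rotated]) simp
      then have g_pos: "0 < g i"
        by (rule_tac ccontr) (simp add: ennreal_neg not_less)
      have "ennreal (R i) \<le> ennreal ?h * ennreal (g i)
          + ennreal (exp (- l * ?h)) * ennreal (measure_pmf.expectation (K ?h i) R)"
        using discounted_moment_step[OF i(1) l r, of m, unfolded E, unfolded R]
        by (rule order_trans) (intro add_right_mono mult_left_mono g i zero_le)
      also have "\<dots> = ennreal (?h * g i + exp (- l * ?h) * measure_pmf.expectation (K ?h i) R)"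
        using g_pos E_nonneg by (simp add: ennreal_mult[symmetric] ennreal_plus[symmetric] del: ennreal_plus)
      finally show "R i \<le> ?h * g i + exp (- l * ?h) * measure_pmf.expectation (K ?h i) R"
        using g_pos E_nonneg by (subst (asm) ennreal_le_iff) auto
    qed (use l in auto)
    have "R i - 1 * V i \<le> 0"
    proof (rule maximum_principle[where w = "\<lambda>i. R i - 1 * V i" and C = "max 0 C", OF _ _ i])
      show "R i - 1 * V i \<le> max 0 C" if "i \<in> S" for i
        using V[OF that] R_le[of i] by simp
      fix c :: real assume c: "0 < c"
      obtain Q where Q: "\<And>i. i \<in> S \<Longrightarrow> V i \<le> max 0 C \<Longrightarrow> rate i \<le> Q"
        using proper by blast
      have "rate j \<le> Q \<and> l * c \<le> L (\<lambda>i. R i - 1 * V i) j" if j: "j \<in> S" "c \<le> R j - 1 * V j" for j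
      proof
        show "rate j \<le> Q"
          using j c R_le[of j] by (intro Q) auto
        have "j \<notin> T"
          using j c V[of j] R_target[of j] by auto
        then have "l * R j \<le> L (\<lambda>i. R i - 1 * V i) j"
          using j LR[of j] drift[of j] linear[of j R 1 V] by auto
        moreover have "l * c \<le> l * R j"
          using j V[of j] l by (intro mult_left_mono) auto
        ultimately show "l * c \<le> L (\<lambda>i. R i - 1 * V i) j"
          by simp
      qed
      then show "\<exists>\<eta>>0. \<exists>Q. \<forall>i\<in>S. c \<le> R i - 1 * V i \<longrightarrow> rate i \<le> Q \<and> \<eta> \<le> L (\<lambda>i. R i - 1 * V i) i"
        using c l by (intro exI[of _ "l * c"]) auto
    qed
    then show ?thesis
      unfolding R by (intro ennreal_leI) simp
  qed
  then show ?thesis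
    unfolding moment_eq_SUP by (intro SUP_least) auto
qed

text \<open>The limit \<open>u\<close>, a bound for the probability of never hitting, is bounded
  with L u \<ge> 0. It is compared with e V for every e > 0: where u - e V is positive, V \<le> 1 /
  e, so rates and drift are controlled there. Letting e tend to 0 gives u = 0.\<close>

theorem survival_tendsto_0:
  assumes V: "\<And>i. i \<in> S \<Longrightarrow> 0 \<le> V i"
    and proper: "\<And>c. \<exists>Q. \<forall>i\<in>S. V i \<le> c \<longrightarrow> rate i \<le> Q"
    and drift: "\<And>c. \<exists>\<eta>>0. \<forall>i\<in>S. i \<notin> T \<longrightarrow> V i \<le> c \<longrightarrow> L V i \<le> - \<eta>"
    and i: "i \<in> S"
  shows "(INF k::nat. survival (real k) i) = 0"
proof -
  define u where "u = (\<lambda>i. enn2real (INF k::nat. survival (real k) i))"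
  have le_1: "(INF k::nat. survival (real k) i) \<le> 1" for i
    by (rule INF_lower2[of 0]) (auto simp: survival_le_1)
  have u: "(INF k::nat. survival (real k) i) = ennreal (u i)" for i
    using order_le_less_trans[OF le_1[of i] ennreal_one_less_top] unfolding u_def by simp
  have u_nonneg: "0 \<le> u i" for i
    by (simp add: u_def)
  have u_le: "u i \<le> 1" for i
    using le_1[of i] unfolding u by simp
  have u_target: "u i = 0" if "i \<in> T" for i
    using that unfolding u_def by (simp add: survival_target)
  have Lu: "0 * u i - 0 \<le> L u i" if i: "i \<in> S" for i
  proof (rule generator_lower_bound[OF u_nonneg u_le _ i])
    fix m :: nat
    let ?h = "1 / 2 ^ m :: real"
    have "integrable (K ?h i) u"
      using u_nonneg u_le by (intro measure_pmf.integrable_const_bound[of _ 1]) auto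
    then have E: "(\<integral>\<^sup>+j. ennreal (u j) \<partial>K ?h i) = ennreal (measure_pmf.expectation (K ?h i) u)"
      using u_nonneg by (intro nn_integral_eq_integral) auto
    have "ennreal (u i) \<le> (\<integral>\<^sup>+j. survival (real k) j \<partial>K ?h i)" for k :: nat
    proof -
      \<comment> \<open>As the step is at most 1, raising k by one makes room for it.\<close>
      have "ennreal (u i) \<le> survival (real (Suc k)) i"
        unfolding u[symmetric] by (rule INF_lower) auto
      also have "\<dots> \<le> survival (real k + ?h) i"
        by (rule survival_antimono) simp
      also have "\<dots> \<le> (\<integral>\<^sup>+j. survival (real k) j \<partial>K ?h i)"
        using i by (intro survival_add) auto
      finally show ?thesis .
    qed
    then have "ennreal (u i) \<le> (INF k. \<integral>\<^sup>+j. survival (real k) j \<partial>K ?h i)"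
      by (rule INF_greatest)
    also have "\<dots> = (\<integral>\<^sup>+j. (INF k::nat. survival (real k) j) \<partial>K ?h i)"
    proof (rule nn_integral_monotone_convergence_INF_AE'[symmetric])
      have "(\<integral>\<^sup>+j. survival (real 0) j \<partial>K ?h i) \<le> (\<integral>\<^sup>+j. 1 \<partial>K ?h i)"
        by (intro nn_integral_mono survival_le_1)
      then show "(\<integral>\<^sup>+j. survival (real 0) j \<partial>K ?h i) < \<infinity>"
        by (auto simp: order_le_less_trans)
    qed (auto intro!: AE_I2 survival_antimono)
    also have "\<dots> = ennreal (measure_pmf.expectation (K ?h i) u)"
      unfolding u E ..
    finally show "u i \<le> ?h * 0 + exp (- 0 * ?h) * measure_pmf.expectation (K ?h i) u"
      using u_nonneg by (subst (asm) ennreal_le_iff) auto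
  qed auto
  have "u i - e * V i \<le> 0" if e: "0 < e" for e
  proof (rule maximum_principle[where w = "\<lambda>i. u i - e * V i" and C = 1, OF _ _ i])
    show "u i - e * V i \<le> 1" if "i \<in> S" for i
      by (smt (verit) V[OF that] e u_le[of i] mult_nonneg_nonneg)
    fix c :: real assume c: "0 < c"
    obtain Q where Q: "\<And>i. i \<in> S \<Longrightarrow> V i \<le> 1 / e \<Longrightarrow> rate i \<le> Q"
      using proper by blast
    obtain \<eta> where \<eta>: "0 < \<eta>" "\<And>i. i \<in> S \<Longrightarrow> i \<notin> T \<Longrightarrow> V i \<le> 1 / e \<Longrightarrow> L V i \<le> - \<eta>"
      using drift by blast
    have "rate j \<le> Q \<and> e * \<eta> \<le> L (\<lambda>i. u i - e * V i) j" if j: "j \<in> S" "c \<le> u j - e * V j" for j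
    proof
      have Vj: "V j \<le> 1 / e"
        using j c u_le[of j] e by (simp add: field_simps)
      then show "rate j \<le> Q"
        using j by (intro Q) auto
      have "0 \<le> e * V j"
        using V[OF j(1)] e by simp
      then have "j \<notin> T"
        using j c u_target[of j] by auto
      then have "e * \<eta> \<le> e * (- L V j)"
        using \<eta>(2)[OF j(1) _ Vj] e by (intro mult_left_mono) auto
      then show "e * \<eta> \<le> L (\<lambda>i. u i - e * V i) j"
        using Lu[OF j(1)] linear[OF j(1), of u e V] by simp
    qed
    then show "\<exists>\<eta>>0. \<exists>Q. \<forall>i\<in>S. c \<le> u i - e * V i \<longrightarrow> rate i \<le> Q \<and> \<eta> \<le> L (\<lambda>i. u i - e * V i) i"
      using e \<eta>(1) by (intro exI[of _ "e * \<eta>"]) auto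
  qed
  then have le: "u i \<le> e * V i" if "0 < e" for e
    using that by simp
  have "u i \<le> 0"
  proof (rule field_le_epsilon)
    fix e :: real assume e: "0 < e"
    have "e / (V i + 1) * V i \<le> e"
      using V[OF i] e by (simp add: field_simps)
    then show "u i \<le> 0 + e"
      using le[of "e / (V i + 1)"] V[OF i] e by simp
  qed
  then show ?thesis
    unfolding u using u_nonneg[of i] by simp
qed

end

section \<open>Hitting times of a Markov process\<close>

text \<open>The path is observed at dyadic times only; right-continuity enters later, when these are
  compared with all times.\<close>

locale taboo_process = prob_space M + taboo_semigroup S K T
  for M :: "'a measure" and S :: "'s set" and K and T +
  fixes X :: "real \<Rightarrow> 'a \<Rightarrow> 's"
  assumes countable_S: "countable S"
    and measurable_X: "0 \<le> t \<Longrightarrow> X t \<in> measurable M (count_space S)"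
    and markov: "0 \<le> s \<Longrightarrow> 0 \<le> t \<Longrightarrow> j \<in> S \<Longrightarrow> AE \<omega> in M.
      real_cond_exp M (natural_filtration M X s) (indicator {\<omega>'. X (s + t) \<omega>' = j}) \<omega> = pmf (K t (X s \<omega>)) j"
begin

lemma X_in_S: "0 \<le> t \<Longrightarrow> \<omega> \<in> space M \<Longrightarrow> X t \<omega> \<in> S"
  using measurable_space[OF measurable_X] by simp

lemma measurable_X_compose: "0 \<le> t \<Longrightarrow> (\<lambda>\<omega>. f (X t \<omega>)) \<in> borel_measurable M"
  by (rule measurable_compose[OF measurable_X]) auto

lemma X_sets[measurable]: "0 \<le> t \<Longrightarrow> {\<omega>\<in>space M. P (X t \<omega>)} \<in> sets M"
  using measurable_sets[OF measurable_X, of t "{x\<in>S. P x}"] X_in_S[of t]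
  by (auto simp: vimage_def Int_def conj_commute cong: conj_cong)

lemma space_natural_filtration: "space (natural_filtration M X s) = space M"
  unfolding natural_filtration_def by (rule space_measure_of) auto

lemma sets_natural_filtration:
  assumes "0 \<le> r" "r \<le> s"
  shows "{\<omega>\<in>space M. P (X r \<omega>)} \<in> sets (natural_filtration M X s)"
proof -
  have "{\<omega>\<in>space M. P (X r \<omega>)} = X r -` Collect P \<inter> space M"
    by auto
  also have "\<dots> \<in> sets (natural_filtration M X s)"
    unfolding natural_filtration_def using assms
    by (subst sets_measure_of) (auto simp del: vimage_Collect_eq intro!: sigma_sets.Basic exI[of _ r] exI[of _ "Collect P"])
  finally show ?thesis .
qed

lemma subalgebra_natural_filtration: "subalgebra M (natural_filtration M X s)"
  unfolding subalgebra_def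
proof
  have "{X r -` B \<inter> space M |r B. 0 \<le> r \<and> r \<le> s} \<subseteq> sets M"
    using X_sets by (auto simp: vimage_def Int_def conj_commute)
  then show "sets (natural_filtration M X s) \<subseteq> sets M"
    unfolding natural_filtration_def by (subst sets_measure_of) (auto intro!: sets.sigma_sets_subset)
qed (rule space_natural_filtration)

lemma markov_emeasure:
  assumes "0 \<le> s" "0 \<le> t" "j \<in> S" and A: "A \<in> sets (natural_filtration M X s)"
  shows "(\<integral>\<^sup>+\<omega>. indicator A \<omega> * indicator {j} (X (s + t) \<omega>) \<partial>M)
      = (\<integral>\<^sup>+\<omega>. indicator A \<omega> * ennreal (pmf (K t (X s \<omega>)) j) \<partial>M)"
proof -
  interpret finite_measure_subalgebra M "natural_filtration M X s"
    using subalgebra_natural_filtration by unfold_locales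
  have A_M[measurable]: "A \<in> sets M"
    using A subalgebra_natural_filtration unfolding subalgebra_def by auto
  have [measurable]: "(indicator {\<omega>'. X (s + t) \<omega>' = j} :: 'a \<Rightarrow> real) \<in> borel_measurable M"
    using assms X_sets[of "s + t" "\<lambda>x. x
        = j"] by (subst borel_measurable_indicator_iff) (auto simp: Int_def conj_commute)
  have [measurable]: "(\<lambda>\<omega>. pmf (K t (X s \<omega>)) j) \<in> borel_measurable M"
    using assms by (intro measurable_X_compose)
  have int: "integrable M (indicator {\<omega>'. X (s + t) \<omega>' = j} :: _ \<Rightarrow> real)"
    by (rule integrable_const_bound[of _ 1]) (auto simp: indicator_def)
  have eq: "(\<integral>\<omega>. indicator A \<omega> * indicator {\<omega>'. X (s + t) \<omega>' = j} \<omega> \<partial>M)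
      = (\<integral>\<omega>. indicator A \<omega> * pmf (K t (X s \<omega>)) j \<partial>M)"
  proof -
    have "(\<integral>\<omega>. indicator A \<omega> * indicator {\<omega>'. X (s + t) \<omega>' = j} \<omega> \<partial>M)
        = (\<integral>\<omega>. indicator A \<omega> * real_cond_exp M (natural_filtration M X s) (indicator {\<omega>'. X (s + t) \<omega>' = j}) \<omega> \<partial>M)"
      using real_cond_exp_intA[OF int A] unfolding set_lebesgue_integral_def by simp
    also have "\<dots> = (\<integral>\<omega>. indicator A \<omega> * pmf (K t (X s \<omega>)) j \<partial>M)"
      using markov[OF assms(1-3)] by (intro integral_cong_AE) auto
    finally show ?thesis .
  qed
  have "(\<integral>\<^sup>+\<omega>. indicator A \<omega> * indicator {j} (X (s + t) \<omega>) \<partial>M)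
      = (\<integral>\<^sup>+\<omega>. ennreal (indicator A \<omega> * indicator {\<omega>'. X (s + t) \<omega>' = j} \<omega>) \<partial>M)"
    by (intro nn_integral_cong) (auto simp: indicator_def)
  also have "\<dots> = ennreal (\<integral>\<omega>. indicator A \<omega> * indicator {\<omega>'. X (s + t) \<omega>' = j} \<omega> \<partial>M)"
    by (intro nn_integral_eq_integral integrable_const_bound[of _ 1]) (auto split: split_indicator)
  also have "\<dots> = (\<integral>\<^sup>+\<omega>. ennreal (indicator A \<omega> * pmf (K t (X s \<omega>)) j) \<partial>M)"
    unfolding eq by (intro nn_integral_eq_integral[symmetric] integrable_const_bound[of _ 1]) (auto split: split_indicator simp: pmf_le_1)
  also have "\<dots> = (\<integral>\<^sup>+\<omega>. indicator A \<omega> * ennreal (pmf (K t (X s \<omega>)) j) \<partial>M)"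
    by (intro nn_integral_cong) (auto simp: indicator_def)
  finally show ?thesis .
qed

text \<open>Both sides are expanded over the countably many values of the process, and
  \<open>markov_emeasure\<close> gives the identity for each single value.\<close>

lemma markov_nn_integral:
  assumes s: "0 \<le> s" and t: "0 \<le> t" and A: "A \<in> sets (natural_filtration M X s)"
  shows "(\<integral>\<^sup>+\<omega>. indicator A \<omega> * g (X (s + t) \<omega>) \<partial>M)
      = (\<integral>\<^sup>+\<omega>. indicator A \<omega> * (\<integral>\<^sup>+j. g j \<partial>K t (X s \<omega>)) \<partial>M)"
proof -
  have A_M[measurable]: "A \<in> sets M"
    using A subalgebra_natural_filtration unfolding subalgebra_def by auto
  have [measurable]: "(\<lambda>\<omega>. indicator {j} (X (s + t) \<omega>) :: ennreal) \<in> borel_measurable M"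
    "(\<lambda>\<omega>. ennreal (pmf (K t (X s \<omega>)) j)) \<in> borel_measurable M" for j
    using s t by (intro measurable_X_compose, simp)+
  have "(\<integral>\<^sup>+\<omega>. indicator A \<omega> * g (X (s + t) \<omega>) \<partial>M)
      = (\<integral>\<^sup>+\<omega>. \<integral>\<^sup>+j. g j * (indicator A \<omega> * indicator {j} (X (s + t) \<omega>)) \<partial>count_space S \<partial>M)"
  proof (rule nn_integral_cong)
    fix \<omega> assume "\<omega> \<in> space M"
    then have in_S: "X (s + t) \<omega> \<in> S"
      using s t by (intro X_in_S) auto
    have "(\<integral>\<^sup>+j. g j * (indicator A \<omega> * indicator {j} (X (s + t) \<omega>)) \<partial>count_space S)
        = (\<integral>\<^sup>+j. (indicator A \<omega> * g j) * indicator {X (s + t) \<omega>} j \<partial>count_space S)"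
      by (intro nn_integral_cong) (auto simp: indicator_def)
    also have "\<dots> = indicator A \<omega> * g (X (s + t) \<omega>)"
      using in_S by (subst nn_integral_indicator_singleton) (auto simp: emeasure_count_space)
    finally show "indicator A \<omega> * g (X (s + t) \<omega>)
        = (\<integral>\<^sup>+j. g j * (indicator A \<omega> * indicator {j} (X (s + t) \<omega>)) \<partial>count_space S)" ..
  qed
  also have "\<dots> = (\<integral>\<^sup>+j. \<integral>\<^sup>+\<omega>. g j * (indicator A \<omega> * indicator {j} (X (s + t) \<omega>)) \<partial>M \<partial>count_space S)"
    by (intro nn_integral_count_space_nn_integral countable_S) auto
  also have "\<dots> = (\<integral>\<^sup>+j. \<integral>\<^sup>+\<omega>. g j * (indicator A \<omega> * ennreal (pmf (K t (X s \<omega>)) j)) \<partial>M \<partial>count_space S)"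
  proof (rule nn_integral_cong)
    fix j assume "j \<in> space (count_space S)"
    then show "(\<integral>\<^sup>+\<omega>. g j * (indicator A \<omega> * indicator {j} (X (s + t) \<omega>)) \<partial>M)
        = (\<integral>\<^sup>+\<omega>. g j * (indicator A \<omega> * ennreal (pmf (K t (X s \<omega>)) j)) \<partial>M)"
      using markov_emeasure[OF s t _ A, of j] by (subst (1 2) nn_integral_cmult) auto
  qed
  also have "\<dots> = (\<integral>\<^sup>+\<omega>. \<integral>\<^sup>+j. g j * (indicator A \<omega> * ennreal (pmf (K t (X s \<omega>)) j)) \<partial>count_space S \<partial>M)"
    by (intro nn_integral_count_space_nn_integral[symmetric] countable_S) auto
  also have "\<dots> = (\<integral>\<^sup>+\<omega>. indicator A \<omega> * (\<integral>\<^sup>+j. g j \<partial>K t (X s \<omega>)) \<partial>M)"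
  proof (rule nn_integral_cong)
    fix \<omega> assume "\<omega> \<in> space M"
    then have "set_pmf (K t (X s \<omega>)) \<subseteq> S"
      using s t by (intro set_pmf_K X_in_S)
    then have "(\<integral>\<^sup>+j. g j \<partial>K t (X s \<omega>)) = (\<integral>\<^sup>+j. ennreal (pmf (K t (X s \<omega>)) j) * g j \<partial>count_space S)"
      unfolding nn_integral_measure_pmf by (intro nn_integral_count_space_eq) (auto simp: set_pmf_iff)
    then show "(\<integral>\<^sup>+j. g j * (indicator A \<omega> * ennreal (pmf (K t (X s \<omega>)) j)) \<partial>count_space S)
        = indicator A \<omega> * (\<integral>\<^sup>+j. g j \<partial>K t (X s \<omega>))"
      by (simp add: nn_integral_cmult[symmetric] mult_ac)
  qed
  finally show ?thesis .
qed

abbreviation start :: "'s \<Rightarrow> 'a set" where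
  "start i \<equiv> {\<omega>\<in>space M. X 0 \<omega> = i}"

lemma avoid_process:
  assumes h: "0 \<le> h"
  shows "emeasure M {\<omega>\<in>space M. X 0 \<omega> = i \<and> (\<forall>j\<le>k. X (real j * h) \<omega> \<notin> T)}
    \<le> emeasure M (start i) * avoid h k i"
proof -
  define A where "A = (\<lambda>k. {\<omega>\<in>space M. X 0 \<omega> = i \<and> (\<forall>j\<le>k. X (real j * h) \<omega> \<notin> T)})"
  have A_F: "A k \<in> sets (natural_filtration M X (real k * h))" for k
  proof -
    have "{\<omega>\<in>space (natural_filtration M X (real k * h)). X 0 \<omega> = i \<and> (\<forall>j\<in>{..k}. X (real j * h) \<omega> \<notin> T)}
        \<in> sets (natural_filtration M X (real k * h))"
      using h by (intro sets.sets_Collect_conj sets.sets_Collect_finite_All)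
        (auto simp: space_natural_filtration mult_right_mono intro!: sets_natural_filtration)
    then show ?thesis
      by (simp add: A_def space_natural_filtration Ball_def)
  qed
  have A_M[measurable]: "A k \<in> sets M" for k
    using A_F subalgebra_natural_filtration unfolding subalgebra_def by auto
  \<comment> \<open>The m future steps are kept arbitrary so that the induction closes: conditioning
    at time kh trades the last observed avoidance for one more step of \<open>avoid\<close>, whose
    indicator equals 1 on \<open>A k\<close>.\<close>
  have *: "(\<integral>\<^sup>+\<omega>. indicator (A k) \<omega> * avoid h m (X (real k * h) \<omega>) \<partial>M)
      \<le> emeasure M (start i) * avoid h (k + m) i" for m
  proof (induction k arbitrary: m)
    case 0
    have "(\<integral>\<^sup>+\<omega>. indicator (A 0) \<omega> * avoid h m (X (real 0 * h) \<omega>) \<partial>M)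
        \<le> (\<integral>\<^sup>+\<omega>. avoid h m i * indicator (start i) \<omega> \<partial>M)"
      by (intro nn_integral_mono) (auto simp: A_def indicator_def)
    also have "\<dots> = emeasure M (start i) * avoid h m i"
      by (subst nn_integral_cmult_indicator) (auto simp: mult.commute)
    finally show ?case
      by simp
  next
    case (Suc k)
    have "(\<integral>\<^sup>+\<omega>. indicator (A (Suc k)) \<omega> * avoid h m (X (real (Suc k) * h) \<omega>) \<partial>M)
        \<le> (\<integral>\<^sup>+\<omega>. indicator (A k) \<omega> * avoid h m (X (real k * h + h) \<omega>) \<partial>M)"
      by (intro nn_integral_mono) (auto simp: A_def indicator_def algebra_simps)
    also have "\<dots> = (\<integral>\<^sup>+\<omega>. indicator (A k) \<omega> * (\<integral>\<^sup>+j. avoid h m j \<partial>K h (X (real k * h) \<omega>)) \<partial>M)"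
      using h by (intro markov_nn_integral A_F) auto
    also have "\<dots> = (\<integral>\<^sup>+\<omega>. indicator (A k) \<omega> * avoid h (Suc m) (X (real k * h) \<omega>) \<partial>M)"
      by (intro nn_integral_cong) (auto simp: A_def indicator_def)
    also have "\<dots> \<le> emeasure M (start i) * avoid h (Suc k + m) i"
      using Suc.IH[of "Suc m"] by simp
    finally show ?case .
  qed
  have "emeasure M (A k) = (\<integral>\<^sup>+\<omega>. indicator (A k) \<omega> \<partial>M)"
    by simp
  also have "\<dots> = (\<integral>\<^sup>+\<omega>. indicator (A k) \<omega> * avoid h 0 (X (real k * h) \<omega>) \<partial>M)"
    by (intro nn_integral_cong) (auto simp: A_def indicator_def)
  also have "\<dots> \<le> emeasure M (start i) * avoid h k i"
    using *[of 0] by simp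
  finally show ?thesis
    unfolding A_def .
qed

text \<open>Countably many dyadic times keep this event measurable. Avoiding all of them up to t
  implies avoidance along every grid, whence the bound by \<open>survival\<close>.\<close>

definition no_hit :: "real \<Rightarrow> 'a \<Rightarrow> bool" where
  "no_hit t \<omega> \<longleftrightarrow> (\<forall>n j::nat. real j * (1 / 2 ^ n) \<le> t \<longrightarrow> X (real j * (1 / 2 ^ n)) \<omega> \<notin> T)"

lemma no_hit_sets[measurable]: "{\<omega>\<in>space M. X 0 \<omega> = i \<and> no_hit t \<omega>} \<in> sets M"
  unfolding no_hit_def
  by (intro sets.sets_Collect_conj sets.sets_Collect_countable_All sets.sets_Collect_imp X_sets) auto

lemma no_hit_le:
  assumes "0 \<le> t"
  shows "emeasure M {\<omega>\<in>space M. X 0 \<omega> = i \<and> no_hit t \<omega>} \<le> emeasure M (start i) * survival t i"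
proof -
  let ?P = "emeasure M (start i)"
  have "emeasure M {\<omega>\<in>space M. X 0 \<omega> = i \<and> no_hit t \<omega>}
      \<le> ?P * avoid (1 / 2 ^ n) (nat \<lfloor>2 ^ n * t\<rfloor>) i" for n
  proof -
    have le: "real j * (1 / 2 ^ n) \<le> t" if "j \<le> nat \<lfloor>2 ^ n * t\<rfloor>" for j
    proof -
      have "real j \<le> 2 ^ n * t"
        using that assms by (simp add: le_nat_iff le_floor_iff)
      then show ?thesis
        by (simp add: field_simps)
    qed
    have "emeasure M {\<omega>\<in>space M. X 0 \<omega> = i \<and> no_hit t \<omega>}
        \<le> emeasure M {\<omega>\<in>space M. X 0 \<omega> = i \<and> (\<forall>j\<le>nat \<lfloor>2 ^ n * t\<rfloor>. X (real j * (1 / 2 ^ n)) \<omega> \<notin> T)}"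
    proof (rule emeasure_mono)
      have "{\<omega>\<in>space M. X 0 \<omega> = i \<and> (\<forall>j\<in>{..nat \<lfloor>2 ^ n * t\<rfloor>}. X (real j * (1 / 2 ^ n)) \<omega> \<notin> T)} \<in> sets M"
        by (intro sets.sets_Collect_conj sets.sets_Collect_finite_All X_sets) auto
      then show "{\<omega>\<in>space M. X 0 \<omega> = i \<and> (\<forall>j\<le>nat \<lfloor>2 ^ n * t\<rfloor>. X (real j * (1 / 2 ^ n)) \<omega> \<notin> T)} \<in> sets M"
        by (simp add: Ball_def)
    qed (use le in \<open>auto simp: no_hit_def\<close>)
    also have "\<dots> \<le> ?P * avoid (1 / 2 ^ n) (nat \<lfloor>2 ^ n * t\<rfloor>) i"
      by (rule avoid_process) simp
    finally show ?thesis .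
  qed
  note bound = this
  show ?thesis
  \<comment> \<open>Division by the probability of the start isolates the avoidance terms, so that
    the infimum over the grids can be taken before multiplying back.\<close>
  proof (cases "?P = 0")
    case True
    then show ?thesis
      using bound[of 0] by simp
  next
    case False
    have "emeasure M {\<omega>\<in>space M. X 0 \<omega> = i \<and> no_hit t \<omega>} / ?P \<le> survival t i"
      unfolding survival_def
      by (intro INF_greatest divide_le_posI_ennreal) (use bound False in \<open>auto simp: zero_less_iff_neq_zero mult.commute\<close>)
    then have "emeasure M {\<omega>\<in>space M. X 0 \<omega> = i \<and> no_hit t \<omega>} / ?P * ?P \<le> survival t i * ?P"
      by (rule mult_right_mono) simp
    then show ?thesis
      using False by (subst (asm) ennreal_divide_times) (simp add: ennreal_divide_self less_top[symmetric] mult.commute)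
  qed
qed

abbreviation survival_times :: "'a \<Rightarrow> real set" where
  "survival_times \<omega> \<equiv> {t. 0 \<le> t \<and> no_hit t \<omega>}"

text \<open>\<open>survival_times\<close> is an interval that starts at 0 (or is empty), so this
  integrates (1 + t) powr r up to the first dyadic hitting time. Tonelli then bounds its expectation
  by \<open>moment\<close>.\<close>

definition hit_functional :: "real \<Rightarrow> 'a \<Rightarrow> ennreal" where
  "hit_functional r \<omega> = (\<integral>\<^sup>+t. ennreal ((1 + t) powr r) * indicator (survival_times \<omega>) t \<partial>lborel)"

lemma measurable_no_hit[measurable]:
  "(\<lambda>(\<omega>, t). indicator (survival_times \<omega>) t :: ennreal) \<in> borel_measurable (M \<Otimes>\<^sub>M lborel)"
proof -
  have "(\<lambda>(\<omega>, t). indicator (survival_times \<omega>) t :: ennreal)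
      = indicator {(\<omega>, t). 0 \<le> t \<and> no_hit t \<omega>}"
    by (auto simp: indicator_def)
  also have "\<dots> \<in> borel_measurable (M \<Otimes>\<^sub>M lborel)"
  proof (subst borel_measurable_indicator_iff)
    have X: "{x \<in> space (M \<Otimes>\<^sub>M lborel). X (real j
        * (1 / 2 ^ n)) (fst x) \<notin> T} \<in> sets (M \<Otimes>\<^sub>M lborel)" for j n :: nat
      using measurable_sets[OF measurable_fst[of M lborel] X_sets[of "real j
          * (1 / 2 ^ n)" "\<lambda>x. x \<notin> T"]]
      by (auto simp: vimage_def space_pair_measure Int_def conj_commute conj_left_commute mem_Times_iff cong: conj_cong)
    have "{x \<in> space (M \<Otimes>\<^sub>M lborel). 0 \<le> snd x \<and>
        (\<forall>n j::nat. real j * (1 / 2 ^ n) \<le> snd x \<longrightarrow> X (real j * (1 / 2 ^ n)) (fst x) \<notin> T)} \<in> sets (M \<Otimes>\<^sub>M lborel)"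
      by (intro sets.sets_Collect_conj sets.sets_Collect_countable_All sets.sets_Collect_imp X) measurable
    also have "{x \<in> space (M \<Otimes>\<^sub>M lborel). 0 \<le> snd x \<and>
        (\<forall>n j::nat. real j * (1 / 2 ^ n) \<le> snd x \<longrightarrow> X (real j * (1 / 2 ^ n)) (fst x) \<notin> T)}
      = {(\<omega>, t). 0 \<le> t \<and> no_hit t \<omega>} \<inter> space (M \<Otimes>\<^sub>M lborel)"
      by (auto simp: no_hit_def)
    finally show "{(\<omega>, t). 0 \<le> t \<and> no_hit t \<omega>} \<inter> space (M \<Otimes>\<^sub>M lborel) \<in> sets (M \<Otimes>\<^sub>M lborel)" .
  qed
  finally show ?thesis .
qed

lemma hit_functional_measurable[measurable]: "hit_functional r \<in> borel_measurable M"
  unfolding hit_functional_def by measurable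

lemma hit_functional_start:
  "(\<integral>\<^sup>+\<omega>. hit_functional r \<omega> * indicator (start i) \<omega> \<partial>M)
    \<le> emeasure M (start i) * moment r i"
proof -
  interpret pair_sigma_finite M lborel
    by unfold_locales
  have [measurable]: "start i \<in> sets M"
    by (rule X_sets) simp
  have "(\<integral>\<^sup>+\<omega>. hit_functional r \<omega> * indicator (start i) \<omega> \<partial>M)
      = (\<integral>\<^sup>+\<omega>. \<integral>\<^sup>+t. ennreal ((1 + t) powr r) * indicator (survival_times \<omega>) t * indicator (start i) \<omega> \<partial>lborel \<partial>M)"
    unfolding hit_functional_def by (intro nn_integral_cong nn_integral_multc[symmetric]) measurable
  also have "\<dots> = (\<integral>\<^sup>+t. \<integral>\<^sup>+\<omega>. ennreal ((1 + t) powr r) * indicator (survival_times \<omega>) t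
      * indicator (start i) \<omega> \<partial>M \<partial>lborel)"
    by (rule Fubini'[symmetric]) measurable
  also have "\<dots> \<le> (\<integral>\<^sup>+t. emeasure M (start i)
      * (ennreal ((1 + t) powr r) * survival t i * indicator {0..} t) \<partial>lborel)"
  proof (rule nn_integral_mono)
    fix t :: real
    have "(\<integral>\<^sup>+\<omega>. ennreal ((1 + t) powr r) * indicator (survival_times \<omega>) t * indicator (start i) \<omega> \<partial>M)
        = (\<integral>\<^sup>+\<omega>. (ennreal ((1 + t) powr r) * indicator {0..} t) * indicator {\<omega>\<in>space M. X 0 \<omega> = i \<and> no_hit t \<omega>} \<omega> \<partial>M)"
      by (intro nn_integral_cong) (auto simp: indicator_def)
    also have "\<dots> = ennreal ((1 + t) powr r) * indicator {0..} t
        * emeasure M {\<omega>\<in>space M. X 0 \<omega> = i \<and> no_hit t \<omega>}"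
      by (rule nn_integral_cmult_indicator) measurable
    also have "\<dots> \<le> ennreal ((1 + t) powr r) * indicator {0..} t * (emeasure M (start i) * survival t i)"
      using no_hit_le[of t i] by (cases "0 \<le> t") (auto intro!: mult_left_mono)
    finally show "(\<integral>\<^sup>+\<omega>. ennreal ((1 + t) powr r) * indicator (survival_times \<omega>) t
        * indicator (start i) \<omega> \<partial>M)
      \<le> emeasure M (start i) * (ennreal ((1 + t) powr r) * survival t i * indicator {0..} t)"
      by (simp add: mult_ac)
  qed
  also have "\<dots> = emeasure M (start i) * moment r i"
    unfolding moment_def by (rule nn_integral_cmult) measurable
  finally show ?thesis .
qed

text \<open>Serves an initial law that is spread over the translates of one configuration: the bound
  \<open>C\<close> is uniform on \<open>D\<close>, and the starting events are disjoint, so their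
  probabilities sum to at most 1.\<close>

lemma hit_functional_le:
  assumes D: "D \<subseteq> S" and le: "\<And>i. i \<in> D \<Longrightarrow> moment r i \<le> C"
  shows "(\<integral>\<^sup>+\<omega>. hit_functional r \<omega> * indicator {\<omega>\<in>space M. X 0 \<omega> \<in> D} \<omega> \<partial>M) \<le> C"
proof -
  have D_countable: "countable D"
    using countable_S D by (rule countable_subset[rotated])
  have [measurable]: "start i \<in> sets M" "{\<omega>\<in>space M. X 0 \<omega> \<in> D} \<in> sets M" for i
    by (intro X_sets order_refl)+
  have split: "indicator {\<omega>\<in>space M. X 0 \<omega> \<in> D} \<omega> = (\<integral>\<^sup>+i. indicator (start i) \<omega> \<partial>count_space D)"
    if "\<omega> \<in> space M" for \<omega>
  proof (cases "X 0 \<omega> \<in> D")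
    case True
    have "(\<integral>\<^sup>+i. indicator (start i) \<omega> \<partial>count_space D) = (\<integral>\<^sup>+i. 1 * indicator {X 0 \<omega>} i \<partial>count_space D)"
      using that by (intro nn_integral_cong) (auto simp: indicator_def)
    also have "\<dots> = 1"
      using True by (subst nn_integral_cmult_indicator) (auto simp: emeasure_count_space)
    finally show ?thesis
      using True that by simp
  next
    case False
    then have "(\<integral>\<^sup>+i. indicator (start i) \<omega> \<partial>count_space D) = (\<integral>\<^sup>+i. 0 \<partial>count_space D)"
      by (intro nn_integral_cong) (auto simp: indicator_def)
    then show ?thesis
      using False by simp
  qed
  have total: "(\<integral>\<^sup>+i. emeasure M (start i) \<partial>count_space D) \<le> 1"
  proof -
    have "(\<integral>\<^sup>+i. emeasure M (start i) \<partial>count_space D)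
        = (\<integral>\<^sup>+i. \<integral>\<^sup>+\<omega>. indicator (start i) \<omega> \<partial>M \<partial>count_space D)"
      by simp
    also have "\<dots> = (\<integral>\<^sup>+\<omega>. \<integral>\<^sup>+i. indicator (start i) \<omega> \<partial>count_space D \<partial>M)"
      by (intro nn_integral_count_space_nn_integral[symmetric] D_countable) auto
    also have "\<dots> = (\<integral>\<^sup>+\<omega>. indicator {\<omega>\<in>space M. X 0 \<omega> \<in> D} \<omega> \<partial>M)"
      by (intro nn_integral_cong split[symmetric])
    also have "\<dots> \<le> 1"
      by (simp add: emeasure_le_1)
    finally show ?thesis .
  qed
  have "(\<integral>\<^sup>+\<omega>. hit_functional r \<omega> * indicator {\<omega>\<in>space M. X 0 \<omega> \<in> D} \<omega> \<partial>M)
      = (\<integral>\<^sup>+\<omega>. \<integral>\<^sup>+i. hit_functional r \<omega> * indicator (start i) \<omega> \<partial>count_space D \<partial>M)"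
    by (intro nn_integral_cong) (simp add: split nn_integral_cmult)
  also have "\<dots> = (\<integral>\<^sup>+i. \<integral>\<^sup>+\<omega>. hit_functional r \<omega> * indicator (start i) \<omega> \<partial>M \<partial>count_space D)"
    by (intro nn_integral_count_space_nn_integral D_countable) auto
  also have "\<dots> \<le> (\<integral>\<^sup>+i. emeasure M (start i) * C \<partial>count_space D)"
    by (intro nn_integral_mono order_trans[OF hit_functional_start] mult_left_mono le) auto
  also have "\<dots> = (\<integral>\<^sup>+i. emeasure M (start i) \<partial>count_space D) * C"
    by (rule nn_integral_multc) simp
  also have "\<dots> \<le> 1 * C"
    by (intro mult_right_mono total) simp
  finally show ?thesis by simp
qed

lemma AE_hit:
  assumes D: "D \<subseteq> S" and 0: "\<And>i. i \<in> D \<Longrightarrow> (INF k::nat. survival (real k) i) = 0"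
  shows "AE \<omega> in M. X 0 \<omega> \<in> D \<longrightarrow> (\<exists>n j::nat. X (real j * (1 / 2 ^ n)) \<omega> \<in> T)"
proof -
  have D_countable: "countable D"
    using countable_S D by (rule countable_subset[rotated])
  have "AE \<omega> in M. X 0 \<omega> = i \<longrightarrow> (\<exists>n j::nat. X (real j * (1 / 2 ^ n)) \<omega> \<in> T)" if i: "i \<in> D" for i
  proof (rule AE_I)
    let ?N = "{\<omega>\<in>space M. X 0 \<omega> = i \<and> (\<forall>n j::nat. X (real j * (1 / 2 ^ n)) \<omega> \<notin> T)}"
    show [measurable]: "?N \<in> sets M"
      by (intro sets.sets_Collect_conj sets.sets_Collect_countable_All X_sets) auto
    show "{\<omega>\<in>space M. \<not> (X 0 \<omega> = i \<longrightarrow> (\<exists>n j::nat. X (real j * (1 / 2 ^ n)) \<omega> \<in> T))} \<subseteq> ?N"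
      by auto
    have "emeasure M ?N \<le> survival (real k) i" for k :: nat
    proof -
      have "emeasure M ?N \<le> emeasure M {\<omega>\<in>space M. X 0 \<omega> = i \<and> no_hit (real k) \<omega>}"
        by (rule emeasure_mono) (auto simp: no_hit_def)
      also have "\<dots> \<le> emeasure M (start i) * survival (real k) i"
        by (rule no_hit_le) simp
      also have "\<dots> \<le> 1 * survival (real k) i"
        by (intro mult_right_mono emeasure_le_1) simp
      finally show ?thesis by simp
    qed
    then have "emeasure M ?N \<le> (INF k::nat. survival (real k) i)"
      by (rule INF_greatest)
    then show "emeasure M ?N = 0"
      using 0[OF i] by simp
  qed
  then have "AE \<omega> in M. \<forall>i\<in>D. X 0 \<omega> = i \<longrightarrow> (\<exists>n j::nat. X (real j * (1 / 2 ^ n)) \<omega> \<in> T)"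
    using D_countable by (rule AE_ball_countable')
  then show ?thesis
    by eventually_elim auto
qed

end

section \<open>Inversions and their spread\<close>

definition zeros_upto :: "config \<Rightarrow> int \<Rightarrow> real" where
  "zeros_upto \<nu> x = card {z. z \<le> x \<and> \<not> \<nu> z}"

definition ones_above :: "config \<Rightarrow> int \<Rightarrow> real" where
  "ones_above \<nu> x = card {y. x < y \<and> \<nu> y}"

definition falls :: "config \<Rightarrow> int set" where
  "falls \<nu> = {x. \<nu> x \<and> \<not> \<nu> (x + 1)}"

definition rises :: "config \<Rightarrow> int set" where
  "rises \<nu> = {x. \<not> \<nu> x \<and> \<nu> (x + 1)}"

definition flip :: "int \<Rightarrow> config \<Rightarrow> config" where
  "flip x \<nu> = \<nu>(x := \<not> \<nu> x)"

definition swap :: "int \<Rightarrow> config \<Rightarrow> config" where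
  "swap x \<nu> = \<nu>(x := \<nu> (x + 1), x + 1 := \<nu> x)"

text \<open>Each one contributes the number of zeros to its left. Summation over the nonzero terms,
  rather than over a chosen window, makes translation invariance a mere reindexing; for members of
  \<open>configs\<close> there are finitely many.\<close>

definition inversions :: "config \<Rightarrow> real" where
  "inversions \<nu> = sum (zeros_upto \<nu>) {x. \<nu> x \<and> zeros_upto \<nu> x \<noteq> 0}"

text \<open>The sum of the distances \<open>y - x\<close> over all inversions, that is, over all pairs
  \<open>x < y\<close> with a zero at \<open>x\<close> and a one at \<open>y\<close>.\<close>

definition spread :: "config \<Rightarrow> real" where
  "spread \<nu> = (\<Sum>x | zeros_upto \<nu> x * ones_above \<nu> x \<noteq> 0. zeros_upto \<nu> x * ones_above \<nu> x)"

abbreviation energy :: "real \<Rightarrow> config \<Rightarrow> real" where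
  "energy \<alpha> \<equiv> \<lambda>\<nu>. spread \<nu> + \<alpha> * inversions \<nu>"

text \<open>By exchanging summations this is the sum of the distances y - x over all ones y > x;
  \<open>left_area\<close> is likewise the sum of x - z over all zeros z < x. Their difference is,
  up to sign, the change of \<open>spread\<close> under a flip at x.\<close>

definition right_area :: "config \<Rightarrow> int \<Rightarrow> real" where
  "right_area \<nu> x = sum (ones_above \<nu>) {y. x \<le> y \<and> ones_above \<nu> y \<noteq> 0}"

definition left_area :: "config \<Rightarrow> int \<Rightarrow> real" where
  "left_area \<nu> x = sum (zeros_upto \<nu>) {y. y < x \<and> zeros_upto \<nu> y \<noteq> 0}"

definition window :: "config \<Rightarrow> int \<Rightarrow> int \<Rightarrow> bool" where
  "window \<nu> a b \<longleftrightarrow> (\<forall>x\<le>a. \<nu> x) \<and> (\<forall>x\<ge>b. \<not> \<nu> x)"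

lemma window_less: "window \<nu> a b \<Longrightarrow> a < b"
  unfolding window_def by (meson not_le_imp_less order_refl)

lemma window_mono: "window \<nu> a b \<Longrightarrow> a' \<le> a \<Longrightarrow> b \<le> b' \<Longrightarrow> window \<nu> a' b'"
  unfolding window_def by auto

lemma window_D: "window \<nu> a b \<Longrightarrow> x \<le> a \<Longrightarrow> \<nu> x" "window \<nu> a b \<Longrightarrow> b \<le> x \<Longrightarrow> \<not> \<nu> x"
  unfolding window_def by auto

lemma configs_eq_window: "configs = {\<nu>. \<exists>a b. window \<nu> a b}"
proof (intro set_eqI iffI)
  fix \<nu> assume "\<nu> \<in> configs"
  then have fin: "finite {x. x < 0 \<and> \<not> \<nu> x}" "finite {x. x > 0 \<and> \<nu> x}"
    by (auto simp: configs_def)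
  define a where "a = Min (insert 0 {x. x < 0 \<and> \<not> \<nu> x}) - 1"
  define b where "b = Max (insert 0 {x. x > 0 \<and> \<nu> x}) + 1"
  have "\<nu> x" if "x \<le> a" for x
  proof (rule ccontr)
    assume "\<not> \<nu> x"
    moreover have "Min (insert 0 {x. x < 0 \<and> \<not> \<nu> x}) \<le> 0"
      using fin by (intro Min_le) auto
    then have "a < 0"
      unfolding a_def by linarith
    ultimately have "Min (insert 0 {x. x < 0 \<and> \<not> \<nu> x}) \<le> x"
      using fin that by (intro Min_le) auto
    then show False
      using that by (simp add: a_def)
  qed
  moreover have "\<not> \<nu> x" if "b \<le> x" for x
  proof
    assume "\<nu> x"
    moreover have "0 < b"
      unfolding b_def using fin Max_ge[of "insert 0 {x. x > 0 \<and> \<nu> x}" 0] by simp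
    ultimately have "x \<le> Max (insert 0 {x. x > 0 \<and> \<nu> x})"
      using fin that by (intro Max_ge) auto
    then show False
      using that by (simp add: b_def)
  qed
  ultimately show "\<nu> \<in> {\<nu>. \<exists>a b. window \<nu> a b}"
    unfolding window_def by blast
next
  fix \<nu> assume "\<nu> \<in> {\<nu>. \<exists>a b. window \<nu> a b}"
  then obtain a b where ab: "window \<nu> a b" by auto
  have "{x. x < 0 \<and> \<not> \<nu> x} \<subseteq> {a..0}" "{x. x > 0 \<and> \<nu> x} \<subseteq> {0..b}"
    using window_D[OF ab] by (auto simp: not_less[symmetric]) 
  then show "\<nu> \<in> configs"
    unfolding configs_def by (auto intro: finite_subset)
qed

lemma window_in_configs: "window \<nu> a b \<Longrightarrow> \<nu> \<in> configs"
  unfolding configs_eq_window by auto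

lemma finite_zeros: "window \<nu> a b \<Longrightarrow> finite {z. z \<le> x \<and> \<not> \<nu> z}"
  by (rule finite_subset[of _ "{a..x}"]) (auto simp: window_def intro: ccontr)

lemma finite_ones: "window \<nu> a b \<Longrightarrow> finite {y. x < y \<and> \<nu> y}"
  by (rule finite_subset[of _ "{x..b}"]) (auto simp: window_def intro: ccontr)

lemma zeros_upto_nonneg: "0 \<le> zeros_upto \<nu> x" and ones_above_nonneg: "0 \<le> ones_above \<nu> x"
  by (auto simp: zeros_upto_def ones_above_def)

lemma zeros_upto_eq_0:
  assumes "window \<nu> a b" "x \<le> a"
  shows "zeros_upto \<nu> x = 0"
proof -
  have "{z. z \<le> x \<and> \<not> \<nu> z} = {}"
    using assms by (auto simp: window_def)
  then show ?thesis by (simp only: zeros_upto_def card.empty of_nat_0)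
qed

lemma ones_above_eq_0:
  assumes "window \<nu> a b" "b \<le> x + 1"
  shows "ones_above \<nu> x = 0"
proof -
  have "{y. x < y \<and> \<nu> y} = {}"
    using assms by (auto simp: window_def)
  then show ?thesis by (simp only: ones_above_def card.empty of_nat_0)
qed

lemma zeros_upto_add_1:
  assumes "window \<nu> a b"
  shows "zeros_upto \<nu> (x + 1) = zeros_upto \<nu> x + of_bool (\<not> \<nu> (x + 1))"
proof -
  have "{z. z \<le> x + 1 \<and> \<not> \<nu> z} = (if \<nu> (x + 1) then {} else {x + 1}) \<union> {z. z \<le> x \<and> \<not> \<nu> z}"
    by (auto simp: order_le_less)
  then show ?thesis
    using finite_zeros[OF assms, of x] by (simp add: zeros_upto_def)
qed

lemma ones_above_add_1:
  assumes "window \<nu> a b"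
  shows "ones_above \<nu> x = ones_above \<nu> (x + 1) + of_bool (\<nu> (x + 1))"
proof -
  have "{y. x < y \<and> \<nu> y} = (if \<nu> (x + 1) then {x + 1} else {}) \<union> {y. x + 1 < y \<and> \<nu> y}"
    by (auto simp: order_le_less) (metis add1_zle_eq order_le_less)+
  then show ?thesis
    using finite_ones[OF assms, of "x + 1"] by (simp add: ones_above_def)
qed

lemma zeros_upto_mono:
  assumes "window \<nu> a b" "x \<le> y"
  shows "zeros_upto \<nu> x \<le> zeros_upto \<nu> y"
  unfolding zeros_upto_def of_nat_le_iff
  using assms(2) by (intro card_mono finite_zeros[OF assms(1)]) auto

lemma ones_above_antimono:
  assumes "window \<nu> a b" "x \<le> y"
  shows "ones_above \<nu> y \<le> ones_above \<nu> x"
  unfolding ones_above_def of_nat_le_iff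
  using assms(2) by (intro card_mono finite_ones[OF assms(1)]) auto

lemma inversions_window:
  assumes "window \<nu> a b"
  shows "inversions \<nu> = (\<Sum>x\<in>{a..b}. of_bool (\<nu> x) * zeros_upto \<nu> x)"
proof -
  have "{x. \<nu> x \<and> zeros_upto \<nu> x \<noteq> 0} \<subseteq> {a..b}"
    using zeros_upto_eq_0[OF assms] window_D(2)[OF assms] by (auto simp: linorder_not_le[symmetric])
      (meson linorder_not_le nle_le)+
  then have "(\<Sum>x\<in>{a..b}. of_bool (\<nu> x) * zeros_upto \<nu> x)
      = (\<Sum>x\<in>{x. \<nu> x \<and> zeros_upto \<nu> x \<noteq> 0}. of_bool (\<nu> x) * zeros_upto \<nu> x)"
    by (intro sum.mono_neutral_right) auto
  then show ?thesis
    by (simp add: inversions_def)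
qed

text \<open>The product at x counts the inversions that straddle the cut between x and x + 1; an
  inversion of length d straddles d cuts.\<close>

lemma spread_window:
  assumes "window \<nu> a b"
  shows "spread \<nu> = (\<Sum>x\<in>{a..b}. zeros_upto \<nu> x * ones_above \<nu> x)"
proof -
  have "{x. zeros_upto \<nu> x * ones_above \<nu> x \<noteq> 0} \<subseteq> {a..b}"
  proof
    fix x assume "x \<in> {x. zeros_upto \<nu> x * ones_above \<nu> x \<noteq> 0}"
    then have "\<not> x \<le> a" "\<not> b \<le> x + 1"
      using zeros_upto_eq_0[OF assms, of x] ones_above_eq_0[OF assms, of x] by auto
    then show "x \<in> {a..b}" by auto
  qed
  then show ?thesis
    unfolding spread_def by (intro sum.mono_neutral_left) auto
qed

lemma right_area_window:
  assumes "window \<nu> a b"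
  shows "right_area \<nu> x = (\<Sum>y\<in>{x..b}. ones_above \<nu> y)"
proof -
  have "{y. x \<le> y \<and> ones_above \<nu> y \<noteq> 0} \<subseteq> {x..b}"
  proof
    fix y assume "y \<in> {y. x \<le> y \<and> ones_above \<nu> y \<noteq> 0}"
    then have "x \<le> y" "\<not> b \<le> y + 1"
      using ones_above_eq_0[OF assms, of y] by auto
    then show "y \<in> {x..b}" by auto
  qed
  then show ?thesis
    unfolding right_area_def by (intro sum.mono_neutral_left) auto
qed

lemma left_area_window:
  assumes "window \<nu> a b"
  shows "left_area \<nu> x = (\<Sum>y\<in>{a..<x}. zeros_upto \<nu> y)"
proof -
  have "{y. y < x \<and> zeros_upto \<nu> y \<noteq> 0} \<subseteq> {a..<x}"
  proof
    fix y assume "y \<in> {y. y < x \<and> zeros_upto \<nu> y \<noteq> 0}"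
    then have "y < x" "\<not> y \<le> a"
      using zeros_upto_eq_0[OF assms, of y] by auto
    then show "y \<in> {a..<x}" by auto
  qed
  then show ?thesis
    unfolding left_area_def by (intro sum.mono_neutral_left) auto
qed

lemma right_area_add_1:
  assumes "window \<nu> a b"
  shows "right_area \<nu> x = ones_above \<nu> x + right_area \<nu> (x + 1)"
proof -
  \<comment> \<open>The window is enlarged so that x can be split off even when it lies beyond
    b.\<close>
  define b' where "b' = max b x"
  have w: "window \<nu> a b'"
    by (rule window_mono[OF assms]) (auto simp: b'_def)
  have "{x..b'} = insert x {x + 1..b'}"
    by (auto simp: b'_def)
  then show ?thesis
    unfolding right_area_window[OF w] by simp
qed

lemma left_area_add_1:
  assumes "window \<nu> a b"
  shows "left_area \<nu> (x + 1) = left_area \<nu> x + zeros_upto \<nu> x"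
proof -
  define a' where "a' = min a x"
  have w: "window \<nu> a' b"
    by (rule window_mono[OF assms]) (auto simp: a'_def)
  have "{a'..<x + 1} = insert x {a'..<x}"
    by (auto simp: a'_def)
  then show ?thesis
    unfolding left_area_window[OF w] by simp
qed

subsection \<open>Flips and swaps\<close>

lemma flip_flip: "flip x (flip x \<nu>) = \<nu>"
  by (auto simp: flip_def)

lemma flip_apply: "flip x \<nu> y = (if y = x then \<not> \<nu> x else \<nu> y)"
  by (auto simp: flip_def)

lemma swap_eq_flip: "\<nu> x \<noteq> \<nu> (x + 1) \<Longrightarrow> swap x \<nu> = flip (x + 1) (flip x \<nu>)"
  by (auto simp: flip_def swap_def)

lemma window_flip: "window \<nu> a b \<Longrightarrow> a < x \<Longrightarrow> x < b \<Longrightarrow> window (flip x \<nu>) a b"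
  by (auto simp: window_def flip_def)

lemma zeros_upto_flip_one:
  assumes "window \<nu> a b" "\<nu> x"
  shows "zeros_upto (flip x \<nu>) y = zeros_upto \<nu> y + of_bool (x \<le> y)"
proof -
  have "{z. z \<le> y \<and> \<not> flip x \<nu> z} = (if x \<le> y then {x} else {}) \<union> {z. z \<le> y \<and> \<not> \<nu> z}"
    using assms(2) by (auto simp: flip_def)
  then show ?thesis
    using finite_zeros[OF assms(1), of y] assms(2) by (simp add: zeros_upto_def)
qed

lemma ones_above_flip_one:
  assumes "window \<nu> a b" "\<nu> x"
  shows "ones_above (flip x \<nu>) y = ones_above \<nu> y - of_bool (y < x)"
proof -
  have "{z. y < z \<and> \<nu> z} = (if y < x then {x} else {}) \<union> {z. y < z \<and> flip x \<nu> z}"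
    using assms(2) by (auto simp: flip_def)
  moreover have "finite {z. y < z \<and> flip x \<nu> z}"
    by (rule finite_subset[OF _ finite_ones[OF assms(1), of y]]) (use assms in \<open>auto simp: flip_def split: if_splits\<close>)
  ultimately show ?thesis
    using assms(2) by (simp add: ones_above_def flip_apply)
qed

text \<open>Turning the one at x into a zero destroys its inversions with the zeros on its left and
  creates one with each one on its right.\<close>

lemma inversions_flip_one:
  assumes w: "window \<nu> a b" and x: "a < x" "x < b" "\<nu> x"
  shows "inversions (flip x \<nu>) = inversions \<nu> + ones_above \<nu> x - zeros_upto \<nu> x"
proof -
  have "{a..b} \<inter> {y. x < y \<and> \<nu> y} = {y. x < y \<and> \<nu> y}"
    using w x window_D(2)[OF w] by (auto simp: linorder_not_le[symmetric]) (meson linorder_not_le nle_le)+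
  then have ones: "(\<Sum>y\<in>{a..b}. of_bool (x < y \<and> \<nu> y)) = ones_above \<nu> x"
    by (simp add: ones_above_def of_bool_def sum.If_cases)
  have "inversions (flip x \<nu>) - inversions \<nu>
      = (\<Sum>y\<in>{a..b}. of_bool (x < y \<and> \<nu> y) - (if y = x then zeros_upto \<nu> x else 0))"
    unfolding inversions_window[OF w] inversions_window[OF window_flip[OF w x(1,2)]] sum_subtractf[symmetric]
    using x by (intro sum.cong refl) (auto simp: zeros_upto_flip_one[OF w] flip_apply algebra_simps)
  also have "\<dots> = ones_above \<nu> x - zeros_upto \<nu> x"
    unfolding sum_subtractf ones using x by simp
  finally show ?thesis by simp
qed

lemma inversions_flip_zero:
  assumes w: "window \<nu> a b" and x: "a < x" "x < b" "\<not> \<nu> x"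
  shows "inversions (flip x \<nu>) = inversions \<nu> + zeros_upto \<nu> x - ones_above \<nu> x - 1"
proof -
  have w': "window (flip x \<nu>) a b" and x': "flip x \<nu> x"
    using w x by (auto simp: window_flip flip_apply)
  show ?thesis
    using inversions_flip_one[OF w' x(1,2) x'] zeros_upto_flip_one[OF w' x', of x] ones_above_flip_one[OF w' x', of x]
    by (simp add: flip_flip)
qed

lemma right_area_flip_one:
  assumes w: "window \<nu> a b" and x: "a < x" "x < b" "\<nu> x"
  shows "right_area (flip x \<nu>) x = right_area \<nu> x"
  unfolding right_area_window[OF w] right_area_window[OF window_flip[OF w x(1,2)]]
  by (intro sum.cong refl) (simp add: ones_above_flip_one[OF w x(3)])

lemma left_area_flip_one:
  assumes w: "window \<nu> a b" and x: "a < x" "x < b" "\<nu> x"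
  shows "left_area (flip x \<nu>) x = left_area \<nu> x"
  unfolding left_area_window[OF w] left_area_window[OF window_flip[OF w x(1,2)]]
  by (intro sum.cong refl) (simp add: zeros_upto_flip_one[OF w x(3)])

text \<open>Every cut from x on gains a zero on its left, which adds \<open>ones_above\<close>;
  every cut before x loses a one on its right, which removes \<open>zeros_upto\<close>.\<close>

lemma spread_flip_one:
  assumes w: "window \<nu> a b" and x: "a < x" "x < b" "\<nu> x"
  shows "spread (flip x \<nu>) = spread \<nu> + right_area \<nu> x - left_area \<nu> x"
proof -
  have "spread (flip x \<nu>) - spread \<nu>
      = (\<Sum>y\<in>{a..b}. (if x \<le> y then ones_above \<nu> y else 0) - (if y < x then zeros_upto \<nu> y else 0))"
    unfolding spread_window[OF w] spread_window[OF window_flip[OF w x(1,2)]] sum_subtractf[symmetric]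
    using x by (intro sum.cong refl) (auto simp: zeros_upto_flip_one[OF w] ones_above_flip_one[OF w] algebra_simps)
  also have "\<dots> = (\<Sum>y\<in>{a..b} \<inter> {y. x \<le> y}. ones_above \<nu> y) - (\<Sum>y\<in>{a..b} \<inter> {y. y < x}. zeros_upto \<nu> y)"
    unfolding sum_subtractf by (simp add: sum.If_cases)
  also have "{a..b} \<inter> {y. x \<le> y} = {x..b}"
    using x by auto
  also have "{a..b} \<inter> {y. y < x} = {a..<x}"
    using x by auto
  finally show ?thesis
    unfolding right_area_window[OF w] left_area_window[OF w] by simp
qed

lemma spread_flip_zero:
  assumes w: "window \<nu> a b" and x: "a < x" "x < b" "\<not> \<nu> x"
  shows "spread (flip x \<nu>) = spread \<nu> - right_area \<nu> x + left_area \<nu> x"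
proof -
  have w': "window (flip x \<nu>) a b" and x': "flip x \<nu> x"
    using w x by (auto simp: window_flip flip_apply)
  show ?thesis
    using spread_flip_one[OF w' x(1,2) x'] right_area_flip_one[OF w' x(1,2) x'] left_area_flip_one[OF w' x(1,2) x']
    by (simp add: flip_flip)
qed

text \<open>The new inversion has length 1. In addition the one moves away from every zero on its
  left and the zero from every one on its right, each by one site.\<close>

lemma swap_fall:
  assumes w: "window \<nu> a b" and x: "a < x" "x + 1 < b" "x \<in> falls \<nu>"
  shows "inversions (swap x \<nu>) = inversions \<nu> + 1"
    and "spread (swap x \<nu>) = spread \<nu> + (zeros_upto \<nu> x + ones_above \<nu> x + 1)"
proof -
  have \<nu>: "\<nu> x" "\<not> \<nu> (x + 1)"
    using x by (auto simp: falls_def)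
  let ?\<mu> = "flip x \<nu>"
  have w': "window ?\<mu> a b" and \<mu>: "\<not> ?\<mu> (x + 1)"
    using w x \<nu> by (auto simp: window_flip flip_apply)
  have eq: "swap x \<nu> = flip (x + 1) ?\<mu>"
    using \<nu> by (simp add: swap_eq_flip)
  note flips = zeros_upto_flip_one[OF w \<nu>(1)] ones_above_flip_one[OF w \<nu>(1)]
  show "inversions (swap x \<nu>) = inversions \<nu> + 1"
    unfolding eq using inversions_flip_zero[OF w' _ x(2) \<mu>] inversions_flip_one[OF w x(1) _ \<nu>(1)] x
      zeros_upto_add_1[OF w, of x] ones_above_add_1[OF w, of x] \<nu> by (simp add: flips)
  show "spread (swap x \<nu>) = spread \<nu> + (zeros_upto \<nu> x + ones_above \<nu> x + 1)"
    unfolding eq using spread_flip_zero[OF w' _ x(2) \<mu>] spread_flip_one[OF w x(1) _ \<nu>(1)] x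
      right_area_add_1[OF w', of x] left_area_add_1[OF w', of x] right_area_flip_one[OF w x(1) _ \<nu>(1)]
      left_area_flip_one[OF w x(1) _ \<nu>(1)]
    by (simp add: flips)
qed

lemma swap_rise:
  assumes w: "window \<nu> a b" and x: "a < x" "x + 1 < b" "x \<in> rises \<nu>"
  shows "inversions (swap x \<nu>) = inversions \<nu> - 1"
    and "spread (swap x \<nu>) = spread \<nu> - (zeros_upto \<nu> x + ones_above \<nu> x - 1)"
proof -
  have \<nu>: "\<not> \<nu> x" "\<nu> (x + 1)"
    using x by (auto simp: rises_def)
  let ?\<mu> = "swap x \<nu>"
  have w': "window ?\<mu> a b" and \<mu>: "x \<in> falls ?\<mu>"
    using w x \<nu> by (auto simp: window_def swap_def falls_def)
  have swap: "swap x ?\<mu> = \<nu>"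
    using \<nu> by (auto simp: swap_def fun_eq_iff)
  have \<mu>x: "?\<mu> x" and eq: "flip x ?\<mu> = flip (x + 1) \<nu>"
    using \<nu> by (auto simp: swap_def flip_def fun_eq_iff)
  have "zeros_upto \<nu> x = zeros_upto ?\<mu> x + 1" "ones_above \<nu> x = ones_above ?\<mu> x + 1"
    using zeros_upto_flip_one[OF w' \<mu>x, of x] ones_above_flip_one[OF w' \<mu>x, of x]
      zeros_upto_flip_one[OF w \<nu>(2), of x] ones_above_flip_one[OF w \<nu>(2), of x]
    by (simp_all add: eq)
  then show "inversions ?\<mu> = inversions \<nu> - 1" "spread ?\<mu>
      = spread \<nu> - (zeros_upto \<nu> x + ones_above \<nu> x - 1)"
    using swap_fall[OF w' x(1,2) \<mu>] by (simp_all add: swap)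
qed

subsection \<open>The generator as a sum over the boundaries\<close>

lemma falls_window: "window \<nu> a b \<Longrightarrow> falls \<nu> \<subseteq> {a..<b}"
  and rises_window: "window \<nu> a b \<Longrightarrow> rises \<nu> \<subseteq> {a..<b}"
  by (auto simp: falls_def rises_def window_def) (meson add1_zle_eq linorder_not_le order_less_imp_le)+

lemma finite_falls: "window \<nu> a b \<Longrightarrow> finite (falls \<nu>)"
  and finite_rises: "window \<nu> a b \<Longrightarrow> finite (rises \<nu>)"
  using falls_window rises_window by (meson finite_atLeastLessThan_int finite_subset)+

lemma exclusion_generator_eq:
  assumes "window \<nu> a b"
  shows "exclusion_generator p f \<nu>
    = (\<Sum>x\<in>falls \<nu>. (1 - p) * (f (swap x \<nu>) - f \<nu>)) + (\<Sum>x\<in>rises \<nu>. p * (f (swap x \<nu>) - f \<nu>))"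
proof -
  note fin = finite_falls[OF assms] finite_rises[OF assms]
  let ?g = "\<lambda>(x, y). jump_prob p x y * of_bool (\<nu> x) * (1 - of_bool (\<nu> y))
      * (f (\<nu>(x := \<nu> y, y := \<nu> x)) - f \<nu>)"
  let ?F = "(\<lambda>x. (x, x + 1)) ` falls \<nu>" and ?R = "(\<lambda>x. (x + 1, x)) ` rises \<nu>"
  have "exclusion_generator p f \<nu> = infsum ?g UNIV"
    by (simp add: exclusion_generator_def case_prod_beta')
  also have "\<dots> = infsum ?g (?F \<union> ?R)"
  proof (rule infsum_cong_neutral)
    fix xy assume "xy \<in> UNIV - (?F \<union> ?R)"
    moreover obtain x y where xy: "xy = (x, y)" by fastforce
    ultimately have "\<not> (y = x + 1 \<and> x \<in> falls \<nu>)" "\<not> (x = y + 1 \<and> y \<in> rises \<nu>)"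
      by auto
    then show "?g xy = 0"
      unfolding xy by (auto simp: jump_prob_def falls_def rises_def)
  qed auto
  also have "\<dots> = sum ?g ?F + sum ?g ?R"
    using fin by (subst infsum_finite) (auto intro!: sum.union_disjoint)
  also have "sum ?g ?F = (\<Sum>x\<in>falls \<nu>. (1 - p) * (f (swap x \<nu>) - f \<nu>))"
    by (subst sum.reindex) (auto simp: inj_on_def jump_prob_def falls_def swap_def intro!: sum.cong)
  also have "sum ?g ?R = (\<Sum>x\<in>rises \<nu>. p * (f (swap x \<nu>) - f \<nu>))"
    by (subst sum.reindex)
      (auto simp: inj_on_def jump_prob_def rises_def swap_def fun_upd_twist intro!: sum.cong)
  finally show ?thesis .
qed

text \<open>The flip rate of a site is half the number of boundaries adjacent to it. Assigning each
  half to its boundary turns the sum over sites into a sum over boundaries, each flipping either of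
  its two sites at rate 1/2.\<close>

lemma voter_generator_eq:
  assumes "window \<nu> a b"
  shows "voter_generator f \<nu>
    = (\<Sum>x\<in>falls \<nu>. (f (flip x \<nu>) + f (flip (x + 1) \<nu>) - 2 * f \<nu>) / 2)
    + (\<Sum>x\<in>rises \<nu>. (f (flip x \<nu>) + f (flip (x + 1) \<nu>) - 2 * f \<nu>) / 2)"
proof -
  note fin = finite_falls[OF assms] finite_rises[OF assms]
  let ?B = "falls \<nu> \<union> rises \<nu>"
  let ?h = "\<lambda>x. (f (flip x \<nu>) - f \<nu>) / 2"
  have B: "?B \<subseteq> {a..<b}"
    using falls_window[OF assms] rises_window[OF assms] by simp
  have disj: "falls \<nu> \<inter> rises \<nu> = {}"
    by (auto simp: falls_def rises_def)
  have rate: "flip_rate x \<nu> * (f (\<nu>(x := \<not> \<nu> x)) - f \<nu>)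
      = of_bool (x \<in> ?B) * ?h x + of_bool (x - 1 \<in> ?B) * ?h x" for x
    by (auto simp: flip_rate_def falls_def rises_def flip_def field_simps)
  have "voter_generator f \<nu> = infsum (\<lambda>x. of_bool (x \<in> ?B) * ?h x + of_bool (x - 1 \<in> ?B) * ?h x) {a..b}"
    unfolding voter_generator_def rate using B by (intro infsum_cong_neutral) auto
  also have "\<dots> = (\<Sum>x\<in>{a..b}. of_bool (x \<in> ?B) * ?h x) + (\<Sum>x\<in>{a..b}. of_bool (x - 1 \<in> ?B) * ?h x)"
    by (simp add: sum.distrib)
  also have "(\<Sum>x\<in>{a..b}. of_bool (x \<in> ?B) * ?h x) = (\<Sum>x\<in>?B. ?h x)"
    using B by (intro sum.mono_neutral_cong_right) auto
  also have "(\<Sum>x\<in>{a..b}. of_bool (x - 1 \<in> ?B) * ?h x) = (\<Sum>x\<in>{x. x - 1 \<in> ?B}. ?h x)"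
  proof (intro sum.mono_neutral_cong_right subsetI)
    fix x assume "x \<in> {x. x - 1 \<in> ?B}"
    then show "x \<in> {a..b}"
      using subsetD[OF B, of "x - 1"] by auto
  qed auto
  also have "{x. x - 1 \<in> ?B} = (\<lambda>x. x + 1) ` ?B"
  proof (intro set_eqI iffI)
    fix x assume "x \<in> {x. x - 1 \<in> ?B}"
    then show "x \<in> (\<lambda>x. x + 1) ` ?B"
      by (intro image_eqI[of _ _ "x - 1"]) auto
  qed auto
  also have "(\<Sum>x\<in>(\<lambda>x. x + 1) ` ?B. ?h x) = (\<Sum>x\<in>?B. ?h (x + 1))"
    by (subst sum.reindex) (auto intro!: inj_onI)
  also have "(\<Sum>x\<in>?B. ?h x) + (\<Sum>x\<in>?B. ?h (x + 1))
      = (\<Sum>x\<in>?B. (f (flip x \<nu>) + f (flip (x + 1) \<nu>) - 2 * f \<nu>) / 2)"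
    unfolding sum.distrib[symmetric] by (intro sum.cong) (auto simp: field_simps)
  finally show ?thesis
    using fin disj by (simp add: sum.union_disjoint)
qed

lemma generator_eq:
  assumes "window \<nu> a b"
  shows "exclusion_voter_generator \<beta> p f \<nu>
    = (\<Sum>x\<in>falls \<nu>. (1 - \<beta>) * (1 - p) * (f (swap x \<nu>) - f \<nu>) + \<beta> / 2 * (f (flip x \<nu>) + f (flip (x + 1) \<nu>) - 2 * f \<nu>))
    + (\<Sum>x\<in>rises \<nu>. (1 - \<beta>) * p * (f (swap x \<nu>) - f \<nu>) + \<beta> / 2 * (f (flip x \<nu>) + f (flip (x + 1) \<nu>) - 2 * f \<nu>))"
  unfolding exclusion_voter_generator_def exclusion_generator_eq[OF assms] voter_generator_eq[OF assms]
  by (simp add: sum.distrib sum_distrib_left distrib_left mult.assoc)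

lemma sum_telescope_int:
  fixes h :: "int \<Rightarrow> real"
  assumes "a \<le> b"
  shows "(\<Sum>x\<in>{a..<b}. h x - h (x + 1)) = h a - h b"
  using assms
proof (induction b rule: int_ge_induct)
  case (step b)
  then have "{a..<b + 1} = insert b {a..<b}"
    by auto
  then show ?case
    using step by simp
qed simp

lemma sum_falls_minus_sum_rises:
  assumes "window \<nu> a b"
  shows "(\<Sum>x\<in>{a..<b}. (of_bool (\<nu> x) - of_bool (\<nu> (x + 1))) * g x)
      = sum g (falls \<nu>) - (sum g (rises \<nu>) :: real)"
proof -
  have "(\<Sum>x\<in>{a..<b}. (of_bool (\<nu> x) - of_bool (\<nu> (x + 1))) * g x)
      = (\<Sum>x\<in>{a..<b}. of_bool (x \<in> falls \<nu>) * g x) - (\<Sum>x\<in>{a..<b}. of_bool (x \<in> rises \<nu>) * g x)"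
    unfolding sum_subtractf[symmetric] by (intro sum.cong) (auto simp: falls_def rises_def)
  also have "(\<Sum>x\<in>{a..<b}. of_bool (x \<in> falls \<nu>) * g x) = sum g (falls \<nu>)"
    using falls_window[OF assms] by (intro sum.mono_neutral_cong_right) auto
  also have "(\<Sum>x\<in>{a..<b}. of_bool (x \<in> rises \<nu>) * g x) = sum g (rises \<nu>)"
    using rises_window[OF assms] by (intro sum.mono_neutral_cong_right) auto
  finally show ?thesis .
qed

lemma card_falls:
  assumes "window \<nu> a b"
  shows "card (falls \<nu>) = card (rises \<nu>) + 1"
proof -
  have "real (card (falls \<nu>)) - real (card (rises \<nu>)) = of_bool (\<nu> a) - of_bool (\<nu> b)"
    using sum_falls_minus_sum_rises[OF assms, of "\<lambda>_. 1"] window_less[OF assms]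
      sum_telescope_int[of a b "\<lambda>x. of_bool (\<nu> x)"] by simp
  then show ?thesis
    using assms by (simp add: window_def)
qed

text \<open>With \<open>g = zeros_upto + ones_above\<close>, the alternating sum of \<open>g\<close> over the boundaries
  telescopes, since \<open>(\<nu> x - \<nu> (x + 1)) * g x = H x - H (x + 1)\<close> for \<open>H = \<nu> * g - ones_above\<close>.\<close>

lemma sum_falls_eq_sum_rises:
  assumes "window \<nu> a b"
  shows "(\<Sum>x\<in>falls \<nu>. zeros_upto \<nu> x + ones_above \<nu> x) = (\<Sum>x\<in>rises \<nu>. zeros_upto \<nu> x + ones_above \<nu> x)"
proof -
  let ?g = "\<lambda>x. zeros_upto \<nu> x + ones_above \<nu> x"
  let ?H = "\<lambda>x. of_bool (\<nu> x) * ?g x - ones_above \<nu> x"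
  have "(of_bool (\<nu> x) - of_bool (\<nu> (x + 1))) * ?g x = ?H x - ?H (x + 1)" for x
    using zeros_upto_add_1[OF assms, of x] ones_above_add_1[OF assms, of x] by (auto simp: algebra_simps)
  then have "sum ?g (falls \<nu>) - sum ?g (rises \<nu>) = ?H a - ?H b"
    using sum_falls_minus_sum_rises[OF assms, of ?g] sum_telescope_int[of a b ?H] window_less[OF assms] by simp
  also have "?H a - ?H b = 0"
    using assms zeros_upto_eq_0[OF assms, of a] ones_above_eq_0[OF assms, of b] by (simp add: window_def)
  finally show ?thesis by simp
qed

text \<open>The two flips at a boundary are listed together because their first-order terms cancel.
  At a fall the sum of the two changes is 0 for the inversions and g = zeros + ones for the spread;
  at a rise, below, it is -2 and -g.\<close>

lemma flip_fall:
  assumes w: "window \<nu> a b" and x: "a < x" "x + 1 < b" "x \<in> falls \<nu>"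
  shows "inversions (flip x \<nu>) = inversions \<nu> + (ones_above \<nu> x - zeros_upto \<nu> x)"
    and "inversions (flip (x + 1) \<nu>) = inversions \<nu> - (ones_above \<nu> x - zeros_upto \<nu> x)"
    and "spread (flip x \<nu>) = spread \<nu> + (right_area \<nu> x - left_area \<nu> x)"
    and "spread (flip (x + 1) \<nu>)
        = spread \<nu> - (right_area \<nu> x - left_area \<nu> x) + (zeros_upto \<nu> x + ones_above \<nu> x)"
proof -
  have \<nu>: "\<nu> x" "\<not> \<nu> (x + 1)"
    using x by (auto simp: falls_def)
  show "inversions (flip x \<nu>) = inversions \<nu> + (ones_above \<nu> x - zeros_upto \<nu> x)"
    using inversions_flip_one[OF w x(1) _ \<nu>(1)] x by simp
  show "inversions (flip (x + 1) \<nu>) = inversions \<nu> - (ones_above \<nu> x - zeros_upto \<nu> x)"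
    using inversions_flip_zero[OF w _ x(2) \<nu>(2)] x zeros_upto_add_1[OF w, of x] ones_above_add_1[OF w, of x] \<nu> by simp
  show "spread (flip x \<nu>) = spread \<nu> + (right_area \<nu> x - left_area \<nu> x)"
    using spread_flip_one[OF w x(1) _ \<nu>(1)] x by simp
  show "spread (flip (x + 1) \<nu>)
      = spread \<nu> - (right_area \<nu> x - left_area \<nu> x) + (zeros_upto \<nu> x + ones_above \<nu> x)"
    using spread_flip_zero[OF w _ x(2) \<nu>(2)] x right_area_add_1[OF w, of x] left_area_add_1[OF w, of x] by simp
qed

lemma flip_rise:
  assumes w: "window \<nu> a b" and x: "a < x" "x + 1 < b" "x \<in> rises \<nu>"
  shows "inversions (flip x \<nu>) = inversions \<nu> - 1 + (zeros_upto \<nu> x - ones_above \<nu> x)"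
    and "inversions (flip (x + 1) \<nu>) = inversions \<nu> - 1 - (zeros_upto \<nu> x - ones_above \<nu> x)"
    and "spread (flip x \<nu>) = spread \<nu> - (right_area \<nu> x - left_area \<nu> x)"
    and "spread (flip (x + 1) \<nu>)
        = spread \<nu> + (right_area \<nu> x - left_area \<nu> x) - (zeros_upto \<nu> x + ones_above \<nu> x)"
proof -
  have \<nu>: "\<not> \<nu> x" "\<nu> (x + 1)"
    using x by (auto simp: rises_def)
  show "inversions (flip x \<nu>) = inversions \<nu> - 1 + (zeros_upto \<nu> x - ones_above \<nu> x)"
    using inversions_flip_zero[OF w x(1) _ \<nu>(1)] x by simp
  show "inversions (flip (x + 1) \<nu>) = inversions \<nu> - 1 - (zeros_upto \<nu> x - ones_above \<nu> x)"
    using inversions_flip_one[OF w _ x(2) \<nu>(2)] x zeros_upto_add_1[OF w, of x] ones_above_add_1[OF w, of x] \<nu> by simp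
  show "spread (flip x \<nu>) = spread \<nu> - (right_area \<nu> x - left_area \<nu> x)"
    using spread_flip_zero[OF w x(1) _ \<nu>(1)] x by simp
  show "spread (flip (x + 1) \<nu>)
      = spread \<nu> + (right_area \<nu> x - left_area \<nu> x) - (zeros_upto \<nu> x + ones_above \<nu> x)"
    using spread_flip_one[OF w _ x(2) \<nu>(2)] x right_area_add_1[OF w, of x] left_area_add_1[OF w, of x] by simp
qed

text \<open>The quantity in the drift of the spread. It equals the corresponding sum over the rises,
  and its terms at the two extreme falls alone contribute the length of the hybrid zone.\<close>

definition fall_area :: "config \<Rightarrow> real" where
  "fall_area \<nu> = (\<Sum>x\<in>falls \<nu>. zeros_upto \<nu> x + ones_above \<nu> x)"

lemma generator_inversions:
  assumes w: "\<nu> \<in> configs"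
  shows "exclusion_voter_generator \<beta> p inversions \<nu>
    = (1 - \<beta>) * (1 - p) * (card (rises \<nu>) + 1) - ((1 - \<beta>) * p + \<beta>) * card (rises \<nu>)"
proof -
  obtain a b where w0: "window \<nu> a b"
    using assms by (auto simp: configs_eq_window)
  \<comment> \<open>One more site on each side puts every boundary strictly inside the window, as
    the flip and swap lemmas require.\<close>
  then have w: "window \<nu> (a - 1) (b + 1)"
    by (rule window_mono) auto
  have F: "a - 1 < x" "x + 1 < b + 1" if "x \<in> falls \<nu>" for x
    using falls_window[OF w0] that by auto
  have R: "a - 1 < x" "x + 1 < b + 1" if "x \<in> rises \<nu>" for x
    using rises_window[OF w0] that by auto
  have "exclusion_voter_generator \<beta> p inversions \<nu>
      = (\<Sum>x\<in>falls \<nu>. (1 - \<beta>) * (1 - p)) + (\<Sum>x\<in>rises \<nu>. - ((1 - \<beta>) * p + \<beta>))"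
    unfolding generator_eq[OF w] using F R
    by (intro arg_cong2[where f = "(+)", OF sum.cong[OF refl] sum.cong[OF refl]])
      (simp_all add: flip_fall[OF w] flip_rise[OF w] swap_fall[OF w] swap_rise[OF w] field_simps)
  then show ?thesis
    using card_falls[OF w] by (simp add: algebra_simps)
qed

text \<open>The flips contribute + g \<beta> / 2 at falls and - g \<beta> / 2 at rises, which cancel
  in total; only swaps remain, at rate 1 - p with change g + 1 and at rate p with change - (g -
  1).\<close>

lemma generator_spread:
  assumes w: "\<nu> \<in> configs"
  shows "exclusion_voter_generator \<beta> p spread \<nu>
    = (1 - \<beta>) * ((1 - 2 * p) * fall_area \<nu> + card (rises \<nu>) + (1 - p))"
proof -
  obtain a b where w0: "window \<nu> a b"
    using assms by (auto simp: configs_eq_window)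
  then have w: "window \<nu> (a - 1) (b + 1)"
    by (rule window_mono) auto
  have F: "a - 1 < x" "x + 1 < b + 1" if "x \<in> falls \<nu>" for x
    using falls_window[OF w0] that by auto
  have R: "a - 1 < x" "x + 1 < b + 1" if "x \<in> rises \<nu>" for x
    using rises_window[OF w0] that by auto
  let ?g = "\<lambda>x. zeros_upto \<nu> x + ones_above \<nu> x"
  have "exclusion_voter_generator \<beta> p spread \<nu>
    = (\<Sum>x\<in>falls \<nu>. ((1 - \<beta>) * (1 - p) + \<beta> / 2) * ?g x + (1 - \<beta>) * (1 - p))
    + (\<Sum>x\<in>rises \<nu>. - ((1 - \<beta>) * p + \<beta> / 2) * ?g x + (1 - \<beta>) * p)"
    unfolding generator_eq[OF w] using F R
    by (intro arg_cong2[where f = "(+)", OF sum.cong[OF refl] sum.cong[OF refl]])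
      (simp_all add: flip_fall[OF w] flip_rise[OF w] swap_fall[OF w] swap_rise[OF w] field_simps)
  moreover have "(\<Sum>x\<in>A. c * ?g x + d) = c * sum ?g A + card A * d" for A and c d :: real
    by (subst sum.distrib, subst sum_distrib_left[symmetric]) simp
  ultimately have "exclusion_voter_generator \<beta> p spread \<nu>
      = ((1 - \<beta>) * (1 - p) + \<beta> / 2) * sum ?g (falls \<nu>) + (1 - \<beta>) * (1 - p) * (card (rises \<nu>) + 1)
     - ((1 - \<beta>) * p + \<beta> / 2) * sum ?g (rises \<nu>) + (1 - \<beta>) * p * card (rises \<nu>)"
    by (simp only: card_falls[OF w]) (simp add: algebra_simps)
  then show ?thesis
    unfolding fall_area_def sum_falls_eq_sum_rises[OF w, symmetric] by (simp add: algebra_simps)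
qed

subsection \<open>The hybrid zone of a configuration\<close>

text \<open>The distances from x to the k ones beyond it are distinct positive integers, so their
  sum is at least 1 + ... + k.\<close>

lemma triangle_le_right_area:
  assumes w: "window \<nu> a b"
  shows "ones_above \<nu> x * (ones_above \<nu> x + 1) / 2 \<le> right_area \<nu> x"
proof (cases "x \<le> b")
  case True
  then show ?thesis
  proof (induction x rule: int_le_induct)
    case base
    have "ones_above \<nu> b = 0"
      by (rule ones_above_eq_0[OF w]) simp
    then show ?case
      by (simp add: right_area_window[OF w])
  next
    case (step x)
    have "ones_above \<nu> (x - 1) * (ones_above \<nu> (x - 1) + 1) / 2
        \<le> ones_above \<nu> (x - 1) + ones_above \<nu> x * (ones_above \<nu> x + 1) / 2"
      using ones_above_add_1[OF w, of "x
          - 1"] ones_above_nonneg[of \<nu> x] by (cases "\<nu> x") (auto simp: field_simps)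
    then show ?case
      using step right_area_add_1[OF w, of "x - 1"] by simp
  qed
next
  case False
  then have "ones_above \<nu> x = 0"
    by (intro ones_above_eq_0[OF w]) simp
  then show ?thesis
    using False by (simp add: right_area_window[OF w])
qed

lemma triangle_le_left_area:
  assumes w: "window \<nu> a b"
  shows "zeros_upto \<nu> x * (zeros_upto \<nu> x + 1) / 2 \<le> left_area \<nu> (x + 1)"
proof (cases "a \<le> x")
  case True
  then show ?thesis
  proof (induction x rule: int_ge_induct)
    case base
    have "zeros_upto \<nu> a = 0"
      by (rule zeros_upto_eq_0[OF w]) simp
    then show ?case
      by (simp add: left_area_window[OF w] zeros_upto_nonneg sum_nonneg)
  next
    case (step x)
    have "zeros_upto \<nu> (x + 1) * (zeros_upto \<nu> (x + 1) + 1) / 2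
        \<le> zeros_upto \<nu> (x + 1) + zeros_upto \<nu> x * (zeros_upto \<nu> x + 1) / 2"
      using zeros_upto_add_1[OF w, of x] zeros_upto_nonneg[of \<nu> x] by (cases "\<nu> (x
          + 1)") (auto simp: field_simps)
    then show ?case
      using step left_area_add_1[OF w, of "x + 1"] by simp
  qed
next
  case False
  then have "zeros_upto \<nu> x = 0"
    by (intro zeros_upto_eq_0[OF w]) simp
  then show ?thesis
    by (simp add: left_area_window[OF w] zeros_upto_nonneg sum_nonneg)
qed

lemma zeros_minus_ones:
  assumes w: "window \<nu> a b" and "x \<le> y"
  shows "zeros_upto \<nu> y - ones_above \<nu> y = zeros_upto \<nu> x - ones_above \<nu> x + of_int (y - x)"
  using assms(2)
proof (induction y rule: int_ge_induct)
  case (step y)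
  then show ?case
    using zeros_upto_add_1[OF w, of y] ones_above_add_1[OF w, of y] by auto
qed simp

lemma inversions_nonneg: "0 \<le> inversions \<nu>" and spread_nonneg: "0 \<le> spread \<nu>"
  by (auto simp: inversions_def spread_def zeros_upto_nonneg ones_above_nonneg intro!: sum_nonneg)

lemma rises_le_inversions:
  assumes w: "window \<nu> a b"
  shows "card (rises \<nu>) \<le> inversions \<nu>"
proof -
  have "real (card (rises \<nu>)) = (\<Sum>x\<in>(\<lambda>x. x + 1) ` rises \<nu>. 1)"
    by (subst sum.reindex) auto
  also have "\<dots> \<le> (\<Sum>x\<in>(\<lambda>x. x + 1) ` rises \<nu>. of_bool (\<nu> x) * zeros_upto \<nu> x)"
  proof (rule sum_mono)
    fix y assume "y \<in> (\<lambda>x. x + 1) ` rises \<nu>"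
    then obtain x where x: "y = x + 1" "\<not> \<nu> x" "\<nu> (x + 1)"
      by (auto simp: rises_def)
    then show "1 \<le> of_bool (\<nu> y) * zeros_upto \<nu> y"
      using zeros_upto_add_1[OF w, of x] zeros_upto_add_1[OF w, of "x
          - 1"] zeros_upto_nonneg[of \<nu> "x - 1"] by simp
  qed
  also have "\<dots> \<le> (\<Sum>x\<in>{a..b}. of_bool (\<nu> x) * zeros_upto \<nu> x)"
    using rises_window[OF w] by (intro sum_mono2) (auto simp: zeros_upto_nonneg)
  also have "\<dots> = inversions \<nu>"
    by (rule inversions_window[OF w, symmetric])
  finally show ?thesis .
qed

text \<open>The zone consists of the sites l + 1, ..., r; it begins with the leftmost zero and ends
  with the rightmost one, and l and r are the extreme falls. Below, \<open>m\<close> and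
  \<open>n\<close> count its ones and zeros.\<close>

locale hybrid_zone =
  fixes \<nu> :: config and l r :: int
  assumes left: "\<And>x. x \<le> l \<Longrightarrow> \<nu> x" and l: "\<not> \<nu> (l + 1)"
    and r: "\<nu> r" and right: "\<And>x. r < x \<Longrightarrow> \<not> \<nu> x"
    and l_less_r: "l < r"
begin

abbreviation m where "m \<equiv> ones_above \<nu> l"
abbreviation n where "n \<equiv> zeros_upto \<nu> r"

lemma zone_window: "window \<nu> l (r + 1)"
  using left right by (auto simp: window_def)

lemma wide_window: "window \<nu> (l - 1) (r + 2)"
  by (rule window_mono[OF zone_window]) auto

lemma boundary_bounds:
  assumes "x \<in> falls \<nu> \<union> rises \<nu>"
  shows "l \<le> x" "x \<le> r"
proof -
  show "l \<le> x"
    using assms left[of x] left[of "x + 1"] by (force simp: falls_def rises_def)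
  show "x \<le> r"
    using assms right[of x] right[of "x + 1"] by (force simp: falls_def rises_def)
qed

lemma boundary_inside:
  assumes "x \<in> falls \<nu> \<union> rises \<nu>"
  shows "l - 1 < x" "x + 1 < r + 2"
  using boundary_bounds[OF assms] by auto

lemma extreme_falls: "l \<in> falls \<nu>" "r \<in> falls \<nu>"
  using left[of l] l r right[of "r + 1"] by (auto simp: falls_def)

lemma zeros_l: "zeros_upto \<nu> l = 0"
  by (rule zeros_upto_eq_0[OF zone_window]) simp

lemma ones_r: "ones_above \<nu> r = 0"
  by (rule ones_above_eq_0[OF zone_window]) simp

lemma zeros_pos: "l < x \<Longrightarrow> 1 \<le> zeros_upto \<nu> x"
  using zeros_upto_add_1[OF zone_window, of l] zeros_upto_mono[OF zone_window, of "l
      + 1" x] l zeros_l by simp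

lemma ones_pos: "x < r \<Longrightarrow> 1 \<le> ones_above \<nu> x"
  using ones_above_add_1[OF zone_window, of "r - 1"] ones_above_antimono[OF zone_window, of x "r
      - 1"] r ones_r by simp

lemma m_pos: "1 \<le> m" and n_pos: "1 \<le> n"
  using ones_pos zeros_pos l_less_r by auto

lemma zeros_le: "x \<le> r \<Longrightarrow> zeros_upto \<nu> x \<le> n"
  by (rule zeros_upto_mono[OF zone_window])

lemma ones_le: "l \<le> x \<Longrightarrow> ones_above \<nu> x \<le> m"
  by (rule ones_above_antimono[OF zone_window])

lemma length: "of_int (r - l) = m + n"
  using zeros_minus_ones[OF zone_window, of l r] l_less_r zeros_l ones_r by simp

lemma boundary_height: "x \<in> falls \<nu> \<union> rises \<nu> \<Longrightarrow> zeros_upto \<nu> x + ones_above \<nu> x \<le> m + n"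
  using boundary_bounds[of x] zeros_le[of x] ones_le[of x] by simp

lemma rises_pos: "1 \<le> card (rises \<nu>)"
proof -
  have "card {l, r} \<le> card (falls \<nu>)"
    using extreme_falls by (intro card_mono finite_falls[OF zone_window]) auto
  then show ?thesis
    using l_less_r card_falls[OF zone_window] by simp
qed

lemma inversions_le: "inversions \<nu> \<le> m * n"
proof -
  have "{l..r + 1} \<inter> {x. l < x \<and> \<nu> x} = {x. l < x \<and> \<nu> x}"
    using right by force
  then have ones: "(\<Sum>x\<in>{l..r + 1}. of_bool (l < x \<and> \<nu> x)) = m"
    by (simp add: ones_above_def of_bool_def sum.If_cases)
  have "inversions \<nu> \<le> (\<Sum>x\<in>{l..r + 1}. of_bool (l < x \<and> \<nu> x) * n)"
    unfolding inversions_window[OF zone_window]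
  proof (rule sum_mono)
    fix x assume x: "x \<in> {l..r + 1}"
    consider "x = l" | "\<not> \<nu> x" | "l < x" "\<nu> x" "x \<le> r"
      using x right[of x] by force
    then show "of_bool (\<nu> x) * zeros_upto \<nu> x \<le> of_bool (l < x \<and> \<nu> x) * n"
      by cases (auto simp: zeros_l intro: zeros_le)
  qed
  then show ?thesis
    unfolding sum_distrib_right[symmetric] ones .
qed

lemma inversions_pos: "1 \<le> inversions \<nu>"
  using rises_le_inversions[OF zone_window] rises_pos by simp

lemma zone_le_inversions: "m \<le> inversions \<nu>" "n \<le> inversions \<nu>"
proof -
  have "{l..r + 1} \<inter> {x. l < x \<and> \<nu> x} = {x. l < x \<and> \<nu> x}"
    using right by force
  then have "m = (\<Sum>x\<in>{l..r + 1}. of_bool (l < x \<and> \<nu> x))"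
    by (simp add: ones_above_def of_bool_def sum.If_cases)
  also have "\<dots> \<le> inversions \<nu>"
    unfolding inversions_window[OF zone_window]
    using zeros_pos by (intro sum_mono) (auto simp: zeros_upto_nonneg)
  finally show "m \<le> inversions \<nu>" .
  have "n = (\<Sum>x\<in>{r}. of_bool (\<nu> x) * zeros_upto \<nu> x)"
    using r by simp
  also have "\<dots> \<le> inversions \<nu>"
    unfolding inversions_window[OF zone_window]
    using l_less_r by (intro sum_mono2) (auto simp: zeros_upto_nonneg)
  finally show "n \<le> inversions \<nu>" .
qed

lemma spread_le: "spread \<nu> \<le> m * n * (m + n)"
proof -
  have "spread \<nu> = (\<Sum>x\<in>{l<..<r}. zeros_upto \<nu> x * ones_above \<nu> x)"
    unfolding spread_window[OF zone_window]
  proof (intro sum.mono_neutral_right ballI)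
    fix x assume "x \<in> {l..r + 1} - {l<..<r}"
    then have "x = l \<or> x = r \<or> r + 1 \<le> x + 1" by auto
    then show "zeros_upto \<nu> x * ones_above \<nu> x = 0"
      using zeros_l ones_r ones_above_eq_0[OF zone_window, of x] by auto
  qed auto
  also have "\<dots> \<le> (\<Sum>x\<in>{l<..<r}. n * m)"
    by (intro sum_mono mult_mono zeros_le ones_le zeros_upto_nonneg ones_above_nonneg) auto
  also have "\<dots> = real (card {l<..<r}) * (n * m)"
    by simp
  also have "\<dots> \<le> (m + n) * (n * m)"
    using l_less_r length m_pos n_pos by (intro mult_right_mono) auto
  finally show ?thesis
    by (simp add: mult_ac)
qed

text \<open>This area is the total length of the inversions of the leftmost zero. It is part of the
  spread, and since no other zero is farther from the ones, n copies of it dominate the spread. The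
  mirror image for the rightmost one follows.\<close>

lemma right_area_bounds:
  "m * (m + 1) / 2 \<le> right_area \<nu> (l + 1)" "right_area \<nu> (l + 1) \<le> spread \<nu>"
  "spread \<nu> \<le> n * right_area \<nu> (l + 1)"
proof -
  have "ones_above \<nu> (l + 1) = m"
    using ones_above_add_1[OF zone_window, of l] l by simp
  then show "m * (m + 1) / 2 \<le> right_area \<nu> (l + 1)"
    using triangle_le_right_area[OF zone_window, of "l + 1"] by simp
  have "{l..r + 1} = insert l {l + 1..r + 1}"
    using l_less_r by auto
  then have spread: "spread \<nu> = (\<Sum>x\<in>{l + 1..r + 1}. zeros_upto \<nu> x * ones_above \<nu> x)"
    unfolding spread_window[OF zone_window] by (simp add: zeros_l)
  show "right_area \<nu> (l + 1) \<le> spread \<nu>"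
    unfolding spread right_area_window[OF zone_window]
  proof (rule sum_mono)
    fix x assume "x \<in> {l + 1..r + 1}"
    then show "ones_above \<nu> x \<le> zeros_upto \<nu> x * ones_above \<nu> x"
      using mult_right_mono[OF zeros_pos[of x] ones_above_nonneg[of \<nu> x]] by simp
  qed
  show "spread \<nu> \<le> n * right_area \<nu> (l + 1)"
    unfolding spread right_area_window[OF zone_window] sum_distrib_left
  proof (rule sum_mono)
    fix x assume x: "x \<in> {l + 1..r + 1}"
    show "zeros_upto \<nu> x * ones_above \<nu> x \<le> n * ones_above \<nu> x"
    proof (cases "x \<le> r")
      case True
      then show ?thesis
        by (intro mult_right_mono zeros_le ones_above_nonneg)
    next
      case False
      then show ?thesis
        using ones_above_eq_0[OF zone_window, of x] by simp
    qed
  qed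
qed

lemma left_area_bounds:
  "n * (n + 1) / 2 \<le> left_area \<nu> r" "left_area \<nu> r \<le> spread \<nu>"
  "spread \<nu> \<le> m * left_area \<nu> r"
proof -
  have "zeros_upto \<nu> (r - 1) = n"
    using zeros_upto_add_1[OF zone_window, of "r - 1"] r by simp
  then show "n * (n + 1) / 2 \<le> left_area \<nu> r"
    using triangle_le_left_area[OF zone_window, of "r - 1"] by simp
  have "spread \<nu> = (\<Sum>x\<in>{l..<r}. zeros_upto \<nu> x * ones_above \<nu> x)"
    unfolding spread_window[OF zone_window]
    using ones_above_eq_0[OF zone_window] by (intro sum.mono_neutral_right) auto
  note spread = this
  show "left_area \<nu> r \<le> spread \<nu>"
    unfolding spread left_area_window[OF zone_window]
  proof (rule sum_mono)
    fix x assume "x \<in> {l..<r}"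
    then show "zeros_upto \<nu> x \<le> zeros_upto \<nu> x * ones_above \<nu> x"
      using mult_left_mono[OF ones_pos[of x] zeros_upto_nonneg[of \<nu> x]] by simp
  qed
  show "spread \<nu> \<le> m * left_area \<nu> r"
    unfolding spread left_area_window[OF zone_window] sum_distrib_left
  proof (rule sum_mono)
    fix x assume "x \<in> {l..<r}"
    then show "zeros_upto \<nu> x * ones_above \<nu> x \<le> m * zeros_upto \<nu> x"
      by (subst mult.commute) (intro mult_right_mono ones_le zeros_upto_nonneg, auto)
  qed
qed

lemma fall_area_ge: "m + n \<le> fall_area \<nu>"
proof -
  have "m + n = (\<Sum>x\<in>{l, r}. zeros_upto \<nu> x + ones_above \<nu> x)"
    using l_less_r zeros_l ones_r by simp
  also have "\<dots> \<le> fall_area \<nu>"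
    unfolding fall_area_def using extreme_falls
    by (intro sum_mono2 finite_falls[OF zone_window]) (auto simp: zeros_upto_nonneg ones_above_nonneg)
  finally show ?thesis .
qed

lemma left_area_l: "left_area \<nu> (l + 1) = 0"
  using left_area_add_1[OF zone_window, of l] zeros_l by (simp add: left_area_window[OF zone_window])

lemma right_area_r: "right_area \<nu> r = 0"
  using right_area_add_1[OF zone_window, of r] ones_r ones_above_eq_0[OF zone_window, of "r + 1"]
  by (simp add: right_area_window[OF zone_window])

lemma fall_area_ge_2: "2 \<le> fall_area \<nu>"
  using fall_area_ge m_pos n_pos by simp

lemma zone_energy_le:
  assumes "0 \<le> \<alpha>"
  shows "energy \<alpha> \<nu> \<le> (1 + \<alpha>) * (m + n) ^ 3"
proof -
  have mn: "m * n \<le> (m + n)\<^sup>2"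
    unfolding power2_eq_square using m_pos n_pos by (intro mult_mono) auto
  have "spread \<nu> \<le> (m + n)\<^sup>2 * (m + n)"
    using m_pos n_pos by (intro order_trans[OF spread_le] mult_right_mono mn) auto
  moreover have "inversions \<nu> \<le> (m + n)\<^sup>2 * 1"
    using inversions_le mn by simp
  moreover have "(m + n)\<^sup>2 * 1 \<le> (m + n)\<^sup>2 * (m + n)"
    using m_pos n_pos by (intro mult_left_mono) auto
  ultimately have "spread \<nu> \<le> (m + n) ^ 3" "inversions \<nu> \<le> (m + n) ^ 3"
    by (auto simp: power3_eq_cube power2_eq_square mult_ac)
  then have "energy \<alpha> \<nu> \<le> (m + n) ^ 3 + \<alpha> * (m + n) ^ 3"
    using assms by (intro add_mono mult_left_mono)
  then show ?thesis
    by (simp add: algebra_simps)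
qed

text \<open>From f \<le> m n \<le> (m + n)^2, many inversions force a long zone. This translates a
  lower bound on \<open>fall_area\<close> into one on \<open>inversions\<close>, the quantity by
  which \<open>barrier_absorbs\<close> separates its cases.\<close>

lemma inversions_ge_imp_fall_area_ge:
  assumes "G\<^sup>2 \<le> inversions \<nu>" "0 \<le> G"
  shows "G \<le> fall_area \<nu>"
proof -
  have "m * n \<le> (m + n) * (m + n)"
    using m_pos n_pos by (intro mult_mono) auto
  then have "G\<^sup>2 \<le> (m + n)\<^sup>2"
    using assms(1) inversions_le unfolding power2_eq_square[of "m + n"] by linarith
  then have "G \<le> m + n"
    by (rule power2_le_imp_le) (use m_pos n_pos in linarith)
  then show ?thesis
    using fall_area_ge by linarith
qed

end

lemma configs_hybrid_zone:
  assumes "\<nu> \<in> configs" "config_class \<nu> \<noteq> ground_state"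
  obtains l r where "hybrid_zone \<nu> l r"
proof -
  obtain a b where w: "window \<nu> a b"
    using assms(1) by (auto simp: configs_eq_window)
  have ab: "a < b"
    by (rule window_less[OF w])
  define l where "l = Min {x\<in>{a..b}. \<not> \<nu> x} - 1"
  define r where "r = Max {x\<in>{a..b}. \<nu> x}"
  have fin: "finite {x\<in>{a..b}. P x}" for P
    by (rule finite_subset[of _ "{a..b}"]) auto
  have "b \<in> {x\<in>{a..b}. \<not> \<nu> x}"
    using window_D(2)[OF w, of b] ab by simp
  then have min: "Min {x\<in>{a..b}. \<not> \<nu> x} \<in> {x\<in>{a..b}. \<not> \<nu> x}"
    by (intro Min_in fin) blast
  then have l: "\<not> \<nu> (l + 1)"
    by (simp add: l_def)
  have left: "\<nu> x" if "x \<le> l" for x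
  proof (rule ccontr)
    assume x: "\<not> \<nu> x"
    then have "a < x"
      using window_D(1)[OF w, of x] by linarith
    then have "Min {x\<in>{a..b}. \<not> \<nu> x} \<le> x"
      using x that min by (intro Min_le fin) (auto simp: l_def)
    then show False
      using that by (simp add: l_def)
  qed
  have "a \<in> {x\<in>{a..b}. \<nu> x}"
    using window_D(1)[OF w, of a] ab by simp
  then have max: "Max {x\<in>{a..b}. \<nu> x} \<in> {x\<in>{a..b}. \<nu> x}"
    by (intro Max_in fin) blast
  then have r: "\<nu> r"
    by (simp add: r_def)
  have right: "\<not> \<nu> x" if "r < x" for x
  proof
    assume x: "\<nu> x"
    then have "x < b"
      using window_D(2)[OF w, of x] by linarith
    then have "x \<le> Max {x\<in>{a..b}. \<nu> x}"
      using x that max by (intro Max_ge fin) (auto simp: r_def)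
    then show False
      using that by (simp add: r_def)
  qed
  have "l \<le> r"
    using left[of l] right[of l] by force
  moreover have "l \<noteq> r"
  proof
    assume "l = r"
    then have \<nu>: "\<nu> x = (x \<le> l)" for x
      using left[of x] right[of x] by force
    have "window (\<lambda>x. x \<le> 0) 0 1"
      by (auto simp: window_def)
    then have "(\<nu>, \<lambda>x. x \<le> 0) \<in> translate_rel"
      using assms(1) \<nu> unfolding translate_rel_def by (auto intro: window_in_configs exI[of _ l])
    then have "config_class \<nu> = ground_state"
      unfolding config_class_def ground_state_def by (rule equiv_class_eq[OF equiv_translate_rel])
    then show False
      using assms(2) by simp
  qed
  ultimately have "hybrid_zone \<nu> l r"
    using left l r right by unfold_locales auto
  then show thesis
    by (rule that)
qed

section \<open>Closure, countability and translation invariance of the configurations\<close>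

lemma swap_in_configs: "\<nu> \<in> configs \<Longrightarrow> x \<in> falls \<nu> \<union> rises \<nu> \<Longrightarrow> swap x \<nu> \<in> configs"
  and flip_in_configs: "\<nu> \<in> configs \<Longrightarrow> flip x \<nu> \<in> configs"
proof -
  have flip: "flip x \<nu> \<in> configs" if "\<nu> \<in> configs" for x \<nu>
  proof -
    obtain a b where w: "window \<nu> a b"
      using \<open>\<nu> \<in> configs\<close> by (auto simp: configs_eq_window)
    have "window \<nu> (min a (x - 1)) (max b (x + 1))"
      by (rule window_mono[OF w]) auto
    then show ?thesis
      by (rule window_in_configs[OF window_flip]) auto
  qed
  then show "\<nu> \<in> configs \<Longrightarrow> flip x \<nu> \<in> configs" .
  show "\<nu> \<in> configs \<Longrightarrow> x \<in> falls \<nu> \<union> rises \<nu> \<Longrightarrow> swap x \<nu> \<in> configs"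
    using flip by (subst swap_eq_flip) (auto simp: falls_def rises_def)
qed

lemma countable_configs: "countable configs"
proof -
  have "configs \<subseteq> (\<lambda>(A, B) x. x \<notin> A \<and> (x \<le> 0 \<or> x \<in> B)) ` ({A. finite A} \<times> {B. finite B})"
  proof
    fix \<nu> assume \<nu>: "\<nu> \<in> configs"
    have "{x. x \<le> 0 \<and> \<not> \<nu> x} \<subseteq> insert 0 {x. x < 0 \<and> \<not> \<nu> x}"
      by auto
    then have "finite {x. x \<le> 0 \<and> \<not> \<nu> x}"
      using \<nu> by (rule_tac finite_subset) (auto simp: configs_def)
    then have fin: "finite {x. x \<le> 0 \<and> \<not> \<nu> x}" "finite {x. x > 0 \<and> \<nu> x}"
      using \<nu> by (auto simp: configs_def)
    show "\<nu> \<in> (\<lambda>(A, B) x. x \<notin> A \<and> (x \<le> 0 \<or> x \<in> B)) ` ({A. finite A} \<times> {B. finite B})"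
    proof (rule image_eqI[of _ _ "({x. x \<le> 0 \<and> \<not> \<nu> x}, {x. x > 0 \<and> \<nu> x})"])
      show "\<nu> = (case ({x. x \<le> 0 \<and> \<not> \<nu> x}, {x. x > 0 \<and> \<nu> x}) of (A, B) \<Rightarrow> \<lambda>x. x \<notin> A \<and> (x \<le> 0 \<or> x \<in> B))"
        by (rule ext) auto
    qed (use fin in simp)
  qed
  moreover have "countable ({A :: int set. finite A} \<times> {B :: int set. finite B})"
    using countable_Collect_finite by (intro countable_SIGMA) auto
  ultimately show ?thesis
    by (meson countable_image countable_subset)
qed

lemma translate_invariant:
  assumes "(\<nu>, \<mu>) \<in> translate_rel"
  shows "inversions \<mu> = inversions \<nu>" and "spread \<mu> = spread \<nu>"
proof -
  obtain k where k: "\<mu> x = \<nu> (x + k)" for x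
    using assms by (auto simp: translate_rel_def)
  have zeros: "zeros_upto \<mu> x = zeros_upto \<nu> (x + k)" for x
  proof -
    have "bij_betw (\<lambda>z. z + k) {z. z \<le> x \<and> \<not> \<mu> z} {z. z \<le> x + k \<and> \<not> \<nu> z}"
      by (rule bij_betw_byWitness[of _ "\<lambda>z. z - k"]) (auto simp: k)
    then show ?thesis
      unfolding zeros_upto_def by (simp add: bij_betw_same_card)
  qed
  have ones: "ones_above \<mu> x = ones_above \<nu> (x + k)" for x
  proof -
    have "bij_betw (\<lambda>z. z + k) {z. x < z \<and> \<mu> z} {z. x + k < z \<and> \<nu> z}"
      by (rule bij_betw_byWitness[of _ "\<lambda>z. z - k"]) (auto simp: k)
    then show ?thesis
      unfolding ones_above_def by (simp add: bij_betw_same_card)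
  qed
  show "inversions \<mu> = inversions \<nu>"
    unfolding inversions_def
    by (rule sum.reindex_bij_witness[of _ "\<lambda>z. z - k" "\<lambda>z. z + k"]) (auto simp: k zeros)
  show "spread \<mu> = spread \<nu>"
    unfolding spread_def
    by (rule sum.reindex_bij_witness[of _ "\<lambda>z. z - k" "\<lambda>z. z + k"]) (auto simp: zeros ones)
qed

section \<open>Lyapunov functions\<close>

lemma one_plus_powr_le:
  fixes t a :: real
  assumes "0 \<le> t" "0 < a" "a < 1"
  shows "t powr a \<le> 1 + a * (t - 1)"
proof (cases "t = 0")
  case False
  define s where "s = 1 + a * (t - 1)"
  have t: "0 < t"
    using assms False by simp
  have "s = (1 - a) + a * t"
    by (simp add: s_def algebra_simps)
  then have s: "0 < s"
    using assms t by (simp add: add_pos_pos)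
  \<comment> \<open>Weighted concavity of the logarithm: \<open>s\<close> is the mean of 1 and t
    with weights 1 - a and a, and ln y \<le> y - 1 is used at t / s and 1 / s.\<close>
  have "a * ln (t / s) \<le> a * (t / s - 1)" "(1 - a) * ln (1 / s) \<le> (1 - a) * (1 / s - 1)"
    using assms t s by (intro mult_left_mono ln_le_minus_one; simp)+
  moreover have "a * (t / s - 1) + (1 - a) * (1 / s - 1) = (a * t + (1 - a)) / s - 1"
    by (simp add: diff_divide_distrib add_divide_distrib algebra_simps)
  ultimately have "a * ln (t / s) + (1 - a) * ln (1 / s) \<le> (a * t + (1 - a)) / s - 1"
    by linarith
  also have "\<dots> = 0"
    using s \<open>s = (1 - a) + a * t\<close> by simp
  finally have "a * ln t \<le> ln s"
    using t s by (simp add: ln_div algebra_simps)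
  then have "exp (a * ln t) \<le> exp (ln s)"
    by (simp only: exp_le_cancel_iff)
  then have "exp (a * ln t) \<le> s"
    using s by (simp only: exp_ln)
  then show ?thesis
    using t s by (simp add: powr_def s_def)
qed (use assms in auto)

lemma powr_tangent:
  fixes x y a :: real
  assumes "0 < x" "0 \<le> y" "0 < a" "a < 1"
  shows "y powr a - x powr a \<le> a * x powr (a - 1) * (y - x)"
proof -
  have "x powr a * (y / x) powr a \<le> x powr a * (1 + a * (y / x - 1))"
    using assms by (intro mult_left_mono one_plus_powr_le) auto
  also have "x powr a * (y / x) powr a = y powr a"
    using assms by (simp add: powr_divide)
  also have "x powr a * (1 + a * (y / x - 1)) = x powr a + a * x powr (a - 1) * (y - x)"
    using assms by (simp add: powr_diff field_simps)
  finally show ?thesis by simp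
qed

text \<open>The second-order Taylor polynomial at 0, with 2/25 = (4/5)(1/5)/2. The comparison of
  derivatives reduces to (1 - x) powr (-1/5) \<ge> 1 + x/5; the end point u = 1, where the
  derivative is singular, is checked directly.\<close>

lemma one_minus_powr_le:
  fixes u :: real
  assumes "0 \<le> u" "u \<le> 1"
  shows "(1 - u) powr (4/5) \<le> 1 - 4/5 * u - 2/25 * u\<^sup>2"
proof (cases "u = 1")
  case False
  define \<phi> where "\<phi> = (\<lambda>u::real. 1 - 4/5 * u - 2/25 * u\<^sup>2 - (1 - u) powr (4/5))"
  have "\<phi> 0 \<le> \<phi> u"
  proof (rule DERIV_nonneg_imp_nondecreasing[OF assms(1)])
    fix x assume x: "0 \<le> x" "x \<le> u"
    then have x1: "x < 1"
      using assms False by simp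
    have "1 + 1/5 * x \<le> exp (1/5 * x)"
      by (rule exp_ge_add_one_self)
    also have "\<dots> \<le> exp (- (1/5) * ln (1 - x))"
      using ln_le_minus_one[of "1 - x"] x1 by simp
    also have "\<dots> = (1 - x) powr (4/5 - 1)"
      using x1 by (simp add: powr_def)
    finally have "0 \<le> 4/5 * (1 - x) powr (4/5 - 1) - 4/5 - 4/25 * x"
      by simp
    moreover have "(\<phi> has_real_derivative 4/5 * (1 - x) powr (4/5 - 1) - 4/5 - 4/25 * x) (at x)"
      unfolding \<phi>_def using x1 by (auto intro!: derivative_eq_intros)
    ultimately show "\<exists>y. (\<phi> has_real_derivative y) (at x) \<and> 0 \<le> y"
      by blast
  qed
  then show ?thesis
    by (simp add: \<phi>_def)
qed simp

lemma powr_tangent_gain: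
  fixes x h :: real
  assumes "0 < x" "0 \<le> h" "h \<le> x"
  shows "(x - h) powr (4/5) - x powr (4/5)
      \<le> 4/5 * x powr (4/5 - 1) * ((x - h) - x) - 2/25 * (x powr (4/5) * (h / x)\<^sup>2)"
proof -
  have "x powr (4/5) * (1 - h / x) powr (4/5) \<le> x powr (4/5) * (1 - 4/5 * (h / x) - 2/25 * (h / x)\<^sup>2)"
    using assms by (intro mult_left_mono one_minus_powr_le) auto
  also have "x powr (4/5) * (1 - h / x) powr (4/5) = (x - h) powr (4/5)"
    using assms by (simp add: powr_mult[symmetric] right_diff_distrib)
  also have "x powr (4/5) * (1 - 4/5 * (h / x) - 2/25 * (h / x)\<^sup>2)
      = x powr (4/5) + 4/5 * x powr (4/5 - 1) * ((x - h) - x) - 2/25 * (x powr (4/5) * (h / x)\<^sup>2)"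
    using powr_diff[of x "4/5" 1] assms by (simp only: powr_one) (simp add: algebra_simps)
  finally show ?thesis by simp
qed

text \<open>In the induction step the quadratic coefficient becomes k + 3 ^ k, and the cubic term
  adds at most 3 ^ k; since k \<le> 3 ^ k, the sum is at most 3 ^ Suc k.\<close>

lemma one_plus_power_le:
  fixes u :: real
  assumes "-1 \<le> u" "u \<le> 1"
  shows "(1 + u) ^ k \<le> 1 + k * u + 3 ^ k * u\<^sup>2"
proof (induction k)
  case (Suc k)
  have "k \<le> (3::real) ^ k"
  proof (induction k)
    case (Suc k)
    have "1 \<le> (3::real) ^ k" by simp
    then show ?case
      unfolding power_Suc of_nat_Suc using Suc by linarith
  qed simp
  moreover have "u ^ 3 \<le> u\<^sup>2"
    using mult_right_mono[OF assms(2), of "u\<^sup>2"] by (simp add: power3_eq_cube power2_eq_square mult.assoc)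
  ultimately have "k * u\<^sup>2 + 3 ^ k * u ^ 3 \<le> 3 ^ k * u\<^sup>2 + 3 ^ k * u\<^sup>2"
    by (intro add_mono mult_right_mono mult_left_mono) auto
  moreover have "(1 + u) ^ Suc k \<le> (1 + u) * (1 + k * u + 3 ^ k * u\<^sup>2)"
    using Suc assms by (simp add: mult_left_mono)
  ultimately show ?case
    by (simp add: algebra_simps power2_eq_square power3_eq_cube)
qed simp

lemma power_Suc_increment:
  fixes x d :: real
  assumes x: "0 < x" and d: "\<bar>d\<bar> \<le> \<eta> * x" and \<eta>: "\<eta> \<le> 1"
  shows "(x + d) ^ Suc k - x ^ Suc k \<le> x ^ k * ((k + 1) * d + 3 ^ Suc k * \<eta> * \<bar>d\<bar>)"
proof -
  have "\<eta> * x \<le> 1 * x"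
    using x \<eta> by (intro mult_right_mono) auto
  with d have "\<bar>d\<bar> \<le> x"
    by linarith
  then have u: "-1 \<le> d / x" "d / x \<le> 1"
    using x by (auto simp: field_simps abs_le_iff)
  have "(x + d) ^ Suc k = x ^ Suc k * (1 + d / x) ^ Suc k"
    using x by (subst power_mult_distrib[symmetric]) (simp add: distrib_left)
  also have "\<dots> \<le> x ^ Suc k * (1 + real (Suc k) * (d / x) + 3 ^ Suc k * (d / x)\<^sup>2)"
    using x by (intro mult_left_mono one_plus_power_le u) auto
  also have "\<dots> = x ^ Suc k + x ^ k * ((k + 1) * d + 3 ^ Suc k * (\<bar>d\<bar> / x * \<bar>d\<bar>))"
    using x by (simp add: field_simps power2_eq_square)
  also have "\<dots> \<le> x ^ Suc k + x ^ k * ((k + 1) * d + 3 ^ Suc k * (\<eta> * \<bar>d\<bar>))"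
    using x d by (intro add_left_mono mult_left_mono mult_right_mono) (auto simp: divide_le_eq)
  finally show ?thesis
    by (simp only: mult.assoc of_nat_add of_nat_1)
qed

section \<open>The generator on general functions and its bounded correction\<close>

definition ground_configs :: "config set" where
  "ground_configs = {\<nu>\<in>configs. config_class \<nu> = ground_state}"

lemma ground_configs_hybrid_zone:
  assumes "\<nu> \<in> configs - ground_configs"
  obtains l r where "hybrid_zone \<nu> l r"
proof -
  have "\<nu> \<in> configs" "config_class \<nu> \<noteq> ground_state"
    using assms by (auto simp: ground_configs_def)
  then show thesis
    using that by (rule configs_hybrid_zone)
qed

locale exclusion_voter =
  fixes \<beta> p :: real
  assumes \<beta>: "0 \<le> \<beta>" "\<beta> \<le> 1" and p: "0 \<le> p" "p \<le> 1"
begin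

abbreviation L where "L \<equiv> exclusion_voter_generator \<beta> p"

text \<open>Each boundary carries total jump rate at most 1: the swap at most 1 - \<beta> and the
  two flips \<beta> / 2 each.\<close>

definition rate :: "config \<Rightarrow> real" where
  "rate \<nu> = card (falls \<nu>) + card (rises \<nu>)"

lemma rate_le:
  assumes "\<nu> \<in> configs"
  shows "rate \<nu> \<le> 2 * inversions \<nu> + 1"
proof -
  obtain a b where w: "window \<nu> a b"
    using assms by (auto simp: configs_eq_window)
  show ?thesis
    using rises_le_inversions[OF w] card_falls[OF w] by (simp add: rate_def)
qed

lemma generator_linear:
  assumes "\<nu> \<in> configs"
  shows "L (\<lambda>x. f x - c * g x) \<nu> = L f \<nu> - c * L g \<nu>"
proof -
  obtain a b where w: "window \<nu> a b"
    using assms by (auto simp: configs_eq_window)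
  have "L (\<lambda>x. f x - c * g x) \<nu> = (L f \<nu> - c * L g \<nu>)"
    unfolding generator_eq[OF w] distrib_left sum_distrib_left
    by (simp only: add_diff_add sum_subtractf[symmetric])
      (intro arg_cong2[where f = "(+)", OF sum.cong[OF refl] sum.cong[OF refl]]; simp add: algebra_simps)
  then show ?thesis .
qed

lemma generator_rate_bound:
  assumes \<nu>: "\<nu> \<in> configs" and f: "\<And>\<mu>. \<mu> \<in> configs \<Longrightarrow> f \<mu> \<le> m"
  shows "L f \<nu> \<le> rate \<nu> * (m - f \<nu>)"
proof -
  obtain a b where w: "window \<nu> a b"
    using \<nu> by (auto simp: configs_eq_window)
  have summand: "(1 - \<beta>) * q * (f (swap x \<nu>) - f \<nu>)
      + \<beta> / 2 * (f (flip x \<nu>) + f (flip (x + 1) \<nu>) - 2 * f \<nu>) \<le> m - f \<nu>"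
    if x: "x \<in> falls \<nu> \<union> rises \<nu>" and q: "0 \<le> q" "q \<le> 1" for x q
  proof -
    have "(1 - \<beta>) * q * (f (swap x \<nu>) - f \<nu>) \<le> (1 - \<beta>) * q * (m - f \<nu>)"
      using \<beta> q f[OF swap_in_configs[OF \<nu> x]] by (intro mult_left_mono) auto
    also have "\<dots> \<le> (1 - \<beta>) * 1 * (m - f \<nu>)"
      using \<beta> q f[OF \<nu>] by (intro mult_right_mono mult_left_mono) auto
    moreover have "\<beta> / 2 * (f (flip x \<nu>) + f (flip (x + 1) \<nu>) - 2 * f \<nu>) \<le> \<beta> / 2 * (2 * (m - f \<nu>))"
      using \<beta> f[OF flip_in_configs[OF \<nu>, of x]] f[OF flip_in_configs[OF \<nu>, of "x
          + 1"]] by (intro mult_left_mono) auto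
    ultimately show ?thesis
      by (simp add: algebra_simps)
  qed
  have "L f \<nu> \<le> (\<Sum>x\<in>falls \<nu>. m - f \<nu>) + (\<Sum>x\<in>rises \<nu>. m - f \<nu>)"
    unfolding generator_eq[OF w] using p by (intro add_mono sum_mono summand) auto
  then show ?thesis
    by (simp add: rate_def algebra_simps)
qed

text \<open>The terms \<open>e\<close> collect what concavity gains over the linear bound at single boundaries.\<close>

lemma generator_tangent:
  assumes w: "window \<nu> a b" and c: "0 \<le> c"
    and swap: "\<And>x. x \<in> falls \<nu> \<union> rises \<nu> \<Longrightarrow> V (swap x \<nu>) - V \<nu> \<le> c * (W (swap x \<nu>) - W \<nu>)"
    and flip: "\<And>x. x \<in> falls \<nu> \<union> rises \<nu> \<Longrightarrow>
      V (flip x \<nu>) + V (flip (x + 1) \<nu>) - 2 * V \<nu> \<le> c * (W (flip x \<nu>) + W (flip (x + 1) \<nu>) - 2 * W \<nu>) - e x"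
    and e: "\<And>x. x \<in> rises \<nu> \<Longrightarrow> 0 \<le> e x"
  shows "L V \<nu> \<le> c * L W \<nu> - \<beta> / 2 * sum e (falls \<nu>)"
proof -
  have summand: "(1 - \<beta>) * q * (V (swap x \<nu>) - V \<nu>)
      + \<beta> / 2 * (V (flip x \<nu>) + V (flip (x + 1) \<nu>) - 2 * V \<nu>)
      \<le> c * ((1 - \<beta>) * q * (W (swap x \<nu>) - W \<nu>) + \<beta> / 2 * (W (flip x \<nu>) + W (flip (x + 1) \<nu>) - 2 * W \<nu>)) - \<beta> / 2 * e x"
    if x: "x \<in> falls \<nu> \<union> rises \<nu>" and q: "0 \<le> q" for x q
  proof -
    have "(1 - \<beta>) * q * (V (swap x \<nu>) - V \<nu>) \<le> (1 - \<beta>) * q * (c * (W (swap x \<nu>) - W \<nu>))"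
      using \<beta> q swap[OF x] by (intro mult_left_mono) auto
    moreover have "\<beta> / 2 * (V (flip x \<nu>) + V (flip (x + 1) \<nu>) - 2 * V \<nu>)
        \<le> \<beta> / 2 * (c * (W (flip x \<nu>) + W (flip (x + 1) \<nu>) - 2 * W \<nu>) - e x)"
      using \<beta> flip[OF x] by (intro mult_left_mono) auto
    ultimately show ?thesis
      by (simp add: algebra_simps)
  qed
  have "L V \<nu> \<le> (c * L W \<nu> - \<beta> / 2 * sum e (falls \<nu>)) - \<beta> / 2 * sum e (rises \<nu>)"
    unfolding generator_eq[OF w] distrib_left sum_distrib_left add_diff_add diff_diff_eq
      sum_subtractf[symmetric]
    apply (intro add_mono sum_mono)
    subgoal for x using summand[of x "1 - p"] p by (simp add: algebra_simps)
    subgoal for x using summand[of x p] p by (simp add: algebra_simps)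
    done
  moreover have "0 \<le> \<beta> / 2 * sum e (rises \<nu>)"
    using \<beta> e by (intro mult_nonneg_nonneg sum_nonneg) auto
  ultimately show ?thesis
    by linarith
qed

text \<open>At a rise the swap removes an inversion at rate (1 - \<beta>) p, and the flips change
  the number by -1 + d and -1 - d for some d, so at least one of them, at rate \<beta> / 2, removes
  at least one inversion.\<close>

definition down_rate :: real where
  "down_rate = (1 - \<beta>) * p + \<beta> / 2"

text \<open>A bounded function whose drift is strictly negative at every configuration other than the
  ground state, because at every \<open>01\<close> boundary the number of inversions decreases at least at
  rate \<open>down_rate\<close>.\<close>

definition barrier :: "config \<Rightarrow> real" where
  "barrier \<nu> = 1 - exp (- ln (4 / down_rate) * inversions \<nu>)"

lemma down_rate_le_1: "down_rate \<le> 1"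
proof -
  have "(1 - \<beta>) * p \<le> (1 - \<beta>) * 1"
    using \<beta> p by (intro mult_left_mono) auto
  then show ?thesis
    using \<beta> by (simp add: down_rate_def)
qed

lemma barrier_bounds:
  assumes "0 < down_rate"
  shows "0 \<le> barrier \<nu>" "barrier \<nu> \<le> 1"
  using assms down_rate_le_1 inversions_nonneg[of \<nu>] by (auto simp: barrier_def)

text \<open>With exp \<theta> = 4 / down_rate, losing an inversion multiplies E = exp (- \<theta> f)
  by at least 4 / down_rate. Hence a rise contributes at most E - 4 E = - 3 E, while a fall
  contributes at most E. With N rises and N + 1 falls the total is at most E (1 - 2 N) \<le> -
  E.\<close>

lemma generator_barrier:
  assumes d: "0 < down_rate" and \<nu>: "\<nu> \<in> configs - ground_configs"
  shows "L barrier \<nu> \<le> - exp (- ln (4 / down_rate) * inversions \<nu>)"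
proof -
  define \<theta> where "\<theta> = ln (4 / down_rate)"
  define E where "E = (\<lambda>\<nu>. exp (- \<theta> * inversions \<nu>))"
  have barrier: "barrier \<mu> = 1 - E \<mu>" for \<mu>
    by (simp add: barrier_def E_def \<theta>_def)
  have \<theta>: "0 \<le> \<theta>" "exp \<theta> = 4 / down_rate"
    using d down_rate_le_1 by (auto simp: \<theta>_def)
  have E_pos: "0 < E \<mu>" for \<mu>
    by (simp add: E_def)
  obtain l r where "hybrid_zone \<nu> l r"
    using \<nu> by (rule ground_configs_hybrid_zone)
  then interpret hybrid_zone \<nu> l r .
  note w = wide_window
  have down: "4 / down_rate * E \<nu> \<le> E \<mu>" if "inversions \<mu> \<le> inversions \<nu> - 1" for \<mu>
  proof -
    have "\<theta> + - \<theta> * inversions \<nu> \<le> - \<theta> * inversions \<mu>"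
      using mult_left_mono[OF that \<theta>(1)] by (simp add: algebra_simps)
    then have "exp (\<theta> + - \<theta> * inversions \<nu>) \<le> E \<mu>"
      by (simp add: E_def)
    then show ?thesis
      using \<theta>(2) unfolding exp_add E_def by simp
  qed
  have fall: "(1 - \<beta>) * (1 - p) * (barrier (swap x \<nu>) - barrier \<nu>)
      + \<beta> / 2 * (barrier (flip x \<nu>) + barrier (flip (x + 1) \<nu>) - 2 * barrier \<nu>) \<le> E \<nu>" for x
  proof -
    have "(1 - \<beta>) * (1 - p) * (E \<nu> - E (swap x \<nu>)) \<le> (1 - \<beta>) * 1 * E \<nu>"
      using \<beta> p E_pos[of \<nu>] E_pos[of "swap x \<nu>"] by (intro order_trans[OF mult_left_mono mult_right_mono] mult_left_mono) auto
    moreover have "\<beta> / 2 * (2 * E \<nu> - E (flip x \<nu>) - E (flip (x + 1) \<nu>)) \<le> \<beta> / 2 * (2 * E \<nu>)"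
      using \<beta> E_pos[of "flip x \<nu>"] E_pos[of "flip (x + 1) \<nu>"] by (intro mult_left_mono) auto
    ultimately show ?thesis
      unfolding barrier by (simp add: algebra_simps)
  qed
  have rise: "(1 - \<beta>) * p * (barrier (swap x \<nu>) - barrier \<nu>)
      + \<beta> / 2 * (barrier (flip x \<nu>) + barrier (flip (x + 1) \<nu>) - 2 * barrier \<nu>) \<le> - 3 * E \<nu>"
    if x: "x \<in> rises \<nu>" for x
  proof -
    have xw: "l - 1 < x" "x + 1 < r + 2"
      using boundary_inside[of x] x by auto
    have "4 / down_rate * E \<nu> \<le> E (swap x \<nu>)"
      using swap_rise(1)[OF w xw x] by (intro down) simp
    then have "(1 - \<beta>) * p * (E \<nu> - E (swap x \<nu>)) \<le> (1 - \<beta>) * p * (E \<nu> - 4 / down_rate * E \<nu>)"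
      using \<beta> p by (intro mult_left_mono) auto
    moreover have "4 / down_rate * E \<nu> \<le> E (flip x \<nu>) \<or> 4 / down_rate * E \<nu> \<le> E (flip (x + 1) \<nu>)"
      using flip_rise(1,2)[OF w xw x] down[of "flip x \<nu>"] down[of "flip (x + 1) \<nu>"]
      by (cases "zeros_upto \<nu> x \<le> ones_above \<nu> x") auto
    then have "4 / down_rate * E \<nu> \<le> E (flip x \<nu>) + E (flip (x + 1) \<nu>)"
      using E_pos[of "flip x \<nu>"] E_pos[of "flip (x + 1) \<nu>"] by auto
    then have "\<beta> / 2 * (2 * E \<nu> - E (flip x \<nu>) - E (flip (x + 1) \<nu>))
        \<le> \<beta> / 2 * (2 * E \<nu> - 4 / down_rate * E \<nu>)"
      using \<beta> by (intro mult_left_mono) auto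
    moreover have "(1 - \<beta>) * p * (E \<nu> - 4 / down_rate * E \<nu>) + \<beta> / 2 * (2 * E \<nu> - 4 / down_rate * E \<nu>)
        = ((1 - \<beta>) * p + \<beta>) * E \<nu> - down_rate * (4 / down_rate * E \<nu>)"
      unfolding down_rate_def by (simp only: left_diff_distrib right_diff_distrib distrib_right distrib_left)
    moreover have "down_rate * (4 / down_rate * E \<nu>) = 4 * E \<nu>"
      using d by simp
    moreover have "((1 - \<beta>) * p + \<beta>) * E \<nu> \<le> ((1 - \<beta>) * 1 + \<beta>) * E \<nu>"
      using \<beta> p E_pos[of \<nu>] by (intro mult_right_mono add_right_mono mult_left_mono) auto
    ultimately show ?thesis
      unfolding barrier by (simp add: algebra_simps)
  qed
  have "L barrier \<nu> \<le> (\<Sum>x\<in>falls \<nu>. E \<nu>) + (\<Sum>x\<in>rises \<nu>. - 3 * E \<nu>)"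
    unfolding generator_eq[OF w] by (intro add_mono sum_mono fall rise)
  also have "\<dots> = E \<nu> * (1 - 2 * real (card (rises \<nu>)))"
    using card_falls[OF w] by (simp add: algebra_simps)
  also have "\<dots> \<le> E \<nu> * (- 1)"
    using rises_pos E_pos[of \<nu>] by (intro mult_left_mono) auto
  finally show ?thesis
    by (simp add: E_def \<theta>_def)
qed

lemma generator_add_mult:
  assumes "\<nu> \<in> configs"
  shows "L (\<lambda>x. f x + c * g x) \<nu> = L f \<nu> + c * L g \<nu>"
  using generator_linear[OF assms, of f "- c" g] by simp

text \<open>Where f < f0 the drift of the barrier is at most - exp (- \<theta> f0), so the multiple
  \<open>B0\<close> outweighs the constant \<open>C\<close>; elsewhere it does no harm. One further
  copy of the barrier leaves a strictly negative remainder everywhere off the ground state, which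
  the recurrence proof needs.\<close>

lemma barrier_absorbs:
  assumes d: "0 < down_rate"
    and large: "\<And>\<nu>. \<nu> \<in> configs - ground_configs \<Longrightarrow> f0 \<le> inversions \<nu> \<Longrightarrow> L U \<nu> \<le> - h \<nu>"
    and small: "\<And>\<nu>. \<nu> \<in> configs - ground_configs \<Longrightarrow> inversions \<nu> < f0 \<Longrightarrow> L U \<nu> + h \<nu> \<le> C"
  shows "\<exists>B\<ge>0. \<forall>\<nu>\<in>configs - ground_configs.
    L (\<lambda>\<mu>. U \<mu> + B * barrier \<mu>) \<nu> \<le> - h \<nu> - exp (- ln (4 / down_rate) * inversions \<nu>)"
proof (intro exI conjI ballI)
  define \<theta> where "\<theta> = ln (4 / down_rate)"
  have \<theta>: "0 \<le> \<theta>"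
    using d down_rate_le_1 by (auto simp: \<theta>_def)
  define B0 where "B0 = max 0 C * exp (\<theta> * f0)"
  have B0: "0 \<le> B0"
    by (simp add: B0_def)
  then show "0 \<le> B0 + 1"
    by simp
  fix \<nu> assume \<nu>: "\<nu> \<in> configs - ground_configs"
  let ?E = "exp (- \<theta> * inversions \<nu>)"
  have "L (\<lambda>\<mu>. U \<mu> + (B0 + 1) * barrier \<mu>) \<nu> = L U \<nu> + (B0 + 1) * L barrier \<nu>"
    using \<nu> by (intro generator_add_mult) auto
  also have "\<dots> \<le> L U \<nu> + (B0 + 1) * (- ?E)"
    using generator_barrier[OF d \<nu>] B0 unfolding \<theta>_def by (intro add_left_mono mult_left_mono) auto
  also have "\<dots> = L U \<nu> - B0 * ?E - ?E"
    by (simp add: algebra_simps)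
  also have "L U \<nu> - B0 * ?E \<le> - h \<nu>"
  proof (cases "f0 \<le> inversions \<nu>")
    case True
    have "0 \<le> B0 * ?E"
      using B0 by simp
    then show ?thesis
      using large[OF \<nu> True] by linarith
  next
    case False
    then have "\<theta> * inversions \<nu> \<le> \<theta> * f0"
      using \<theta> by (intro mult_left_mono) auto
    then have "exp 0 \<le> exp (\<theta> * f0 + - \<theta> * inversions \<nu>)"
      by (subst exp_le_cancel_iff) simp
    then have "max 0 C * 1 \<le> max 0 C * (exp (\<theta> * f0) * ?E)"
      unfolding exp_add by (intro mult_left_mono) auto
    then have "C \<le> B0 * ?E"
      by (simp add: B0_def mult.assoc)
    then show ?thesis
      using small[OF \<nu>] False by simp
  qed
  finally show "L (\<lambda>\<mu>. U \<mu> + (B0 + 1) * barrier \<mu>) \<nu>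
      \<le> - h \<nu> - exp (- ln (4 / down_rate) * inversions \<nu>)"
    by (simp add: \<theta>_def)
qed

section \<open>Logarithmic drift and recurrence\<close>

text \<open>The first-order part is the drift of f divided by 1 + f, bounded by its value at p = 0.
  The gain comes from the flips at the two extreme falls, which change f by m and -m and by n and
  -n: a pair of changes h and -h lowers the sum of logarithms by at least h^2 / (1 + f)^2, and m^2 +
  n^2 \<ge> 2 m n \<ge> 2 f.\<close>

lemma generator_log_inversions:
  assumes "hybrid_zone \<nu> l r" and "4/7 \<le> \<beta>"
  defines "f \<equiv> inversions \<nu>"
  shows "L (\<lambda>\<mu>. ln (1 + inversions \<mu>)) \<nu>
      \<le> ((1 - \<beta>) * (real (card (rises \<nu>)) + 1) - \<beta> * card (rises \<nu>) - \<beta> * (f / (1 + f))) / (1 + f)"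
proof -
  interpret hybrid_zone \<nu> l r by fact
  note w = wide_window
  define G where "G = 1 + inversions \<nu>"
  have G: "1 \<le> G" "0 < G"
    using inversions_nonneg[of \<nu>] by (auto simp: G_def)
  have tangent: "ln (1 + inversions \<mu>) - ln G \<le> 1 / G * (inversions \<mu> - inversions \<nu>)" for \<mu>
  proof -
    have pos: "0 < 1 + inversions \<mu>"
      using inversions_nonneg[of \<mu>] by simp
    then have "ln ((1 + inversions \<mu>) / G) \<le> (1 + inversions \<mu>) / G - 1"
      using G by (intro ln_le_minus_one) simp
    also have "\<dots> = 1 / G * (inversions \<mu> - inversions \<nu>)"
      using G by (simp add: G_def field_simps)
    finally show ?thesis
      using G pos by (simp add: ln_div)
  qed
  define e where "e = (\<lambda>x. if x = l then m\<^sup>2 / G\<^sup>2 else if x = r then n\<^sup>2 / G\<^sup>2 else 0)"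
  have pair: "ln (1 + inversions \<mu>) + ln (1 + inversions \<mu>') - 2 * ln G \<le> - (h\<^sup>2 / G\<^sup>2)"
    if "inversions \<mu> = inversions \<nu> + h" "inversions \<mu>' = inversions \<nu> - h" for \<mu> \<mu>' h
  proof -
    have pos: "0 < G + h" "0 < G - h"
      using that inversions_nonneg[of \<mu>] inversions_nonneg[of \<mu>'] by (auto simp: G_def)
    then have "ln ((G + h) * (G - h) / (G * G)) \<le> (G + h) * (G - h) / (G * G) - 1"
      using G by (intro ln_le_minus_one) simp
    also have "\<dots> = - (h\<^sup>2 / G\<^sup>2)"
      using G by (simp add: field_simps power2_eq_square)
    also have "ln ((G + h) * (G - h) / (G * G)) = ln (G + h) + ln (G - h) - 2 * ln G"
      using G pos by (simp add: ln_div ln_mult)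
    finally show ?thesis
      using that by (simp add: G_def add_ac add_diff_eq)
  qed
  have "L (\<lambda>\<mu>. ln (1 + inversions \<mu>)) \<nu> \<le> 1 / G * L inversions \<nu> - \<beta> / 2 * sum e (falls \<nu>)"
  proof (rule generator_tangent[OF w])
    fix x assume x: "x \<in> falls \<nu> \<union> rises \<nu>"
    show "ln (1 + inversions (flip x \<nu>))
        + ln (1 + inversions (flip (x + 1) \<nu>)) - 2 * ln (1 + inversions \<nu>)
      \<le> 1 / G * (inversions (flip x \<nu>) + inversions (flip (x + 1) \<nu>) - 2 * inversions \<nu>) - e x"
    proof (cases "x = l \<or> x = r")
      case True
      then have xf: "x \<in> falls \<nu>"
        using extreme_falls by auto
      have xw: "l - 1 < x" "x + 1 < r + 2"
        using boundary_inside[OF x] by auto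
      have "e x = (ones_above \<nu> x - zeros_upto \<nu> x)\<^sup>2 / G\<^sup>2"
        using True l_less_r zeros_l ones_r by (auto simp: e_def)
      then show ?thesis
        using pair[OF flip_fall(1,2)[OF w xw xf]] flip_fall(1,2)[OF w xw xf] by (simp add: G_def)
    next
      case False
      then have "e x = 0"
        by (simp add: e_def)
      have distrib: "1 / G * (y - inversions \<nu>) + 1 / G * (z - inversions \<nu>)
          = 1 / G * (y + z - 2 * inversions \<nu>)" for y z
        by (simp add: add_divide_distrib[symmetric])
      show ?thesis
        using tangent[of "flip x \<nu>"] tangent[of "flip (x + 1) \<nu>"] \<open>e x = 0\<close>
          distrib[of "inversions (flip x \<nu>)" "inversions (flip (x + 1) \<nu>)"]
        unfolding G_def[symmetric] by linarith
    qed
  qed (use tangent G in \<open>auto simp: e_def G_def\<close>)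
  moreover have "2 * inversions \<nu> / G\<^sup>2 \<le> sum e (falls \<nu>)"
  proof -
    have "2 * (m * n) \<le> m\<^sup>2 + n\<^sup>2"
      using sum_squares_bound[of m n] by simp
    then have "2 * inversions \<nu> \<le> m\<^sup>2 + n\<^sup>2"
      using inversions_le by linarith
    then have "2 * inversions \<nu> / G\<^sup>2 \<le> (m\<^sup>2 + n\<^sup>2) / G\<^sup>2"
      by (intro divide_right_mono) auto
    also have "\<dots> = sum e {l, r}"
      using l_less_r by (simp add: e_def add_divide_distrib)
    also have "\<dots> \<le> sum e (falls \<nu>)"
      using extreme_falls by (intro sum_mono2 finite_falls[OF w]) (auto simp: e_def)
    finally show ?thesis .
  qed
  then have "\<beta> / 2 * (2 * inversions \<nu> / G\<^sup>2) \<le> \<beta> / 2 * sum e (falls \<nu>)"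
    using \<beta> by (intro mult_left_mono) auto
  moreover have "1 / G * L inversions \<nu>
      \<le> 1 / G * ((1 - \<beta>) * (real (card (rises \<nu>)) + 1) - \<beta> * card (rises \<nu>))"
  proof (rule mult_left_mono)
    have "(1 - \<beta>) * (1 - p) \<le> 1 - \<beta>" "\<beta> \<le> (1 - \<beta>) * p + \<beta>"
      using \<beta> p by (auto simp: mult_left_le)
    then have "(1 - \<beta>) * (1 - p) * (real (card (rises \<nu>)) + 1) - ((1 - \<beta>) * p + \<beta>) * card (rises \<nu>)
        \<le> (1 - \<beta>) * (real (card (rises \<nu>)) + 1) - \<beta> * card (rises \<nu>)"
      by (intro diff_mono mult_right_mono) auto
    then show "L inversions \<nu> \<le> (1 - \<beta>) * (real (card (rises \<nu>)) + 1) - \<beta> * card (rises \<nu>)"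
      unfolding generator_inversions[OF window_in_configs[OF w]] by (simp add: add.commute)
  qed (use G in simp)
  ultimately have "L (\<lambda>\<mu>. ln (1 + inversions \<mu>)) \<nu>
      \<le> 1 / G * ((1 - \<beta>) * (real (card (rises \<nu>)) + 1) - \<beta> * card (rises \<nu>)) - \<beta> / 2 * (2 * inversions \<nu> / G\<^sup>2)"
    by linarith
  also have "\<dots> = ((1 - \<beta>) * (real (card (rises \<nu>)) + 1) - \<beta> * card (rises \<nu>)
      - \<beta> * (inversions \<nu> / G)) / G"
    using G by (simp add: power2_eq_square diff_divide_distrib)
  finally show ?thesis
    by (simp add: G_def f_def)
qed

lemma recurrence_lyapunov:
  assumes \<beta>_ge: "4/7 \<le> \<beta>"
  obtains V where "\<And>\<nu>. 0 \<le> V \<nu>" "\<And>\<nu>. ln (1 + inversions \<nu>) \<le> V \<nu>"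
    "\<And>c. \<exists>\<eta>>0. \<forall>\<nu>\<in>configs. \<nu> \<notin> ground_configs \<longrightarrow> V \<nu> \<le> c \<longrightarrow> L V \<nu> \<le> - \<eta>"
proof -
  have d: "0 < down_rate"
    unfolding down_rate_def using \<beta> p \<beta>_ge by (intro add_nonneg_pos) auto
  define \<theta> where "\<theta> = ln (4 / down_rate)"
  have \<theta>: "0 \<le> \<theta>"
    using d down_rate_le_1 by (auto simp: \<theta>_def)
  let ?U = "\<lambda>\<mu>. ln (1 + inversions \<mu>)"
  have bound: "L ?U \<nu> \<le> ((1 - \<beta>) * (real (card (rises \<nu>)) + 1) - \<beta> * card (rises \<nu>)
      - \<beta> * (inversions \<nu> / (1 + inversions \<nu>))) / (1 + inversions \<nu>)
      \<and> 1 \<le> card (rises \<nu>) \<and> card (rises \<nu>) \<le> inversions \<nu>"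
    if \<nu>: "\<nu> \<in> configs - ground_configs" for \<nu>
  proof -
    obtain l r where z: "hybrid_zone \<nu> l r"
      using \<nu> by (rule ground_configs_hybrid_zone)
    then interpret hybrid_zone \<nu> l r .
    show ?thesis
      using generator_log_inversions[OF z \<beta>_ge] rises_pos rises_le_inversions[OF zone_window] by simp
  qed
  have large: "L ?U \<nu> \<le> - 0" if \<nu>: "\<nu> \<in> configs - ground_configs" and f: "3 \<le> inversions \<nu>" for \<nu>
  proof -
    let ?N = "real (card (rises \<nu>))" and ?f = "inversions \<nu>"
    note b = bound[OF \<nu>]
      \<comment> \<open>The numerator is largest at N = 1, where it is at most 2 - 3 \<beta> - (3/4)
        \<beta> = 2 - (15/4) \<beta>; this is negative because (15/4)(4/7) = 15/7 > 2.\<close>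
      have "3 / 4 \<le> ?f / (1 + ?f)"
        using f by (simp add: field_simps)
      then have "\<beta> * (3 / 4) \<le> \<beta> * (?f / (1 + ?f))"
        using \<beta> by (intro mult_left_mono) auto
      moreover have "(1 - 2 * \<beta>) * ?N \<le> (1 - 2 * \<beta>) * 1"
        using b \<beta>_ge by (intro mult_left_mono_neg) auto
      ultimately have "(1 - \<beta>) * (?N + 1) - \<beta> * ?N - \<beta> * (?f / (1 + ?f)) \<le> 0"
        using \<beta>_ge by (simp add: algebra_simps)
      then have "((1 - \<beta>) * (?N + 1) - \<beta> * ?N - \<beta> * (?f / (1 + ?f))) / (1 + ?f) \<le> 0"
        by (rule divide_nonpos_pos) (use f in simp)
      then show ?thesis
        using conjunct1[OF b] by linarith
    qed
  have small: "L ?U \<nu> + 0 \<le> 4" if \<nu>: "\<nu> \<in> configs - ground_configs" and f: "inversions \<nu> < 3" for \<nu>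
  proof -
    let ?N = "real (card (rises \<nu>))" and ?f = "inversions \<nu>"
    note b = bound[OF \<nu>]
      have "0 \<le> \<beta> * (?f / (1 + ?f))" "0 \<le> \<beta> * ?N"
        using \<beta> inversions_nonneg[of \<nu>] by auto
      moreover have "(1 - \<beta>) * (?N + 1) \<le> 1 * (3 + 1)"
        using \<beta> b f by (intro mult_mono) auto
      moreover have "x - y - z \<le> 4" if "x \<le> 1 * (3 + 1)" "0 \<le> y" "0 \<le> z" for x y z :: real
        using that by simp
      ultimately have "(1 - \<beta>) * (?N + 1) - \<beta> * ?N - \<beta> * (?f / (1 + ?f)) \<le> 4"
        by blast
      then have "((1 - \<beta>) * (?N + 1) - \<beta> * ?N - \<beta> * (?f / (1 + ?f))) / (1 + ?f) \<le> 4 / (1 + ?f)"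
        using inversions_nonneg[of \<nu>] by (intro divide_right_mono) auto
      also have "\<dots> \<le> 4"
        using inversions_nonneg[of \<nu>] by (simp add: field_simps)
      finally show ?thesis
        using b by simp
    qed
  obtain B where B: "0 \<le> B" "\<And>\<nu>. \<nu> \<in> configs - ground_configs \<Longrightarrow>
    L (\<lambda>\<mu>. ?U \<mu> + B * barrier \<mu>) \<nu> \<le> - 0 - exp (- \<theta> * inversions \<nu>)"
    using barrier_absorbs[OF d large small] unfolding \<theta>_def by blast
  define V where "V = (\<lambda>\<mu>. ?U \<mu> + B * barrier \<mu>)"
  show thesis
  proof (rule that[of V])
    have "0 \<le> ?U \<nu>" "0 \<le> B * barrier \<nu>" for \<nu>
      using inversions_nonneg[of \<nu>] B(1) barrier_bounds[OF d] by auto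
    then show le: "0 \<le> V \<nu>" "?U \<nu> \<le> V \<nu>" for \<nu>
      by (simp_all add: V_def)
    fix c :: real
    \<comment> \<open>On the level set V \<le> c the number of inversions is at most exp c, so the
      remainder left by \<open>barrier_absorbs\<close> is bounded away from 0.\<close>
    have "L V \<nu> \<le> - exp (- \<theta> * exp c)" if \<nu>: "\<nu> \<in> configs - ground_configs" "V \<nu> \<le> c" for \<nu>
    proof -
      have "exp (ln (1 + inversions \<nu>)) \<le> exp c"
        using le(2)[of \<nu>] \<nu>(2) by simp
      then have "inversions \<nu> \<le> exp c"
        using inversions_nonneg[of \<nu>] by simp
      then have "- \<theta> * exp c \<le> - \<theta> * inversions \<nu>"
        using mult_left_mono[OF _ \<theta>] by simp
      then have "exp (- \<theta> * exp c) \<le> exp (- \<theta> * inversions \<nu>)"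
        by (subst exp_le_cancel_iff)
      then show ?thesis
        using B(2)[OF \<nu>(1)] unfolding V_def by linarith
    qed
    then show "\<exists>\<eta>>0. \<forall>\<nu>\<in>configs. \<nu> \<notin> ground_configs \<longrightarrow> V \<nu> \<le> c \<longrightarrow> L V \<nu> \<le> - \<eta>"
      by (intro exI[of _ "exp (- \<theta> * exp c)"]) auto
  qed
qed

section \<open>The pure voter dynamics\<close>

text \<open>Flipping the leftmost zero or the rightmost one lowers the spread X by H1 or H2, and
  there the power a = 4/5 gains X^a (H/X)^2 up to a constant. With Y = H1 H2, the bounds (m n)^2
  \<le> 4 Y and X^2 \<le> m n Y give X of order at most Y^(3/4) and f of order at most Y^(1/2). So
  the gain is at least of order Y^((3a-2)/4), hence of order f^((3a-2)/2), which is f^(1/5).\<close>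

lemma voter_spread_drift:
  assumes "\<beta> = 1" and \<nu>: "\<nu> \<in> configs - ground_configs"
  shows "L (\<lambda>\<mu>. spread \<mu> powr (4/5)) \<nu> \<le> - (inversions \<nu> powr (1/5) / 25)"
proof -
  obtain l r where "hybrid_zone \<nu> l r"
    using \<nu> by (rule ground_configs_hybrid_zone)
  then interpret hybrid_zone \<nu> l r .
  note w = wide_window
  define X where "X = spread \<nu>"
  define H1 where "H1 = right_area \<nu> (l + 1)"
  define H2 where "H2 = left_area \<nu> r"
  have H1: "m\<^sup>2 / 2 \<le> H1" "H1 \<le> X" "X \<le> n * H1"
    using right_area_bounds m_pos by (auto simp: H1_def X_def power2_eq_square field_simps)
  have H2: "n\<^sup>2 / 2 \<le> H2" "H2 \<le> X" "X \<le> m * H2"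
    using left_area_bounds n_pos by (auto simp: H2_def X_def power2_eq_square field_simps)
  have "0 < m\<^sup>2 / 2" "0 < n\<^sup>2 / 2"
    using m_pos n_pos by auto
  then have pos: "0 < H1" "0 < H2" "0 < X"
    using H1 H2 by linarith+
  let ?c = "4/5 * X powr (4/5 - 1)"
  let ?gain = "\<lambda>h. 2/25 * (X powr (4/5) * (h / X)\<^sup>2)"
  define e where "e = (\<lambda>x. if x = l then ?gain H1 else if x = r then ?gain H2 else 0)"
  have tangent: "spread \<mu> powr (4/5) - X powr (4/5) \<le> ?c * (spread \<mu> - X)" for \<mu>
    using pos spread_nonneg by (intro powr_tangent) auto
  have gain: "spread \<mu> powr (4/5) - X powr (4/5) \<le> ?c * (spread \<mu> - X) - ?gain h"
    if "spread \<mu> = X - h" "0 \<le> h" "h \<le> X" for \<mu> h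
    using powr_tangent_gain[OF pos(3) that(2,3)] that(1) by simp
  have "L (\<lambda>\<mu>. spread \<mu> powr (4/5)) \<nu> \<le> ?c * L spread \<nu> - \<beta> / 2 * sum e (falls \<nu>)"
  proof (rule generator_tangent[OF w])
    fix x assume x: "x \<in> falls \<nu> \<union> rises \<nu>"
    have combine: "a + b - 2 * X powr (4/5) \<le> ?c * (y + z - 2 * X) - g"
      if "a - X powr (4/5) \<le> ?c * (y - X) - g1" "b - X powr (4/5) \<le> ?c * (z - X) - g2" "g
          = g1 + g2" for a b y z g g1 g2
    proof -
      have "?c * (y - X) + ?c * (z - X) = ?c * (y + z - 2 * X)"
        by (simp only: distrib_left[symmetric]) simp
      then show ?thesis
        using that by linarith
    qed
    show "spread (flip x \<nu>) powr (4/5) + spread (flip (x + 1) \<nu>) powr (4/5) - 2 * spread \<nu> powr (4/5)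
      \<le> ?c * (spread (flip x \<nu>) + spread (flip (x + 1) \<nu>) - 2 * spread \<nu>) - e x"
      unfolding X_def[symmetric]
    proof (cases "x = l")
      case True
      have "spread (flip (x + 1) \<nu>) = X - H1"
        unfolding True H1_def X_def using spread_flip_zero[OF w _ _ l] l_less_r left_area_l by simp
      then show "spread (flip x \<nu>) powr (4/5) + spread (flip (x + 1) \<nu>) powr (4/5) - 2 * X powr (4/5)
          \<le> ?c * (spread (flip x \<nu>) + spread (flip (x + 1) \<nu>) - 2 * X) - e x"
        using gain[of "flip (x + 1) \<nu>" H1] tangent[of "flip x \<nu>"] pos H1 True
        by (intro combine[of _ _ 0 _ _ "?gain H1"]) (auto simp: e_def)
    next
      case False
      show "spread (flip x \<nu>) powr (4/5) + spread (flip (x + 1) \<nu>) powr (4/5) - 2 * X powr (4/5)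
          \<le> ?c * (spread (flip x \<nu>) + spread (flip (x + 1) \<nu>) - 2 * X) - e x"
      proof (cases "x = r")
        case True
        have "spread (flip x \<nu>) = X - H2"
          unfolding True H2_def X_def using spread_flip_one[OF w _ _ r] l_less_r right_area_r by simp
        then show ?thesis
          using gain[of "flip x \<nu>" H2] tangent[of "flip (x + 1) \<nu>"] pos H2 False True
          by (intro combine[of _ _ "?gain H2" _ _ 0]) (auto simp: e_def)
      next
        case False
        then show ?thesis
          using tangent[of "flip x \<nu>"] tangent[of "flip (x + 1) \<nu>"] \<open>x \<noteq> l\<close>
          by (intro combine[of _ _ 0 _ _ 0]) (auto simp: e_def)
      qed
    qed
  qed (use tangent pos in \<open>auto simp: e_def X_def\<close>)
  moreover have "L spread \<nu> = 0"
    using \<nu> assms(1) by (subst generator_spread) auto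
  moreover have "?gain H1 + ?gain H2 \<le> sum e (falls \<nu>)"
  proof -
    have "?gain H1 + ?gain H2 = sum e {l, r}"
      using l_less_r by (simp add: e_def)
    also have "\<dots> \<le> sum e (falls \<nu>)"
      using extreme_falls by (intro sum_mono2 finite_falls[OF w]) (auto simp: e_def)
    finally show ?thesis .
  qed
  then have "(?gain H1 + ?gain H2) / 2 \<le> sum e (falls \<nu>) / 2"
    by (rule divide_right_mono) simp
  moreover have "a \<le> - g" if "a \<le> c * b - 1 / 2 * s" "b = 0" "g \<le> s / 2" for a b c g s :: real
    using that by simp
  ultimately have "L (\<lambda>\<mu>. spread \<mu> powr (4/5)) \<nu> \<le> - ((?gain H1 + ?gain H2) / 2)"
    unfolding assms(1) by blast
  \<comment> \<open>The factor is 1/25 = (1/2)(2/25), from the voter rate and the quadratic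
    coefficient; it remains to bound the two squared area ratios from below.\<close>
  also have "\<dots> \<le> - (inversions \<nu> powr (1/5) / 25)"
  proof -
    define Y where "Y = H1 * H2"
    have Y: "0 < Y"
      using pos by (simp add: Y_def)
    have mn: "(m * n)\<^sup>2 \<le> 4 * Y"
    proof -
      have "m\<^sup>2 / 2 * (n\<^sup>2 / 2) \<le> H1 * H2"
        using H1 H2 pos by (intro mult_mono) auto
      then show ?thesis
        by (simp add: Y_def power_mult_distrib)
    qed
    have "X * X \<le> (n * H1) * (m * H2)"
      using H1 H2 pos n_pos by (intro mult_mono) auto
    then have "X\<^sup>2 \<le> m * n * Y"
      by (simp add: Y_def power2_eq_square mult_ac)
    then have "(X\<^sup>2)\<^sup>2 \<le> (m * n * Y)\<^sup>2"
      by (intro power_mono) auto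
    also have "\<dots> = (m * n)\<^sup>2 * Y\<^sup>2"
      by (simp add: power_mult_distrib)
    also have "\<dots> \<le> 4 * Y * Y\<^sup>2"
      using mn by (intro mult_right_mono) auto
    finally have X4: "X ^ 4 \<le> 4 * Y ^ 3"
      by (simp add: power2_eq_square power3_eq_cube power4_eq_xxxx mult_ac)
    have f2: "(inversions \<nu>)\<^sup>2 \<le> 4 * Y"
      using power_mono[OF inversions_le inversions_nonneg, of 2] mn by simp
    have "X powr (6/5) = (X ^ 4) powr (3/10)"
      using pos by (simp add: powr_powr flip: powr_numeral)
    also have "\<dots> \<le> (4 * Y ^ 3) powr (3/10)"
      using X4 pos by (intro powr_mono2) auto
    also have "\<dots> = 4 powr (3/10) * Y powr (9/10)"
      using Y by (simp add: powr_mult powr_powr flip: powr_numeral)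
    finally have 1: "X powr (6/5) \<le> 4 powr (3/10) * Y powr (9/10)" .
    have "inversions \<nu> powr (1/5) = ((inversions \<nu>)\<^sup>2) powr (1/10)"
      using inversions_pos by (simp add: powr_powr flip: powr_numeral)
    also have "\<dots> \<le> (4 * Y) powr (1/10)"
      using f2 by (intro powr_mono2) auto
    also have "\<dots> = 4 powr (1/10) * Y powr (1/10)"
      using Y by (simp add: powr_mult)
    finally have 2: "inversions \<nu> powr (1/5) \<le> 4 powr (1/10) * Y powr (1/10)" .
    have "X powr (6/5) * inversions \<nu> powr (1/5)
        \<le> (4 powr (3/10) * Y powr (9/10)) * (4 powr (1/10) * Y powr (1/10))"
      by (intro mult_mono 1 2) auto
    also have "\<dots> = (4 powr (3/10) * 4 powr (1/10)) * (Y powr (9/10) * Y powr (1/10))"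
      by simp
    also have "\<dots> = 4 powr (2/5) * Y"
      using Y by (simp add: powr_add[symmetric])
    \<comment> \<open>The exponents 9/10 and 1/10 were arranged to leave Y to the power 1; rounding
      2/5 up to 1/2 gives the constant 2 of 2 H1 H2 \<le> H1^2 + H2^2.\<close>
    also have "\<dots> \<le> 4 powr (1/2) * Y"
      using Y by (intro mult_right_mono powr_mono) auto
    also have "(4::real) powr (1/2) = 2"
      by (simp add: powr_half_sqrt)
    finally have "X powr (6/5) * inversions \<nu> powr (1/5) \<le> 2 * Y" .
    moreover have "2 * Y \<le> H1\<^sup>2 + H2\<^sup>2"
      using sum_squares_bound[of H1 H2] by (simp add: Y_def)
    ultimately have "X powr (6/5) * inversions \<nu> powr (1/5) \<le> H1\<^sup>2 + H2\<^sup>2"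
      by linarith
    then have "inversions \<nu> powr (1/5) \<le> (H1\<^sup>2 + H2\<^sup>2) / X powr (6/5)"
      using pos by (simp add: pos_le_divide_eq mult.commute)
    also have "\<dots> = X powr (4/5) * (H1 / X)\<^sup>2 + X powr (4/5) * (H2 / X)\<^sup>2"
    proof -
      have "X powr (6/5) = X powr (2 - 4/5)"
        by simp
      also have "\<dots> = X powr 2 / X powr (4/5)"
        by (rule powr_diff)
      finally have "X powr (6/5) = X\<^sup>2 / X powr (4/5)"
        using pos by simp
      then show ?thesis
        by (simp add: power_divide add_divide_distrib distrib_right mult.commute)
    qed
    finally have "inversions \<nu> powr (1/5) \<le> X powr (4/5) * (H1 / X)\<^sup>2 + X powr (4/5) * (H2 / X)\<^sup>2" .
    moreover have "- ((2/25 * a + 2/25 * b) / 2) \<le> - (i / 25)" if "i \<le> a + b" for a b i :: real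
      using that by simp
    ultimately show ?thesis
      by blast
  qed
  finally show ?thesis .
qed

section \<open>Exclusion with bias towards the ground state\<close>

lemma energy_drift:
  assumes p_gt: "1/2 < p" and \<beta>_lt: "\<beta> < 1"
  obtains \<kappa> \<alpha> where "0 < \<kappa>" "\<kappa> \<le> 1" "2 \<le> \<alpha>"
    "\<And>\<nu>. \<nu> \<in> configs \<Longrightarrow> L (energy \<alpha>) \<nu> \<le> - \<kappa> * fall_area \<nu> - card (rises \<nu>) + 1 + \<alpha>"
proof
  define \<kappa> where "\<kappa> = (1 - \<beta>) * (2 * p - 1)"
  \<comment> \<open>The coefficient of N in the drift of the inversions is - (\<kappa> + \<beta>).
    This weight makes it -2, which turns the unfavourable (1 - \<beta>) N from the spread into at
    most - N.\<close>
  define \<alpha> where "\<alpha> = 2 / (\<kappa> + \<beta>)"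
  show \<kappa>: "0 < \<kappa>"
    unfolding \<kappa>_def using p_gt \<beta>_lt by (intro mult_pos_pos) auto
  have \<kappa>_le: "\<kappa> \<le> 1 - \<beta>"
    unfolding \<kappa>_def using \<beta> p by (intro mult_left_le) auto
  then show "\<kappa> \<le> 1"
    using \<beta> by simp
  have c: "0 < \<kappa> + \<beta>" "\<kappa> + \<beta> \<le> 1"
    using \<kappa> \<kappa>_le \<beta> by auto
  then show \<alpha>: "2 \<le> \<alpha>"
    by (simp add: \<alpha>_def field_simps)
  fix \<nu> assume \<nu>: "\<nu> \<in> configs"
  let ?N = "real (card (rises \<nu>))"
  have "L (energy \<alpha>) \<nu>
      = - \<kappa> * fall_area \<nu> + (1 - \<beta> - \<alpha> * (\<kappa> + \<beta>)) * ?N + (1 - \<beta>) * (1 - p) * (1 + \<alpha>)"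
    unfolding generator_add_mult[OF \<nu>] generator_spread[OF \<nu>] generator_inversions[OF \<nu>] \<kappa>_def
    by (simp add: algebra_simps)
  also have "\<alpha> * (\<kappa> + \<beta>) = 2"
    using c(1) unfolding \<alpha>_def by (metis less_irrefl nonzero_eq_divide_eq)
  also have "(1 - \<beta> - 2) * ?N \<le> - 1 * ?N"
    using \<beta> by (intro mult_right_mono) auto
  also have "(1 - \<beta>) * (1 - p) * (1 + \<alpha>) \<le> 1 * (1 + \<alpha>)"
    using \<beta> p \<alpha> by (intro mult_right_mono mult_le_one) auto
  finally show "L (energy \<alpha>) \<nu> \<le> - \<kappa> * fall_area \<nu> - ?N + 1 + \<alpha>"
    by simp
qed

lemma linear_lyapunov:
  assumes p_gt: "1/2 < p" and \<beta>_lt: "\<beta> < 1"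
  obtains V D where "0 \<le> D" "\<And>\<nu>. inversions \<nu> \<le> V \<nu>"
    "\<And>\<nu>. V \<nu> \<le> D * (1 + spread \<nu> + inversions \<nu>)"
    "\<And>\<nu>. \<nu> \<in> configs - ground_configs \<Longrightarrow> V \<nu> \<le> D * fall_area \<nu> ^ 3"
    "\<And>\<nu>. \<nu> \<in> configs - ground_configs \<Longrightarrow> L V \<nu> \<le> - fall_area \<nu>"
proof -
  have d: "0 < down_rate"
    unfolding down_rate_def using \<beta> p_gt \<beta>_lt by (intro add_pos_nonneg mult_pos_pos) auto
  obtain \<kappa> \<alpha> where \<kappa>: "0 < \<kappa>" "\<kappa> \<le> 1" and \<alpha>: "2 \<le> \<alpha>"
    and drift: "\<And>\<nu>. \<nu> \<in> configs \<Longrightarrow> L (energy \<alpha>) \<nu> \<le> - \<kappa> * fall_area \<nu> - card (rises \<nu>) + 1 + \<alpha>"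
    using energy_drift[OF assms] by blast
  define F where "F = energy \<alpha>"
  have F_nonneg: "0 \<le> F \<nu>" and F_ge: "inversions \<nu> \<le> F \<nu>" for \<nu>
    using spread_nonneg[of \<nu>] inversions_nonneg[of \<nu>] \<alpha> mult_right_mono[of 1 \<alpha> "inversions \<nu>"] by (auto simp: F_def)
  \<comment> \<open>Scaling makes the drift - 2 \<open>fall_area\<close> plus a constant: one half
    is the claim, the other absorbs the constant once the zone is long. The \<open>0 +\<close> in
    the functions below fits \<open>generator_add_mult\<close>.\<close>
  define J where "J = 2 / \<kappa>"
  have J: "2 \<le> J" "J * \<kappa> = 2"
    using \<kappa> by (auto simp: J_def field_simps)
  have drift_U: "L (\<lambda>\<mu>. 0 + J * F \<mu>) \<nu> \<le> - 2 * fall_area \<nu> + J * (1 + \<alpha>)" if \<nu>: "\<nu> \<in> configs" for \<nu>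
  proof -
    have "L (\<lambda>\<mu>. 0 + J * F \<mu>) \<nu> = L (\<lambda>_. 0) \<nu> + J * L F \<nu>"
      by (rule generator_add_mult[OF \<nu>])
    also have "L (\<lambda>_. 0) \<nu> = 0"
      using generator_linear[OF \<nu>, of "\<lambda>_. 0" 1 "\<lambda>_. 0"] by simp
    also have "J * L F \<nu> \<le> J * (- \<kappa> * fall_area \<nu> + 1 + \<alpha>)"
      using drift[OF \<nu>] J unfolding F_def by (intro mult_left_mono) auto
    also have "\<dots> = - (J * \<kappa>) * fall_area \<nu> + J * (1 + \<alpha>)"
      by (simp add: algebra_simps)
    finally show ?thesis
      using J by simp
  qed
  have JA: "0 \<le> J * (1 + \<alpha>)"
    using J \<alpha> by simp
  have large: "L (\<lambda>\<mu>. 0 + J * F \<mu>) \<nu> \<le> - fall_area \<nu>"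
    if \<nu>: "\<nu> \<in> configs - ground_configs" and f: "(J * (1 + \<alpha>))\<^sup>2 \<le> inversions \<nu>" for \<nu>
  proof -
    obtain l r where "hybrid_zone \<nu> l r"
      using \<nu> by (rule ground_configs_hybrid_zone)
    then have "J * (1 + \<alpha>) \<le> fall_area \<nu>"
      using f JA by (rule hybrid_zone.inversions_ge_imp_fall_area_ge)
    then show ?thesis
      using drift_U[of \<nu>] \<nu> by simp
  qed
  have small: "L (\<lambda>\<mu>. 0 + J * F \<mu>) \<nu> + fall_area \<nu> \<le> J * (1 + \<alpha>)"
    if \<nu>: "\<nu> \<in> configs - ground_configs" and "inversions \<nu> < (J * (1 + \<alpha>))\<^sup>2" for \<nu>
  proof -
    obtain l r where "hybrid_zone \<nu> l r"
      using \<nu> by (rule ground_configs_hybrid_zone)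
    then have "2 \<le> fall_area \<nu>"
      by (rule hybrid_zone.fall_area_ge_2)
    then show ?thesis
      using drift_U[of \<nu>] \<nu> by simp
  qed
  obtain B where B: "0 \<le> B" "\<And>\<nu>. \<nu> \<in> configs - ground_configs \<Longrightarrow>
    L (\<lambda>\<mu>. 0 + J * F \<mu> + B * barrier \<mu>) \<nu> \<le> - fall_area \<nu> - exp (- ln (4 / down_rate) * inversions \<nu>)"
    using barrier_absorbs[OF d large small] by blast
  define V where "V = (\<lambda>\<mu>. 0 + J * F \<mu> + B * barrier \<mu>)"
  define D where "D = (J + B) * (2 + \<alpha>)"
  have B_barrier: "0 \<le> B * barrier \<nu>" "B * barrier \<nu> \<le> B" for \<nu>
    using B(1) barrier_bounds[OF d, of \<nu>] by (auto simp: mult_left_le)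
  have V_le: "V \<nu> \<le> (J + B) * (1 + F \<nu>)" for \<nu>
  proof -
    have "B * 1 \<le> B * (1 + F \<nu>)"
      using B(1) F_nonneg[of \<nu>] by (intro mult_left_mono) auto
    then show ?thesis
      using B_barrier[of \<nu>] J by (simp add: V_def algebra_simps)
  qed
  show thesis
  proof (rule that[of D V])
    show "0 \<le> D"
      using J B \<alpha> by (simp add: D_def)
    fix \<nu>
    have "1 * F \<nu> \<le> J * F \<nu>"
      using J F_nonneg[of \<nu>] by (intro mult_right_mono) auto
    then show "inversions \<nu> \<le> V \<nu>"
      using F_ge[of \<nu>] B_barrier[of \<nu>] by (simp add: V_def)
    have "1 + F \<nu> \<le> (2 + \<alpha>) * (1 + spread \<nu> + inversions \<nu>)"
      using \<alpha> spread_nonneg[of \<nu>] inversions_nonneg[of \<nu>] by (simp add: F_def algebra_simps add_increasing)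
    then have "(J + B) * (1 + F \<nu>) \<le> (J + B) * ((2 + \<alpha>) * (1 + spread \<nu> + inversions \<nu>))"
      using J B by (intro mult_left_mono) auto
    then show "V \<nu> \<le> D * (1 + spread \<nu> + inversions \<nu>)"
      using V_le[of \<nu>] by (simp add: D_def mult.assoc)
    assume \<nu>: "\<nu> \<in> configs - ground_configs"
    then obtain l r where "hybrid_zone \<nu> l r"
      by (rule ground_configs_hybrid_zone)
    then interpret hybrid_zone \<nu> l r .
    have "F \<nu> \<le> (1 + \<alpha>) * (m + n) ^ 3"
      unfolding F_def using \<alpha> by (intro zone_energy_le) auto
    also have "\<dots> \<le> (1 + \<alpha>) * fall_area \<nu> ^ 3"
      using \<alpha> m_pos n_pos fall_area_ge by (intro mult_left_mono power_mono) auto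
    finally have "F \<nu> \<le> (1 + \<alpha>) * fall_area \<nu> ^ 3" .
    moreover have "1 \<le> fall_area \<nu> ^ 3"
      using fall_area_ge_2 by (intro one_le_power) simp
    ultimately have "1 + F \<nu> \<le> (2 + \<alpha>) * fall_area \<nu> ^ 3"
      by (simp add: algebra_simps)
    then have "(J + B) * (1 + F \<nu>) \<le> (J + B) * ((2 + \<alpha>) * fall_area \<nu> ^ 3)"
      using J B by (intro mult_left_mono) auto
    then show "V \<nu> \<le> D * fall_area \<nu> ^ 3"
      using V_le[of \<nu>] by (simp add: D_def mult.assoc)
    show "L V \<nu> \<le> - fall_area \<nu>"
      using B(2)[OF \<nu>] exp_gt_zero[of "- ln (4 / down_rate) * inversions \<nu>"] unfolding V_def by linarith
  qed
qed

text \<open>With swaps only, an increment of the energy is at most of the order of the zone length,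
  and the spread is at least an eighth of its square; adding a large \<open>A\<close> thus makes all
  relative increments small, and the second-order term of the power is absorbed by the drift. Voter
  flips lack this property: with a single zero in the zone, one flip removes the whole
  spread.\<close>

lemma exclusion_power_drift:
  assumes p_gt: "1/2 < p" and \<beta>_eq: "\<beta> = 0"
  obtains \<kappa> \<alpha> A where "0 < \<kappa>" "2 \<le> \<alpha>" "1 \<le> A"
    "\<forall>\<nu>\<in>configs - ground_configs.
      L (\<lambda>\<mu>. (energy \<alpha> \<mu> + A) ^ Suc k) \<nu>
        \<le> (energy \<alpha> \<nu> + A) ^ k * ((real k + 1) * (1 + \<alpha> - \<kappa> * fall_area \<nu>))"
proof -
  obtain \<kappa> \<alpha> where \<kappa>: "0 < \<kappa>" "\<kappa> \<le> 1" and \<alpha>: "2 \<le> \<alpha>"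
    and drift: "\<And>\<nu>. \<nu> \<in> configs \<Longrightarrow> L (energy \<alpha>) \<nu> \<le> - \<kappa> * fall_area \<nu> - card (rises \<nu>) + 1 + \<alpha>"
    using energy_drift[OF p_gt] \<beta>_eq by auto
  define F where "F = energy \<alpha>"
  \<comment> \<open>Two smallness conditions: 2 q \<open>fall_area\<close> may use up only half of
    \<kappa> \<open>fall_area\<close>, and 3 q (1 + \<alpha>) N at most the term N. Dividing by 3 ^
    Suc k in \<eta> cancels the constant of \<open>power_Suc_increment\<close>.\<close>
  define q where "q = min (\<kappa> / 4) (1 / (3 * (1 + \<alpha>)))"
  define \<eta> where "\<eta> = q / 3 ^ Suc k"
  have q: "0 < q" "q \<le> \<kappa> / 4" "q * (3 * (1 + \<alpha>)) \<le> 1"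
  proof -
    show "0 < q" "q \<le> \<kappa> / 4"
      using \<kappa> \<alpha> by (auto simp: q_def)
    have "q \<le> 1 / (3 * (1 + \<alpha>))"
      by (simp add: q_def)
    then show "q * (3 * (1 + \<alpha>)) \<le> 1"
      using \<alpha> by (subst (asm) pos_le_divide_eq) auto
  qed
  have \<eta>: "0 < \<eta>" "\<eta> \<le> 1" "3 ^ Suc k * \<eta> = q"
  proof -
    show "0 < \<eta>" "3 ^ Suc k * \<eta> = q"
      using q by (auto simp: \<eta>_def)
    have "(1::real) \<le> 3 ^ Suc k"
      by (rule one_le_power) simp
    then have "\<eta> \<le> q / 1"
      unfolding \<eta>_def using q by (intro divide_left_mono) auto
    then show "\<eta> \<le> 1"
      using q \<kappa> by simp
  qed
  \<comment> \<open>\<eta> A covers 2 / \<eta> and 1 + \<alpha>; the former is what remains when m +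
    n is bounded by \<eta> (m + n)^2 / 8 by completing the square.\<close>
  define A where "A = 2 / \<eta>\<^sup>2 + (1 + \<alpha>) / \<eta> + 1"
  have A: "1 \<le> A"
    using \<eta> \<alpha> by (simp add: A_def)
  show thesis
  proof (rule that[of "\<kappa> / 2" \<alpha> A])
    show "0 < \<kappa> / 2" "2 \<le> \<alpha>" "1 \<le> A"
      using \<kappa> \<alpha> A by auto
  next
    show "\<forall>\<nu>\<in>configs - ground_configs.
      L (\<lambda>\<mu>. (energy \<alpha> \<mu> + A) ^ Suc k) \<nu>
        \<le> (energy \<alpha> \<nu> + A) ^ k * ((real k + 1) * (1 + \<alpha> - \<kappa> / 2 * fall_area \<nu>))"
    proof
    fix \<nu> assume \<nu>: "\<nu> \<in> configs - ground_configs"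
    then obtain l r where "hybrid_zone \<nu> l r"
      by (rule ground_configs_hybrid_zone)
    then interpret hybrid_zone \<nu> l r .
    note w = wide_window
    let ?N = "real (card (rises \<nu>))"
    let ?g = "\<lambda>x. zeros_upto \<nu> x + ones_above \<nu> x"
    let ?D = "\<lambda>x. ?g x + (1 + \<alpha>)"
    define X where "X = F \<nu> + A"
    define U where "U = (\<lambda>\<mu>. (F \<mu> + A) ^ Suc k)"
    have X: "0 < X"
      using spread_nonneg[of \<nu>] inversions_nonneg[of \<nu>] \<alpha> A by (auto simp: X_def F_def intro!: add_nonneg_pos)
    have zone: "m + n + (1 + \<alpha>) \<le> \<eta> * X"
    proof -
      have "(m + n)\<^sup>2 / 8 \<le> spread \<nu>"
      proof -
        have "(m + n)\<^sup>2 \<le> 2 * m\<^sup>2 + 2 * n\<^sup>2"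
          using sum_squares_bound[of m n] by (simp add: power2_sum)
        moreover have "m\<^sup>2 \<le> 2 * spread \<nu>" "n\<^sup>2 \<le> 2 * spread \<nu>"
          using right_area_bounds(1,2) left_area_bounds(1,2) m_pos n_pos by (auto simp: power2_eq_square field_simps)
        ultimately show ?thesis
          by simp
      qed
      also have "spread \<nu> \<le> F \<nu>"
        using \<alpha> inversions_nonneg[of \<nu>] by (simp add: F_def)
      finally have "\<eta> * ((m + n)\<^sup>2 / 8) \<le> \<eta> * F \<nu>"
        using \<eta> by (intro mult_left_mono) auto
      moreover have "m + n \<le> \<eta> * ((m + n)\<^sup>2 / 8) + 2 / \<eta>"
      proof -
        have "0 \<le> (\<eta> * (m + n) - 4)\<^sup>2 / (8 * \<eta>)"
          using \<eta> by simp
        also have "\<dots> = \<eta> * ((m + n)\<^sup>2 / 8) + 2 / \<eta> - (m + n)"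
          using \<eta> by (simp add: power2_diff field_simps power2_eq_square)
        finally show ?thesis by simp
      qed
      moreover have "\<eta> * A = 2 / \<eta> + (1 + \<alpha>) + \<eta>"
      proof -
        have "\<eta> * A = \<eta> * (2 / \<eta>\<^sup>2) + \<eta> * ((1 + \<alpha>) / \<eta>) + \<eta> * 1"
          by (simp only: A_def distrib_left)
        moreover have "\<eta> * (2 / \<eta>\<^sup>2) = 2 / \<eta>" "\<eta> * ((1 + \<alpha>) / \<eta>) = 1 + \<alpha>"
          using \<eta>(1) by (simp_all only: power2_eq_square) (simp_all add: divide_simps)
        ultimately show ?thesis by simp
      qed
      ultimately show ?thesis
        unfolding X_def distrib_left using \<eta>(1) by linarith
    qed
    have increment: "U (swap x \<nu>) - U \<nu> \<le> X ^ k * ((real k + 1) * (F (swap x \<nu>) - F \<nu>) + q * ?D x)"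
      if x: "x \<in> falls \<nu> \<union> rises \<nu>" for x
    proof -
      have xw: "l - 1 < x" "x + 1 < r + 2"
        using boundary_inside[OF x] by auto
      define t where "t = F (swap x \<nu>) - F \<nu>"
      have g_ge: "0 \<le> ?g x"
        using zeros_upto_nonneg[of \<nu> x] ones_above_nonneg[of \<nu> x] by simp
      have t: "\<bar>t\<bar> \<le> ?D x"
      proof (cases "x \<in> falls \<nu>")
        case True
        show ?thesis
          using swap_fall[OF w xw True] g_ge \<alpha> by (simp add: t_def F_def distrib_left)
      next
        case False
        with x have "x \<in> rises \<nu>"
          by simp
        then have "t = - (?g x - 1 + \<alpha>)"
          using swap_rise[OF w xw] by (simp add: t_def F_def right_diff_distrib)
        then show ?thesis
          using g_ge \<alpha> by simp
      qed
      also have "?D x \<le> \<eta> * X"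
        using boundary_height[OF x] zone by simp
      finally have "(X + t) ^ Suc k - X ^ Suc k \<le> X ^ k * ((real k + 1) * t + 3 ^ Suc k * \<eta> * \<bar>t\<bar>)"
        by (intro power_Suc_increment X \<eta>)
      also have "\<dots> = X ^ k * ((real k + 1) * t + q * \<bar>t\<bar>)"
        unfolding \<eta>(3) ..
      also have "\<dots> \<le> X ^ k * ((real k + 1) * t + q * ?D x)"
        using X q t by (intro mult_left_mono add_left_mono) auto
      finally have "(X + t) ^ Suc k - X ^ Suc k \<le> X ^ k * ((real k + 1) * t + q * ?D x)" .
      moreover have "X + t = F (swap x \<nu>) + A"
        by (simp add: X_def t_def)
      ultimately show ?thesis
        by (simp only: U_def X_def[symmetric] t_def)
    qed
    have bound: "s * (U (swap x \<nu>) - U \<nu>)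
        \<le> X ^ k * ((real k + 1) * (s * (F (swap x \<nu>) - F \<nu>)) + q * ?D x)"
      if x: "x \<in> falls \<nu> \<union> rises \<nu>" and s: "0 \<le> s" "s \<le> 1" for x s
    proof -
      have D: "0 \<le> ?D x"
        using zeros_upto_nonneg[of \<nu> x] ones_above_nonneg[of \<nu> x] \<alpha> by simp
      have "s * (U (swap x \<nu>) - U \<nu>) \<le> s * (X ^ k * ((real k + 1) * (F (swap x \<nu>) - F \<nu>) + q * ?D x))"
        using s by (intro mult_left_mono increment x) auto
      also have "\<dots> = X ^ k * ((real k + 1) * (s * (F (swap x \<nu>) - F \<nu>)) + s * (q * ?D x))"
        by (simp add: algebra_simps)
      also have "\<dots> \<le> X ^ k * ((real k + 1) * (s * (F (swap x \<nu>) - F \<nu>)) + 1 * (q * ?D x))"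
        using X q s D by (intro mult_left_mono add_left_mono mult_right_mono) auto
      finally show ?thesis by simp
    qed
    have LF: "L F \<nu> = (\<Sum>x\<in>falls \<nu>. (1 - p) * (F (swap x \<nu>) - F \<nu>))
        + (\<Sum>x\<in>rises \<nu>. p * (F (swap x \<nu>) - F \<nu>))" for F
      unfolding generator_eq[OF w] \<beta>_eq by simp
    have "L U \<nu> \<le> (\<Sum>x\<in>falls \<nu>. X ^ k * ((real k + 1) * ((1 - p) * (F (swap x \<nu>) - F \<nu>)) + q * ?D x))
        + (\<Sum>x\<in>rises \<nu>. X ^ k * ((real k + 1) * (p * (F (swap x \<nu>) - F \<nu>)) + q * ?D x))"
      unfolding LF using p by (intro add_mono sum_mono bound) auto
    also have "\<dots> = X ^ k * ((real k + 1) * L F \<nu> + q * (sum ?D (falls \<nu>) + sum ?D (rises \<nu>)))"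
      unfolding LF sum_distrib_left[symmetric] sum.distrib distrib_left[symmetric] by (simp add: algebra_simps)
    also have "\<dots> \<le> X ^ k * ((real k + 1) * (1 + \<alpha> - \<kappa> / 2 * fall_area \<nu>))"
    proof (rule mult_left_mono)
      have sums: "sum ?D S = sum ?g S + card S * (1 + \<alpha>)" for S
        by (subst sum.distrib) simp
      have "sum ?D (falls \<nu>) + sum ?D (rises \<nu>) = 2 * fall_area \<nu> + (2 * ?N + 1) * (1 + \<alpha>)"
        unfolding sums fall_area_def sum_falls_eq_sum_rises[OF w, symmetric] card_falls[OF w]
        by (simp add: algebra_simps)
      also have "\<dots> \<le> 2 * fall_area \<nu> + (3 * ?N) * (1 + \<alpha>)"
        using rises_pos \<alpha> by (intro add_left_mono mult_right_mono) auto
      finally have "q * (sum ?D (falls \<nu>) + sum ?D (rises \<nu>))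
          \<le> q * (2 * fall_area \<nu> + (3 * ?N) * (1 + \<alpha>))"
        using q by (intro mult_left_mono) auto
      also have "\<dots> = q * (2 * fall_area \<nu>) + q * (3 * (1 + \<alpha>)) * ?N"
        by (simp add: algebra_simps)
      also have "\<dots> \<le> \<kappa> / 4 * (2 * fall_area \<nu>) + 1 * ?N"
        using q fall_area_ge_2 by (intro add_mono mult_right_mono) auto
      also have "\<dots> \<le> (real k + 1) * (\<kappa> / 4 * (2 * fall_area \<nu>) + 1 * ?N)"
        using mult_right_mono[of 1 "real k + 1" "\<kappa> / 4 * (2 * fall_area \<nu>)
            + 1 * ?N"] \<kappa> fall_area_ge_2 by simp
      finally have "q * (sum ?D (falls \<nu>) + sum ?D (rises \<nu>))
          \<le> (real k + 1) * (\<kappa> / 4 * (2 * fall_area \<nu>) + 1 * ?N)" .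
      moreover have "(real k + 1) * L F \<nu> \<le> (real k + 1) * (- \<kappa> * fall_area \<nu> - ?N + 1 + \<alpha>)"
        using drift[of \<nu>] \<nu> unfolding F_def by (intro mult_left_mono) auto
      moreover have "(real k + 1) * (\<kappa> / 4 * (2 * fall_area \<nu>) + 1 * ?N)
          + (real k + 1) * (- \<kappa> * fall_area \<nu> - ?N + 1 + \<alpha>)
          = (real k + 1) * (1 + \<alpha> - \<kappa> / 2 * fall_area \<nu>)"
        by (simp add: field_simps)
      ultimately show "(real k + 1) * L F \<nu> + q * (sum ?D (falls \<nu>) + sum ?D (rises \<nu>))
          \<le> (real k + 1) * (1 + \<alpha> - \<kappa> / 2 * fall_area \<nu>)"
        by linarith
    qed (use X in simp)
    finally show "L (\<lambda>\<mu>. (energy \<alpha> \<mu> + A) ^ Suc k) \<nu>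
        \<le> (energy \<alpha> \<nu> + A) ^ k * ((real k + 1) * (1 + \<alpha> - \<kappa> / 2 * fall_area \<nu>))"
      by (simp only: U_def X_def F_def)
    qed
  qed
qed

lemma power_lyapunov:
  assumes p_gt: "1/2 < p" and \<beta>_eq: "\<beta> = 0" and c: "0 \<le> c"
  obtains V D where "0 \<le> D" "\<And>\<nu>. inversions \<nu> \<le> V \<nu>"
    "\<And>\<nu>. V \<nu> \<le> D * (1 + spread \<nu> + inversions \<nu>) ^ Suc k"
    "\<And>\<nu>. \<nu> \<in> configs - ground_configs \<Longrightarrow> L V \<nu> \<le> - (c * (1 + spread \<nu> + inversions \<nu>) ^ k)"
proof -
  have d: "0 < down_rate"
    unfolding down_rate_def using p_gt \<beta>_eq by simp
  obtain \<kappa> \<alpha> A where \<kappa>: "0 < \<kappa>" and \<alpha>: "2 \<le> \<alpha>" and A: "1 \<le> A"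
    and drift: "\<forall>\<nu>\<in>configs - ground_configs.
      L (\<lambda>\<mu>. (energy \<alpha> \<mu> + A) ^ Suc k) \<nu>
        \<le> (energy \<alpha> \<nu> + A) ^ k * ((real k + 1) * (1 + \<alpha> - \<kappa> * fall_area \<nu>))"
    by (rule exclusion_power_drift[OF p_gt \<beta>_eq, where k = k])
  define F where "F = energy \<alpha>"
  define U where "U = (\<lambda>\<mu>. (F \<mu> + A) ^ Suc k)"
  define W where "W = (\<lambda>\<mu>. 1 + spread \<mu> + inversions \<mu>)"
  have alpha_inv: "1 * inversions \<nu> \<le> \<alpha> * inversions \<nu>" for \<nu>
    using \<alpha> inversions_nonneg[of \<nu>] by (intro mult_right_mono) auto
  have W: "1 \<le> W \<nu>" "W \<nu> \<le> F \<nu> + A" "F \<nu> + A \<le> (A + \<alpha>) * W \<nu>" for \<nu>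
  proof -
    show "1 \<le> W \<nu>" "W \<nu> \<le> F \<nu> + A"
      using spread_nonneg[of \<nu>] inversions_nonneg[of \<nu>] alpha_inv[of \<nu>] A by (auto simp: W_def F_def)
    have "0 \<le> (A + \<alpha> - 1) * spread \<nu>" "0 \<le> A * inversions \<nu>"
      using spread_nonneg[of \<nu>] inversions_nonneg[of \<nu>] A \<alpha> by auto
    then show "F \<nu> + A \<le> (A + \<alpha>) * W \<nu>"
      using \<alpha> by (simp add: W_def F_def algebra_simps)
  qed
  define G where "G = (1 + \<alpha> + c) / \<kappa>"
  have G: "0 \<le> G" "\<kappa> * G = 1 + \<alpha> + c"
    using \<kappa> \<alpha> c by (auto simp: G_def)
  \<comment> \<open>If f < G^2, then m and n are below G^2, so the cubic bound on the energy makes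
    \<open>M\<close> an upper bound of F + A.\<close>
  define M where "M = (1 + \<alpha>) * (2 * G\<^sup>2) ^ 3 + A"
  have large: "L U \<nu> \<le> - (c * W \<nu> ^ k)" if \<nu>: "\<nu> \<in> configs - ground_configs" and f: "G\<^sup>2
      \<le> inversions \<nu>" for \<nu>
  proof -
    obtain l r where "hybrid_zone \<nu> l r"
      using \<nu> by (rule ground_configs_hybrid_zone)
    then have "G \<le> fall_area \<nu>"
      using f G(1) by (rule hybrid_zone.inversions_ge_imp_fall_area_ge)
    then have "\<kappa> * G \<le> \<kappa> * fall_area \<nu>"
      using \<kappa> by (intro mult_left_mono) auto
    then have "(real k + 1) * (1 + \<alpha> - \<kappa> * fall_area \<nu>) \<le> (real k + 1) * (- c)"
      using G by (intro mult_left_mono) auto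
    also have "\<dots> \<le> 1 * (- c)"
      using c by (intro mult_right_mono_neg) auto
    finally have "(F \<nu> + A) ^ k * ((real k + 1) * (1 + \<alpha> - \<kappa> * fall_area \<nu>))
        \<le> (F \<nu> + A) ^ k * (1 * (- c))"
      using W[of \<nu>] by (intro mult_left_mono) auto
    also have "\<dots> \<le> W \<nu> ^ k * (1 * (- c))"
      using W[of \<nu>] c by (intro mult_right_mono_neg power_mono) auto
    finally show ?thesis
      using bspec[OF drift \<nu>] by (simp add: U_def F_def mult.commute)
  qed
  have small: "L U \<nu> + c * W \<nu> ^ k \<le> M ^ k * ((real k + 1) * (1 + \<alpha>) + c)"
    if \<nu>: "\<nu> \<in> configs - ground_configs" and f: "inversions \<nu> < G\<^sup>2" for \<nu>
  proof -
    obtain l r where "hybrid_zone \<nu> l r"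
      using \<nu> by (rule ground_configs_hybrid_zone)
    then interpret hybrid_zone \<nu> l r .
    have "F \<nu> \<le> (1 + \<alpha>) * (m + n) ^ 3"
      unfolding F_def using \<alpha> by (intro zone_energy_le) auto
    also have "\<dots> \<le> (1 + \<alpha>) * (2 * G\<^sup>2) ^ 3"
      using zone_le_inversions f m_pos n_pos \<alpha> by (intro mult_left_mono power_mono) auto
    finally have FM: "F \<nu> + A \<le> M"
      by (simp add: M_def)
    have "L U \<nu> \<le> (F \<nu> + A) ^ k * ((real k + 1) * (1 + \<alpha> - \<kappa> * fall_area \<nu>))"
      using bspec[OF drift \<nu>] by (simp add: U_def F_def)
    also have "\<dots> \<le> (F \<nu> + A) ^ k * ((real k + 1) * (1 + \<alpha>))"
      using W[of \<nu>] \<kappa> fall_area_ge_2 by (intro mult_left_mono) auto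
    finally have "L U \<nu> + c * W \<nu> ^ k \<le> (F \<nu> + A) ^ k * ((real k + 1) * (1 + \<alpha>)) + c * (F \<nu> + A) ^ k"
      using W[of \<nu>] c by (intro add_mono mult_left_mono power_mono) auto
    also have "\<dots> = (F \<nu> + A) ^ k * ((real k + 1) * (1 + \<alpha>) + c)"
      by (simp add: algebra_simps)
    also have "\<dots> \<le> M ^ k * ((real k + 1) * (1 + \<alpha>) + c)"
      using W[of \<nu>] FM \<alpha> c by (intro mult_right_mono power_mono) auto
    finally show ?thesis .
  qed
  obtain B where B: "0 \<le> B" "\<And>\<nu>. \<nu> \<in> configs - ground_configs \<Longrightarrow>
    L (\<lambda>\<mu>. U \<mu> + B * barrier \<mu>) \<nu> \<le> - (c * W \<nu> ^ k) - exp (- ln (4 / down_rate) * inversions \<nu>)"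
    using barrier_absorbs[OF d large small] by blast
  define V where "V = (\<lambda>\<mu>. U \<mu> + B * barrier \<mu>)"
  have B_barrier: "0 \<le> B * barrier \<nu>" "B * barrier \<nu> \<le> B" for \<nu>
    using B(1) barrier_bounds[OF d, of \<nu>] by (auto simp: mult_left_le)
  show thesis
  proof (rule that[of "(A + \<alpha>) ^ Suc k + B" V])
    show "0 \<le> (A + \<alpha>) ^ Suc k + B"
      using A \<alpha> B by simp
    fix \<nu>
    have "inversions \<nu> \<le> F \<nu> + A"
      using W(2)[of \<nu>] spread_nonneg[of \<nu>] by (simp add: W_def)
    also have "\<dots> \<le> U \<nu>"
      unfolding U_def using W[of \<nu>] by (intro self_le_power) auto
    finally show "inversions \<nu> \<le> V \<nu>"
      using B_barrier[of \<nu>] by (simp add: V_def)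
    have "U \<nu> \<le> (A + \<alpha>) ^ Suc k * W \<nu> ^ Suc k"
      unfolding U_def power_mult_distrib[symmetric] using W[of \<nu>] by (intro power_mono) auto
    moreover have "B * 1 \<le> B * W \<nu> ^ Suc k"
      using W[of \<nu>] B by (intro mult_left_mono one_le_power) auto
    ultimately have "V \<nu> \<le> ((A + \<alpha>) ^ Suc k + B) * W \<nu> ^ Suc k"
      using B_barrier[of \<nu>] unfolding V_def distrib_right[of _ B] by linarith
    then show "V \<nu> \<le> ((A + \<alpha>) ^ Suc k + B) * (1 + spread \<nu> + inversions \<nu>) ^ Suc k"
      by (simp only: W_def)
    assume "\<nu> \<in> configs - ground_configs"
    then show "L V \<nu> \<le> - (c * (1 + spread \<nu> + inversions \<nu>) ^ k)"
      using B(2)[of \<nu>] exp_gt_zero[of "- ln (4 / down_rate)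
          * inversions \<nu>"] unfolding V_def W_def by linarith
  qed
qed

end

section \<open>From drift inequalities to recurrence and moments\<close>

locale exclusion_voter_semigroup =
  exclusion_voter \<beta> p + taboo_semigroup configs K ground_configs for \<beta> p K +
  assumes has_generator_K: "has_generator configs K (exclusion_voter_generator \<beta> p)"
begin

sublocale taboo_generator configs K ground_configs L rate
  using has_generator_K generator_linear generator_rate_bound by unfold_locales auto

lemma rate_bounded:
  assumes "\<And>\<nu>. inversions \<nu> \<le> V \<nu>"
  shows "\<exists>Q. \<forall>\<nu>\<in>configs. V \<nu> \<le> c \<longrightarrow> rate \<nu> \<le> Q"
proof (intro exI ballI impI)
  fix \<nu> assume "\<nu> \<in> configs" "V \<nu> \<le> c"
  then show "rate \<nu> \<le> 2 * c + 1"
    using rate_le[of \<nu>] assms[of \<nu>] by simp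
qed

lemma recurrent:
  assumes "4/7 \<le> \<beta>" and \<nu>: "\<nu> \<in> configs"
  shows "(INF k::nat. survival (real k) \<nu>) = 0"
proof -
  obtain V where V: "\<And>\<nu>. 0 \<le> V \<nu>" "\<And>\<nu>. ln (1 + inversions \<nu>) \<le> V \<nu>"
    and drift: "\<And>c. \<exists>\<eta>>0. \<forall>\<nu>\<in>configs. \<nu> \<notin> ground_configs \<longrightarrow> V \<nu> \<le> c \<longrightarrow> L V \<nu> \<le> - \<eta>"
    using recurrence_lyapunov[OF assms(1)] by blast
  show ?thesis
  proof (rule survival_tendsto_0[OF V(1) _ drift \<nu>])
    fix c
    have "rate \<nu> \<le> 2 * exp c + 1" if "\<nu> \<in> configs" "V \<nu> \<le> c" for \<nu>
    proof -
      have "exp (ln (1 + inversions \<nu>)) \<le> exp c"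
        using V(2)[of \<nu>] that by (subst exp_le_cancel_iff) simp
      then show ?thesis
        using rate_le[OF that(1)] inversions_nonneg[of \<nu>] by simp
    qed
    then show "\<exists>Q. \<forall>\<nu>\<in>configs. V \<nu> \<le> c \<longrightarrow> rate \<nu> \<le> Q"
      by blast
  qed
qed

text \<open>Raising the order by one raises the power by one: if the previous moment is at most D0 W
  ^ Suc k, with W = 1 + spread + inversions, the new source term is at most c W ^ Suc k, and
  \<open>power_lyapunov\<close> supplies a function of order W ^ Suc (Suc k) with this
  drift.\<close>

lemma exclusion_moment:
  assumes p_gt: "1/2 < p" and \<beta>_eq: "\<beta> = 0"
  shows "\<exists>D\<ge>0. \<forall>\<nu>\<in>configs. moment (real k) \<nu> \<le> ennreal (D * (1 + spread \<nu> + inversions \<nu>) ^ Suc k)"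
proof (induction k)
  case 0
  obtain V D where V: "0 \<le> D" "\<And>\<nu>. inversions \<nu> \<le> V \<nu>"
    "\<And>\<nu>. V \<nu> \<le> D * (1 + spread \<nu> + inversions \<nu>) ^ Suc 0"
    "\<And>\<nu>. \<nu> \<in> configs - ground_configs \<Longrightarrow> L V \<nu> \<le> - (1 * (1 + spread \<nu> + inversions \<nu>) ^ 0)"
    using power_lyapunov[OF p_gt \<beta>_eq, of 1 0] by (metis zero_le_one)
  have "moment (real 0) \<nu>
      \<le> ennreal (D * (1 + spread \<nu> + inversions \<nu>) ^ Suc 0)" if \<nu>: "\<nu> \<in> configs" for \<nu>
  proof -
    have "moment 0 \<nu> \<le> ennreal (V \<nu>)"
      by (rule moment_le[where g = "\<lambda>_. 1", OF _ _ rate_bounded])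
        (use V \<nu> order_trans[OF inversions_nonneg V(2)] in auto)
    also have "\<dots> \<le> ennreal (D * (1 + spread \<nu> + inversions \<nu>) ^ Suc 0)"
      by (rule ennreal_leI) (rule V)
    finally show ?thesis by simp
  qed
  then show ?case
    using V(1) by blast
next
  case (Suc k)
  then obtain D0 where D0: "0 \<le> D0" "\<And>\<nu>. \<nu> \<in> configs \<Longrightarrow>
      moment (real k) \<nu> \<le> ennreal (D0 * (1 + spread \<nu> + inversions \<nu>) ^ Suc k)"
    by blast
  define c where "c = 2 powr real (Suc k) + 2 * real (Suc k) * D0"
  have c: "0 \<le> c"
    using D0 by (simp add: c_def)
  define W where "W = (\<lambda>\<nu>. 1 + spread \<nu> + inversions \<nu>)"
  have W: "1 \<le> W \<nu>" for \<nu>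
    using spread_nonneg[of \<nu>] inversions_nonneg[of \<nu>] by (simp add: W_def)
  obtain V D where V: "0 \<le> D" "\<And>\<nu>. inversions \<nu> \<le> V \<nu>"
    "\<And>\<nu>. V \<nu> \<le> D * W \<nu> ^ Suc (Suc k)"
    "\<And>\<nu>. \<nu> \<in> configs - ground_configs \<Longrightarrow> L V \<nu> \<le> - (c * W \<nu> ^ Suc k)"
    using power_lyapunov[OF p_gt \<beta>_eq c, of "Suc k"] unfolding W_def by metis
  have "moment (real (Suc k)) \<nu> \<le> ennreal (D * W \<nu> ^ Suc (Suc k))" if \<nu>: "\<nu> \<in> configs" for \<nu>
  proof -
    have "moment (real (Suc k)) \<nu> \<le> ennreal (V \<nu>)"
    proof (rule moment_le[where g = "\<lambda>\<nu>. c * W \<nu> ^ Suc k", OF _ _ rate_bounded[OF V(2)] _ _ \<nu>])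
      fix \<mu> assume \<mu>: "\<mu> \<in> configs"
      show "0 \<le> V \<mu>"
        using V(2)[of \<mu>] inversions_nonneg[of \<mu>] by simp
      have "ennreal (2 powr real (Suc k)) + ennreal (2 * real (Suc k)) * moment (real (Suc k) - 1) \<mu>
          \<le> ennreal (2 powr real (Suc k) * W \<mu> ^ Suc k) + ennreal (2 * real (Suc k)) * ennreal (D0 * W \<mu> ^ Suc k)"
      proof (intro add_mono mult_left_mono ennreal_leI)
        have "2 powr real (Suc k) * 1 \<le> 2 powr real (Suc k) * W \<mu> ^ Suc k"
          using W[of \<mu>] by (intro mult_left_mono one_le_power) auto
        then show "2 powr real (Suc k) \<le> 2 powr real (Suc k) * W \<mu> ^ Suc k" by simp
        show "moment (real (Suc k) - 1) \<mu> \<le> ennreal (D0 * W \<mu> ^ Suc k)"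
          using D0(2)[OF \<mu>] by (simp add: W_def)
      qed auto
      also have "\<dots> = ennreal (2 powr real (Suc k) * W \<mu> ^ Suc k
          + 2 * real (Suc k) * (D0 * W \<mu> ^ Suc k))"
        using D0(1) W[of \<mu>] by (subst ennreal_plus) (auto simp: ennreal_mult)
      also have "2 powr real (Suc k) * W \<mu> ^ Suc k + 2 * real (Suc k) * (D0 * W \<mu> ^ Suc k)
          = c * W \<mu> ^ Suc k"
        unfolding c_def by (simp only: distrib_right mult.assoc)
      finally show "ennreal (2 powr real (Suc k))
          + ennreal (2 * real (Suc k)) * moment (real (Suc k) - 1) \<mu>
          \<le> ennreal (c * W \<mu> ^ Suc k)" .
    qed (use V(4) in auto)
    also have "\<dots> \<le> ennreal (D * W \<nu> ^ Suc (Suc k))"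
      by (rule ennreal_leI) (rule V)
    finally show ?thesis .
  qed
  then show ?case
    using V(1) unfolding W_def by blast
qed

text \<open>The source term involves the index -4/5, which interpolation bounds by the power 1/5 of
  any bound on \<open>moment 0\<close>. At \<beta> = 1 that bound is f, and the spread supplies the
  drift f^(1/5). For \<beta> < 1 it is \<open>V\<close>, at most cubic in \<open>fall_area\<close>,
  so its fifth root is dominated by the linear drift.\<close>

lemma moment_one_fifth:
  assumes p_gt: "1/2 < p"
  shows "\<exists>D\<ge>0. \<forall>\<nu>\<in>configs. moment (1/5) \<nu> \<le> ennreal (D * (1 + spread \<nu> + inversions \<nu>))"
proof -
  have small: "ennreal (2 powr (1/5)) + ennreal (2 * (1/5)) * moment (1/5 - 1) \<nu>
      \<le> ennreal (2 + 3 * (1 + x) powr (1/5))"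
    if "moment 0 \<nu> \<le> ennreal x" "0 \<le> x" for x \<nu>
  proof -
    have "ennreal (2 powr (1/5)) + ennreal (2 * (1/5)) * moment (1/5 - 1) \<nu>
        \<le> ennreal 2 + ennreal (2 * (1/5)) * ennreal ((1 / (1/5) + 1) * (1 + x) powr (1/5))"
    proof (intro add_mono mult_left_mono ennreal_leI)
      show "2 powr (1/5) \<le> (2::real)"
        using powr_mono[of "1/5" 1 "2::real"] by simp
      show "moment (1/5 - 1) \<nu> \<le> ennreal ((1 / (1/5) + 1) * (1 + x) powr (1/5))"
        using that by (intro moment_interpolate) auto
    qed auto
    also have "\<dots> = ennreal (2 + 12/5 * (1 + x) powr (1/5))"
      by (simp add: ennreal_mult[symmetric] ennreal_plus[symmetric] del: ennreal_plus ennreal_numeral)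
    also have "\<dots> \<le> ennreal (2 + 3 * (1 + x) powr (1/5))"
      by (intro ennreal_leI) simp
    finally show ?thesis .
  qed
  show ?thesis
  proof (cases "\<beta> = 1")
    case True
    have first: "moment 0 \<nu> \<le> ennreal (inversions \<nu>)" if "\<nu> \<in> configs" for \<nu>
    proof (rule moment_le[where g = "\<lambda>_. 1", OF _ _ rate_bounded _ _ that])
      fix \<mu> assume \<mu>: "\<mu> \<in> configs" "\<mu> \<notin> ground_configs"
      then obtain l r where "hybrid_zone \<mu> l r"
        using ground_configs_hybrid_zone by blast
      then have "1 \<le> card (rises \<mu>)"
        by (rule hybrid_zone.rises_pos)
      then show "L inversions \<mu> \<le> - 1"
        using True \<mu> by (simp add: generator_inversions)
    qed (auto simp: inversions_nonneg)
    \<comment> \<open>200 / 25 = 8, which covers 2 f^(1/5) and 3 times 2 f^(1/5) for f \<ge>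
      1.\<close>
    define V where "V = (\<lambda>\<mu>. inversions \<mu> + 200 * spread \<mu> powr (4/5))"
    have "moment (1/5) \<nu> \<le> ennreal (V \<nu>)" if "\<nu> \<in> configs" for \<nu>
    proof (rule moment_le[where g = "\<lambda>\<mu>. 2
        + 3 * (1 + inversions \<mu>) powr (1/5)", OF _ _ rate_bounded _ _ that])
      fix \<mu> assume \<mu>: "\<mu> \<in> configs" "\<mu> \<notin> ground_configs"
      then obtain l r where "hybrid_zone \<mu> l r"
        using ground_configs_hybrid_zone by blast
      then have f: "1 \<le> inversions \<mu>"
        by (rule hybrid_zone.inversions_pos)
      have "L V \<mu> = L inversions \<mu> + 200 * L (\<lambda>\<mu>. spread \<mu> powr (4/5)) \<mu>"
        unfolding V_def by (rule generator_add_mult[OF \<mu>(1)])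
      also have "\<dots> \<le> 0 + 200 * (- (inversions \<mu> powr (1/5) / 25))"
        using True \<mu> voter_spread_drift[of \<mu>] by (intro add_mono mult_left_mono) (auto simp: generator_inversions)
      finally have "L V \<mu> \<le> - 8 * inversions \<mu> powr (1/5)"
        by simp
      moreover have "1 \<le> inversions \<mu> powr (1/5)"
        using f by (intro ge_one_powr_ge_zero) auto
      moreover have "(1 + inversions \<mu>) powr (1/5) \<le> 2 * inversions \<mu> powr (1/5)"
      proof -
        have "(1 + inversions \<mu>) powr (1/5) \<le> (2 * inversions \<mu>) powr (1/5)"
          using f by (intro powr_mono2) auto
        also have "\<dots> = 2 powr (1/5) * inversions \<mu> powr (1/5)"
          using f by (simp add: powr_mult)
        also have "\<dots> \<le> 2 powr 1 * inversions \<mu> powr (1/5)"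
          by (intro mult_right_mono powr_mono) auto
        finally show ?thesis by simp
      qed
      ultimately show "L V \<mu> \<le> - (2 + 3 * (1 + inversions \<mu>) powr (1/5))"
        by simp
      show "ennreal (2 powr (1/5)) + ennreal (2 * (1/5)) * moment (1/5 - 1) \<mu>
          \<le> ennreal (2 + 3 * (1 + inversions \<mu>) powr (1/5))"
        using first[OF \<mu>(1)] inversions_nonneg by (rule small)
    qed (auto simp: V_def inversions_nonneg)
    moreover have "V \<nu> \<le> 200 * (1 + spread \<nu> + inversions \<nu>)" for \<nu>
    proof -
      have "spread \<nu> powr (4/5) \<le> (1 + spread \<nu>) powr (4/5)"
        using spread_nonneg[of \<nu>] by (intro powr_mono2) auto
      also have "\<dots> \<le> (1 + spread \<nu>) powr 1"
        using spread_nonneg[of \<nu>] by (intro powr_mono) auto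
      finally show ?thesis
        using spread_nonneg[of \<nu>] inversions_nonneg[of \<nu>] by (simp add: V_def)
    qed
    ultimately show ?thesis
      by (intro exI[of _ 200]) (auto intro: order_trans[OF _ ennreal_leI])
  next
    case False
    then have \<beta>_lt: "\<beta> < 1"
      using \<beta> by simp
    obtain V D where D: "0 \<le> D" and V: "\<And>\<nu>. inversions \<nu> \<le> V \<nu>"
      "\<And>\<nu>. V \<nu> \<le> D * (1 + spread \<nu> + inversions \<nu>)"
      "\<And>\<nu>. \<nu> \<in> configs - ground_configs \<Longrightarrow> V \<nu> \<le> D * fall_area \<nu> ^ 3"
      "\<And>\<nu>. \<nu> \<in> configs - ground_configs \<Longrightarrow> L V \<nu> \<le> - fall_area \<nu>"
      using linear_lyapunov[OF p_gt \<beta>_lt] by metis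
    have V_nonneg: "0 \<le> V \<nu>" for \<nu>
      using V(1)[of \<nu>] inversions_nonneg[of \<nu>] by simp
    have area: "2 \<le> fall_area \<mu>" if "\<mu> \<in> configs" "\<mu> \<notin> ground_configs" for \<mu>
      using that ground_configs_hybrid_zone[of \<mu>] hybrid_zone.fall_area_ge_2 by blast
    have first: "moment 0 \<nu> \<le> ennreal (V \<nu>)" if "\<nu> \<in> configs" for \<nu>
    proof (rule moment_le[where g = "\<lambda>_. 1", OF _ V_nonneg rate_bounded[OF V(1)] _ _ that])
      show "L V \<mu> \<le> - 1" if "\<mu> \<in> configs" "\<mu> \<notin> ground_configs" for \<mu>
        using V(4)[of \<mu>] area[OF that] that by simp
    qed auto
    \<comment> \<open>Chosen so that 2 G + 3 (1 + D) G = J G with G the fall area. Writing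
      \<open>V2\<close> as V + (J - 1) V fits \<open>generator_add_mult\<close>.\<close>
    define J where "J = 5 + 3 * D"
    define V2 where "V2 = (\<lambda>\<mu>. V \<mu> + (J - 1) * V \<mu>)"
    have V2: "V2 \<mu> = J * V \<mu>" for \<mu>
      by (simp add: V2_def algebra_simps)
    have V_le_V2: "V \<mu> \<le> V2 \<mu>" for \<mu>
      using V_nonneg[of \<mu>] D by (simp add: V2_def J_def)
    have "moment (1/5) \<nu> \<le> ennreal (V2 \<nu>)" if "\<nu> \<in> configs" for \<nu>
    proof (rule moment_le[where g = "\<lambda>\<mu>. J * fall_area \<mu>", OF _ _ rate_bounded _ _ that])
      show "inversions \<mu> \<le> V2 \<mu>" for \<mu>
        using V(1) V_le_V2 by (rule order_trans)
      show "0 \<le> V2 \<mu>" for \<mu>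
        using V_nonneg V_le_V2 by (rule order_trans)
      fix \<mu> assume \<mu>: "\<mu> \<in> configs" "\<mu> \<notin> ground_configs"
      have "L V2 \<mu> = L V \<mu> + (J - 1) * L V \<mu>"
        unfolding V2_def by (rule generator_add_mult[OF \<mu>(1)])
      also have "\<dots> = J * L V \<mu>"
        by (simp add: algebra_simps)
      also have "\<dots> \<le> J * (- fall_area \<mu>)"
        using V(4)[of \<mu>] \<mu> D by (intro mult_left_mono) (auto simp: J_def)
      finally show "L V2 \<mu> \<le> - (J * fall_area \<mu>)"
        by simp
      have "2 + 3 * (1 + V \<mu>) powr (1/5) \<le> J * fall_area \<mu>"
      proof -
        define G where "G = fall_area \<mu>"
        have G: "2 \<le> G"
          using area[OF \<mu>] by (simp add: G_def)
        \<comment> \<open>The cubic bound is relaxed to the fifth power so that the fifth root is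
          exactly linear in G.\<close>
        have "1 + V \<mu> \<le> 1 * G ^ 5 + D * G ^ 5"
        proof (rule add_mono)
          show "1 \<le> 1 * G ^ 5"
            using one_le_power[of G 5] G by simp
          have "V \<mu> \<le> D * G ^ 3"
            using V(3)[of \<mu>] \<mu> by (simp add: G_def)
          also have "\<dots> \<le> D * G ^ 5"
            using G D by (intro mult_left_mono power_increasing) auto
          finally show "V \<mu> \<le> D * G ^ 5" .
        qed
        then have "(1 + V \<mu>) powr (1/5) \<le> ((1 + D) * G ^ 5) powr (1/5)"
          using V_nonneg[of \<mu>] by (intro powr_mono2) (auto simp: algebra_simps)
        also have "\<dots> = (1 + D) powr (1/5) * G"
        proof -
          have "(G ^ 5) powr (1/5) = (G powr 5) powr (1/5)"
            using G by (simp add: powr_numeral)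
          also have "\<dots> = G"
            using G by (simp only: powr_powr) simp
          finally show ?thesis
            using D G by (simp add: powr_mult)
        qed
        also have "\<dots> \<le> (1 + D) powr 1 * G"
          using D G by (intro mult_right_mono powr_mono) auto
        finally have "(1 + V \<mu>) powr (1/5) \<le> (1 + D) * G"
          using D by simp
        then have "2 + 3 * (1 + V \<mu>) powr (1/5) \<le> 2 * G + 3 * ((1 + D) * G)"
          using G by (intro add_mono mult_left_mono) auto
        also have "\<dots> = J * G"
          by (simp add: J_def algebra_simps)
        finally show ?thesis
          by (simp add: G_def)
      qed
      then show "ennreal (2 powr (1/5)) + ennreal (2 * (1/5)) * moment (1/5 - 1) \<mu>
          \<le> ennreal (J * fall_area \<mu>)"
        by (intro order_trans[OF small[OF first[OF \<mu>(1)] V_nonneg]] ennreal_leI)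
    qed auto
    moreover have "V2 \<nu> \<le> J * D * (1 + spread \<nu> + inversions \<nu>)" for \<nu>
      using mult_left_mono[OF V(2)[of \<nu>], of J] D unfolding V2 by (simp add: J_def mult.assoc)
    ultimately show ?thesis
      using D by (intro exI[of _ "J * D"]) (auto simp: J_def intro: order_trans[OF _ ennreal_leI])
  qed
qed

end

section \<open>Moments of the relaxation time\<close>

text \<open>On the second half of the interval up to \<tau> = x the weight is at least (x / 2) powr
  r, so the integral is at least (x / 2) powr (r + 1). The summand 1 covers orders s < r + 1 when x
  < 1; for infinite \<tau> the integral diverges.\<close>

lemma hit_functional_ge:
  fixes hit_free :: "real \<Rightarrow> bool"
  assumes r: "0 \<le> r" and s: "0 \<le> s" "s \<le> r + 1"
    and free: "\<And>t. 0 \<le> t \<Longrightarrow> ennreal t < \<tau> \<Longrightarrow> hit_free t"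
  shows "ennreal_powr \<tau> s
    \<le> 1 + ennreal (2 powr (r + 1)) * (\<integral>\<^sup>+t. ennreal ((1 + t) powr r) * indicator {t. 0 \<le> t \<and> hit_free t} t \<partial>lborel)"
    (is "_ \<le> 1 + ennreal _ * ?H")
proof (cases \<tau>)
  case top
  have "(\<integral>\<^sup>+t. 1 * indicator {0::real..} t \<partial>lborel) \<le> ?H"
  proof (rule nn_integral_mono)
    fix t :: real
    have "ennreal 1 \<le> ennreal ((1 + t) powr r)" if "0 \<le> t"
      using that r by (intro ennreal_leI ge_one_powr_ge_zero) auto
    then show "1 * indicator {0..} t \<le> ennreal ((1 + t) powr r) * indicator {t. 0 \<le> t \<and> hit_free t} t"
      using free[of t] top by (auto simp: indicator_def)
  qed
  moreover have "emeasure lborel {0::real..} = \<infinity>"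
  proof (rule ccontr)
    assume "emeasure lborel {0::real..} \<noteq> \<infinity>"
    then obtain x where x: "emeasure lborel {0::real..} = ennreal x" "0 \<le> x"
      by (cases "emeasure lborel {0::real..}") auto
    have "emeasure lborel {0..x + 1} \<le> emeasure lborel {0::real..}"
      by (rule emeasure_mono) auto
    then show False
      using x by simp
  qed
  ultimately have "?H = \<infinity>"
    by (simp add: top_unique)
  then show ?thesis
    by (simp add: ennreal_mult_top)
next
  case (real x)
  have "ennreal (x powr (r + 1)) \<le> ennreal (2 powr (r + 1)) * ?H"
  proof (cases "x = 0")
    case False
    then have x: "0 < x"
      using real by simp
    have "ennreal ((x / 2) powr r) * ennreal (x / 2)
        = (\<integral>\<^sup>+t. ennreal ((x / 2) powr r) * indicator {x / 2..<x} t \<partial>lborel)"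
      using x by (subst nn_integral_cmult_indicator) auto
    also have "\<dots> \<le> ?H"
    proof (rule nn_integral_mono)
      fix t :: real
      have "ennreal ((x / 2) powr r) \<le> ennreal ((1 + t) powr r)" if "x / 2 \<le> t"
        using that x r by (intro ennreal_leI powr_mono2) auto
      then show "ennreal ((x / 2) powr r) * indicator {x / 2..<x} t
          \<le> ennreal ((1 + t) powr r) * indicator {t. 0 \<le> t \<and> hit_free t} t"
        using free[of t] x unfolding real by (auto simp: indicator_def ennreal_less_iff)
    qed
    finally have "ennreal (2 powr (r + 1)) * (ennreal ((x / 2) powr r) * ennreal (x / 2))
        \<le> ennreal (2 powr (r + 1)) * ?H"
      by (rule mult_left_mono) simp
    moreover have "2 powr (r + 1) * ((x / 2) powr r * (x / 2)) = x powr (r + 1)"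
      using x by (simp add: powr_divide powr_add)
    ultimately show ?thesis
      using x by (simp add: ennreal_mult[symmetric])
  qed simp
  moreover have "ennreal_powr \<tau> s \<le> 1 + ennreal (x powr (r + 1))"
  proof -
    have "x powr s \<le> 1 + x powr (r + 1)"
    proof (cases "x \<le> 1")
      case True
      then have "x powr s \<le> 1"
        using real s by (intro powr_le1) auto
      then show ?thesis
        using powr_ge_zero[of x "r + 1"] by linarith
    next
      case False
      then have "x powr s \<le> x powr (r + 1)"
        using s by (intro powr_mono) auto
      then show ?thesis by simp
    qed
    then have "ennreal (x powr s) \<le> ennreal (1 + x powr (r + 1))"
      by (rule ennreal_leI)
    then show ?thesis
      using real by (auto simp: ennreal_powr_def)
  qed
  ultimately show ?thesis
    by (meson add_left_mono order_trans)
qed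

lemma dyadic_between:
  fixes a b :: real
  assumes "0 \<le> a" "a < b"
  obtains j n :: nat where "a < real j * (1 / 2 ^ n)" "real j * (1 / 2 ^ n) < b"
proof -
  obtain n where n: "(1 / 2) ^ n < b - a"
    using real_arch_pow_inv[of "b - a" "1 / 2"] assms by auto
  define j where "j = nat (\<lfloor>a * 2 ^ n\<rfloor> + 1)"
  have j: "real j = of_int \<lfloor>a * 2 ^ n\<rfloor> + 1"
    using assms by (simp add: j_def)
  have "a * 2 ^ n < real j" "real j \<le> a * 2 ^ n + 1"
    unfolding j by linarith+
  moreover have "a * 2 ^ n + 1 < b * 2 ^ n"
    using n by (simp add: power_divide field_simps)
  ultimately show thesis
    by (intro that[of j n]) (auto simp: field_simps)
qed

theorem corollary1:
  fixes M :: "'a measure" and \<beta> p :: real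
    and \<eta> :: "real \<Rightarrow> 'a \<Rightarrow> config set" and S0 :: "config set"
  assumes "0 \<le> \<beta>" "\<beta> \<le> 1" "0 \<le> p" "p \<le> 1"
    and "S0 \<in> config_classes"
    and "exclusion_voter_process M \<beta> p \<eta>"
    and "\<P>(\<omega> in M. \<eta> 0 \<omega> = S0) > 0"
  shows "(p < 1/2 \<and> 4/7 \<le> \<beta> \<longrightarrow>
            \<P>(\<omega> in M. relaxation_time \<eta> \<omega> < \<infinity> \<bar> \<eta> 0 \<omega> = S0) = 1) \<and>
         (\<beta> = 0 \<and> 1/2 < p \<longrightarrow> (\<forall>s\<ge>0.
            cond_nn_expectation M (\<lambda>\<omega>. ennreal_powr (relaxation_time \<eta> \<omega>) s)
              (\<lambda>\<omega>. \<eta> 0 \<omega> = S0) < \<infinity>)) \<and>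
         (1/2 < p \<longrightarrow>
            cond_nn_expectation M (\<lambda>\<omega>. ennreal_powr (relaxation_time \<eta> \<omega>) (6/5))
              (\<lambda>\<omega>. \<eta> 0 \<omega> = S0) < \<infinity>)"
proof -
  obtain X where X: "markov_process M configs (exclusion_voter_generator \<beta> p) X"
    and \<eta>: "\<And>t \<omega>. 0 \<le> t \<Longrightarrow> \<omega> \<in> space M \<Longrightarrow> \<eta> t \<omega> = config_class (X t \<omega>)"
    using assms(6) unfolding exclusion_voter_process_def by blast
  have prob: "prob_space M" and X_meas: "\<And>t. 0 \<le> t \<Longrightarrow> X t \<in> measurable M (count_space configs)"
    and right_cont: "\<And>\<omega> t. \<omega> \<in> space M \<Longrightarrow> 0 \<le> t \<Longrightarrow> \<forall>\<^sub>F s in at_right t. X s \<omega> = X t \<omega>"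
    using X unfolding markov_process_def by blast+
  obtain K where K: "transition_function configs K" "has_generator configs K (exclusion_voter_generator \<beta> p)"
    and markov: "\<And>s t j. 0 \<le> s \<Longrightarrow> 0 \<le> t \<Longrightarrow> j \<in> configs \<Longrightarrow> AE \<omega> in M.
      real_cond_exp M (natural_filtration M X s) (indicator {\<omega>'. X (s + t) \<omega>' = j}) \<omega> = pmf (K t (X s \<omega>)) j"
    using X unfolding markov_process_def by blast
  interpret prob_space M by (rule prob)
  interpret exclusion_voter_semigroup \<beta> p K
    using assms(1-4) K by unfold_locales
  interpret taboo_process M configs K ground_configs X
    using countable_configs X_meas markov by unfold_locales
  \<comment> \<open>The class of S0 contains all translates, and the law of \<open>X 0\<close> among
    them is unknown; translation invariance makes the bounds uniform on \<open>D\<close>.\<close>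
  define D where "D = {\<nu>\<in>configs. config_class \<nu> = S0}"
  have start: "{\<omega>\<in>space M. \<eta> 0 \<omega> = S0} = {\<omega>\<in>space M. X 0 \<omega> \<in> D}"
    using \<eta> X_in_S[of 0] by (auto simp: D_def)
  have start_sets[measurable]: "{\<omega>\<in>space M. X 0 \<omega> \<in> D} \<in> sets M"
    by (intro X_sets order_refl)
  have start_pos: "0 < prob {\<omega>\<in>space M. X 0 \<omega> \<in> D}"
    using assms(7) unfolding start .
  obtain \<nu>0 where \<nu>0: "\<nu>0 \<in> configs" "S0 = config_class \<nu>0"
    using assms(5) unfolding config_classes_def config_class_def by (auto elim: quotientE)
  have invariant: "inversions \<nu> = inversions \<nu>0 \<and> spread \<nu> = spread \<nu>0" if "\<nu> \<in> D" for \<nu>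
  proof -
    have "(\<nu>0, \<nu>) \<in> translate_rel"
      using that \<nu>0 eq_equiv_class_iff[OF equiv_translate_rel] unfolding D_def config_class_def by auto
    then show ?thesis
      using translate_invariant by blast
  qed
  have hit: "\<eta> t \<omega> = ground_state \<longleftrightarrow> X t \<omega> \<in> ground_configs" if "0 \<le> t" "\<omega> \<in> space M" for t \<omega>
    using \<eta>[OF that] X_in_S[OF that] by (auto simp: ground_configs_def)
  \<comment> \<open>Any dyadic hit bounds the relaxation time from above, so no dyadic hit can
    precede it; this one direction suffices for moments.\<close>
  have moments: "cond_nn_expectation M (\<lambda>\<omega>. ennreal_powr (relaxation_time \<eta> \<omega>) s) (\<lambda>\<omega>. \<eta> 0 \<omega> = S0) < \<infinity>"
    if r: "0 \<le> r" and s: "0 \<le> s" "s \<le> r + 1" and C: "\<And>\<nu>. \<nu> \<in> D \<Longrightarrow> moment r \<nu> \<le> ennreal C" for r s C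
  proof -
    let ?c = "ennreal (2 powr (r + 1))" and ?E = "{\<omega>\<in>space M. X 0 \<omega> \<in> D}"
    have "ennreal_powr (relaxation_time \<eta> \<omega>) s \<le> 1 + ?c * hit_functional r \<omega>" if \<omega>: "\<omega> \<in> space M" for \<omega>
      unfolding hit_functional_def
    proof (rule hit_functional_ge[OF r s])
      fix t :: real assume t: "0 \<le> t" "ennreal t < relaxation_time \<eta> \<omega>"
      show "no_hit t \<omega>"
        unfolding no_hit_def
      proof (intro allI impI notI)
        fix n j :: nat
        let ?q = "real j * (1 / 2 ^ n)"
        assume q: "?q \<le> t" "X ?q \<omega> \<in> ground_configs"
        then have "relaxation_time \<eta> \<omega> \<le> ennreal ?q"
          unfolding relaxation_time_def using hit[of ?q \<omega>] \<omega> by (intro Inf_lower) auto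
        also have "\<dots> \<le> ennreal t"
          using q by (intro ennreal_leI)
        finally show False
          using t by simp
      qed
    qed
    then have "cond_nn_expectation M (\<lambda>\<omega>. ennreal_powr (relaxation_time \<eta> \<omega>) s) (\<lambda>\<omega>. \<eta> 0 \<omega> = S0)
        \<le> (\<integral>\<^sup>+\<omega>. 1 + ?c * hit_functional r \<omega> \<partial>uniform_measure M ?E)"
      unfolding cond_nn_expectation_def start by (intro nn_integral_mono) simp
    also have "\<dots> = (\<integral>\<^sup>+\<omega>. (1 + ?c * hit_functional r \<omega>) * indicator ?E \<omega> \<partial>M) / emeasure M ?E"
      by (intro nn_integral_uniform_measure) measurable
    also have "(\<integral>\<^sup>+\<omega>. (1 + ?c * hit_functional r \<omega>) * indicator ?E \<omega> \<partial>M)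
        = (\<integral>\<^sup>+\<omega>. indicator ?E \<omega> + ?c * (hit_functional r \<omega> * indicator ?E \<omega>) \<partial>M)"
      by (intro nn_integral_cong) (simp add: distrib_right mult.assoc)
    also have "\<dots> = emeasure M ?E + ?c * (\<integral>\<^sup>+\<omega>. hit_functional r \<omega> * indicator ?E \<omega> \<partial>M)"
      by (subst nn_integral_add) (auto simp: nn_integral_cmult)
    also have "\<dots> / emeasure M ?E \<le> (1 + ?c * ennreal C) / emeasure M ?E"
      using C by (intro divide_right_mono_ennreal add_mono mult_left_mono emeasure_le_1 hit_functional_le) (auto simp: D_def)
    also have "\<dots> < \<infinity>"
      using start_pos by (simp add: ennreal_divide_eq_top_iff less_top[symmetric] emeasure_eq_measure ennreal_mult_eq_top_iff)
    finally show ?thesis .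
  qed
  have "\<P>(\<omega> in M. relaxation_time \<eta> \<omega> < \<infinity> \<bar> \<eta> 0 \<omega> = S0) = 1" if \<beta>_ge: "4/7 \<le> \<beta>"
  proof -
    let ?E = "{\<omega>\<in>space M. X 0 \<omega> \<in> D}"
    let ?F = "{\<omega>\<in>space M. (\<exists>n j::nat. X (real j * (1 / 2 ^ n)) \<omega> \<in> ground_configs) \<and> X 0 \<omega> \<in> D}"
    have F_sets: "?F \<in> sets M"
      by (intro sets.sets_Collect_conj sets.sets_Collect_countable_Ex X_sets) auto
    have "relaxation_time \<eta> \<omega> < \<infinity> \<longleftrightarrow> (\<exists>n j::nat. X (real j * (1 / 2 ^ n)) \<omega> \<in> ground_configs)"
      if \<omega>: "\<omega> \<in> space M" for \<omega>
    proof
      assume "relaxation_time \<eta> \<omega> < \<infinity>"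
      then obtain t where t: "0 \<le> t" "X t \<omega> \<in> ground_configs"
        unfolding relaxation_time_def Inf_less_iff using hit \<omega> by blast
      \<comment> \<open>By right-continuity the path stays at a ground configuration for a short
        while after t, and that interval contains a dyadic time. Thus the event of relaxing is a
        dyadic, hence measurable, event.\<close>
      obtain b where b: "t < b" "\<And>s. t < s \<Longrightarrow> s < b \<Longrightarrow> X s \<omega> = X t \<omega>"
        using right_cont[OF \<omega> t(1)] unfolding eventually_at_right_field by blast
      obtain j n :: nat where "t < real j * (1 / 2 ^ n)" "real j * (1 / 2 ^ n) < b"
        using dyadic_between[OF t(1) b(1)] .
      then show "\<exists>n j::nat. X (real j * (1 / 2 ^ n)) \<omega> \<in> ground_configs"
        using b(2) t(2) by metis
    next
      assume "\<exists>n j::nat. X (real j * (1 / 2 ^ n)) \<omega> \<in> ground_configs"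
      then obtain n j :: nat where "X (real j * (1 / 2 ^ n)) \<omega> \<in> ground_configs"
        by blast
      then have "relaxation_time \<eta> \<omega> \<le> ennreal (real j * (1 / 2 ^ n))"
        unfolding relaxation_time_def using hit[of "real j * (1 / 2 ^ n)" \<omega>] \<omega> by (intro Inf_lower) auto
      then show "relaxation_time \<eta> \<omega> < \<infinity>"
        by (auto intro: order_le_less_trans)
    qed
    then have "{\<omega>\<in>space M. relaxation_time \<eta> \<omega> < \<infinity> \<and> \<eta> 0 \<omega> = S0} = ?F"
      using start by blast
    moreover have "prob ?F = prob ?E"
    proof (rule finite_measure_eq_AE)
      have "AE \<omega> in M. X 0 \<omega> \<in> D \<longrightarrow> (\<exists>n j::nat. X (real j * (1 / 2 ^ n)) \<omega> \<in> ground_configs)"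
        using recurrent[OF \<beta>_ge] by (intro AE_hit) (auto simp: D_def)
      then show "AE \<omega> in M. \<omega> \<in> ?F \<longleftrightarrow> \<omega> \<in> ?E"
        by eventually_elim auto
    qed (use F_sets start_sets in auto)
    ultimately show ?thesis
      using start_pos unfolding cond_prob_def start by simp
  qed
  moreover have "cond_nn_expectation M (\<lambda>\<omega>. ennreal_powr (relaxation_time \<eta> \<omega>) s) (\<lambda>\<omega>. \<eta> 0 \<omega> = S0) < \<infinity>"
    if \<beta>_eq: "\<beta> = 0" and p_gt: "1/2 < p" and "0 \<le> s" for s
  proof -
    obtain k :: nat where k: "s \<le> real k"
      using real_arch_simple by blast
    obtain C where "\<And>\<nu>. \<nu> \<in> configs \<Longrightarrow>
        moment (real k) \<nu> \<le> ennreal (C * (1 + spread \<nu> + inversions \<nu>) ^ Suc k)"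
      using exclusion_moment[OF p_gt \<beta>_eq, of k] by blast
    then have "\<And>\<nu>. \<nu> \<in> D \<Longrightarrow> moment (real k) \<nu> \<le> ennreal (C * (1 + spread \<nu>0 + inversions \<nu>0) ^ Suc k)"
      using invariant by (metis (no_types, lifting) D_def mem_Collect_eq)
    then show ?thesis
      using k \<open>0 \<le> s\<close> by (intro moments[of "real k"]) auto
  qed
  moreover have "cond_nn_expectation M (\<lambda>\<omega>. ennreal_powr (relaxation_time \<eta> \<omega>) (6/5)) (\<lambda>\<omega>. \<eta> 0 \<omega>
      = S0) < \<infinity>"
    if p_gt: "1/2 < p"
  proof -
    obtain C where "\<And>\<nu>. \<nu> \<in> configs \<Longrightarrow> moment (1/5) \<nu> \<le> ennreal (C * (1 + spread \<nu> + inversions \<nu>))"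
      using moment_one_fifth[OF p_gt] by blast
    then have "\<And>\<nu>. \<nu> \<in> D \<Longrightarrow> moment (1/5) \<nu> \<le> ennreal (C * (1 + spread \<nu>0 + inversions \<nu>0))"
      using invariant by (metis (no_types, lifting) D_def mem_Collect_eq)
    then show ?thesis
      by (intro moments[of "1/5"]) auto
  qed
  ultimately show ?thesis
    by blast
qed

end
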